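(* For every $n\ge 3$ and $d\ge 3$, one has \[ \mathscr N_{n,d}\subseteq \mathscr V_{n,d}^{\mathrm{red}}. \] In particular, $\mathscr V_{n,d}^{\mathrm{red}}$ is nonempty.
   Context: $k$ is an algebraically closed field of characteristic zero, $R=k[x_1,\ldots,x_n]$ is the standard graded polynomial ring with graded pieces $R_m$, and for $f\in R_d$ the gradient ideal is $J_f=(\partial f/\partial x_1,\ldots,\partial f/\partial x_n)$, with degree-$m$ piece $(J_f)_m$. Set $T=n(d-2)$. $\mathbb{P}((J_f)_m)\subseteq\mathbb{P}(R_m)$ is the projective linear subspace attached to $(J_f)_m$, of codimension $\dim_k R_m-\dim_k (J_f)_m$. The Veronese variety $V_n^m\subseteq \mathbb{P}(R_m)$ is the image of $\mathbb{P}(R_1)\to\mathbb{P}(R_m)$, $[\ell]\mapsto[\ell^m]$. A reduced hypersurface $V(f)\subseteq\mathbb{P}_k^{n-1}$ is called Veronese-Avoiding if (I) $\mathrm{codim}_{\mathbb{P}(R_{T-1})}\mathbb{P}((J_f)_{T-1})=n$ and (II) $\mathbb{P}((J_f)_{T-1})\cap V_n^{T-1}=\emptyset$. $\mathscr V_{n,d}=\{[f]\in\mathbb{P}(R_d)\mid V(f)\text{ is Veronese-Avoiding}\}$, $\mathscr R_{n,d}\subseteq\mathbb{P}(R_d)$ is the open locus of reduced hypersurfaces, and $\mathscr V_{n,d}^{\mathrm{red}}=\mathscr V_{n,d}\cap\mathscr R_{n,d}$. $\mathscr N_{n,d}\subseteq\mathbb{P}(R_d)$ is the locus of reduced hypersurfaces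 of degree $d$ whose singular locus consists of exactly $n$ nodes (ordinary double points) in general linear position, meaning that the $n$ points span $\mathbb{P}_k^{n-1}$. *)

theory Defs
  imports
    "HOL-Analysis.Analysis"
    "HOL-Library.Poly_Mapping"
    "HOL-Computational_Algebra.Computational_Algebra"
begin

section \<open>The polynomial ring and its graded pieces\<close>

text \<open>
  The ring \<open>R = k[x\<^sub>1, \<dots>, x\<^sub>n]\<close> is the monoid algebra of the exponent vectors
  \<open>'n \<Rightarrow>\<^sub>0 nat\<close>, where \<open>'n\<close> is an arbitrary finite type and \<open>n = CARD('n)\<close>.
  The ring operations are the convolution operations of \<open>Poly_Mapping\<close>.
\<close>

type_synonym ('n, 'k) mpoly = "('n \<Rightarrow>\<^sub>0 nat) \<Rightarrow>\<^sub>0 'k"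

definition smult_mpoly :: "'k::field \<Rightarrow> ('n, 'k) mpoly \<Rightarrow> ('n, 'k) mpoly" where
  "smult_mpoly c f = Poly_Mapping.single 0 c * f"

interpretation mpoly: vector_space smult_mpoly
  by unfold_locales
    (simp_all add: smult_mpoly_def algebra_simps single_add mult_single
      flip: mult.assoc)

definition total_degree :: "('n::finite \<Rightarrow>\<^sub>0 nat) \<Rightarrow> nat" where
  "total_degree m = (\<Sum>i\<in>UNIV. Poly_Mapping.lookup m i)"

definition graded_piece :: "nat \<Rightarrow> ('n::finite, 'k::field) mpoly set" where
  "graded_piece m = {f. \<forall>\<mu>\<in>Poly_Mapping.keys f. total_degree \<mu> = m}"

definition eval_mpoly :: "('n::finite, 'k::field) mpoly \<Rightarrow> 'k ^ 'n \<Rightarrow> 'k" where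
  "eval_mpoly f p =
     (\<Sum>\<mu>\<in>Poly_Mapping.keys f.
        Poly_Mapping.lookup f \<mu> * (\<Prod>i\<in>UNIV. (p $ i) ^ Poly_Mapping.lookup \<mu> i))"

text \<open>
  The truncated subtraction of exponent vectors is harmless: it truncates only where
  \<open>x\<^sub>i\<close> does not occur in the monomial, and then the coefficient is zero.
\<close>

definition partial :: "'n::finite \<Rightarrow> ('n, 'k::field) mpoly \<Rightarrow> ('n, 'k) mpoly" where
  "partial i f =
     (\<Sum>\<mu>\<in>Poly_Mapping.keys f.
        Poly_Mapping.single (\<mu> - Poly_Mapping.single i 1)
          (of_nat (Poly_Mapping.lookup \<mu> i) * Poly_Mapping.lookup f \<mu>))"

definition gradient_ideal :: "('n::finite, 'k::field) mpoly \<Rightarrow> ('n, 'k) mpoly set" where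
  "gradient_ideal f = {(\<Sum>i\<in>UNIV. a i * partial i f) | a. True}"

definition gradient_ideal_piece ::
    "('n::finite, 'k::field) mpoly \<Rightarrow> nat \<Rightarrow> ('n, 'k) mpoly set" where
  "gradient_ideal_piece f m = gradient_ideal f \<inter> graded_piece m"


section \<open>Projective spaces\<close>

text \<open>
  The point \<open>[v]\<close> of a projective space is the line spanned by \<open>v\<close>. The scalar
  multiplication is a parameter, because both the spaces \<open>R\<^sub>m\<close> and the
  coordinate space \<open>k\<^sup>n\<close> are projectivised.
\<close>

definition proj_point :: "('k::field \<Rightarrow> 'v \<Rightarrow> 'v) \<Rightarrow> 'v \<Rightarrow> 'v set" where
  "proj_point sm v = {sm c v | c. True}"

definition proj_space :: "('k::field \<Rightarrow> 'v \<Rightarrow> 'v) \<Rightarrow> 'v::zero set \<Rightarrow> 'v set set" where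
  "proj_space sm V = proj_point sm ` (V - {0})"

definition veronese :: "nat \<Rightarrow> ('n::finite, 'k::field) mpoly set set" where
  "veronese m = {proj_point smult_mpoly (l ^ m) | l. l \<in> graded_piece 1 \<and> l \<noteq> 0}"

text \<open>
  Codimension of \<open>\<bbbP>(W)\<close> in \<open>\<bbbP>(V)\<close> for finite-dimensional
  subspaces \<open>W \<subseteq> V\<close> of the polynomial ring.
\<close>

definition proj_codim ::
    "('n::finite, 'k::field) mpoly set \<Rightarrow> ('n, 'k) mpoly set \<Rightarrow> int" where
  "proj_codim V W = int (mpoly.dim V) - int (mpoly.dim W)"


section \<open>Veronese-Avoiding hypersurfaces\<close>

text \<open>
  A hypersurface \<open>V(f)\<close> is reduced iff \<open>f\<close> has no multiple factor.
\<close>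

definition reduced_hypersurface :: "('n::finite, 'k::field) mpoly \<Rightarrow> bool" where
  "reduced_hypersurface f \<longleftrightarrow> squarefree f"

definition veronese_avoiding :: "nat \<Rightarrow> ('n::finite, 'k::field) mpoly \<Rightarrow> bool" where
  "veronese_avoiding d f \<longleftrightarrow>
     (let T = CARD('n) * (d - 2) in
        reduced_hypersurface f \<and>
        proj_codim (graded_piece (T - 1)) (gradient_ideal_piece f (T - 1)) = int CARD('n) \<and>
        proj_space smult_mpoly (gradient_ideal_piece f (T - 1)) \<inter> veronese (T - 1) = {})"

definition VA_locus :: "nat \<Rightarrow> ('n::finite, 'k::field) mpoly set set" where
  "VA_locus d =
     {proj_point smult_mpoly f | f. f \<in> graded_piece d \<and> f \<noteq> 0 \<and> veronese_avoiding d f}"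

definition reduced_locus :: "nat \<Rightarrow> ('n::finite, 'k::field) mpoly set set" where
  "reduced_locus d =
     {proj_point smult_mpoly f | f. f \<in> graded_piece d \<and> f \<noteq> 0 \<and> reduced_hypersurface f}"

definition VA_red_locus :: "nat \<Rightarrow> ('n::finite, 'k::field) mpoly set set" where
  "VA_red_locus d = VA_locus d \<inter> reduced_locus d"


section \<open>Nodal hypersurfaces\<close>

definition singular_locus :: "('n::finite, 'k::field) mpoly \<Rightarrow> ('k ^ 'n) set set" where
  "singular_locus f =
     {proj_point (*s) p | p.
        p \<noteq> 0 \<and> eval_mpoly f p = 0 \<and> (\<forall>i. eval_mpoly (partial i f) p = 0)}"

text \<open>
  Substitution of \<open>1\<close> for \<open>x\<^sub>i\<close>: the equation of the hypersurface in the affine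
  chart \<open>x\<^sub>i \<noteq> 0\<close>, as a polynomial in the remaining variables.
\<close>

definition dehomogenize :: "'n::finite \<Rightarrow> ('n, 'k::field) mpoly \<Rightarrow> ('n, 'k) mpoly" where
  "dehomogenize i f =
     (\<Sum>\<mu>\<in>Poly_Mapping.keys f.
        Poly_Mapping.single (Poly_Mapping.update i 0 \<mu>) (Poly_Mapping.lookup f \<mu>))"

text \<open>
  An ordinary double point: in an affine chart \<open>x\<^sub>i \<noteq> 0\<close> around the point, with affine
  coordinates \<open>x\<^sub>j\<close>, \<open>j \<noteq> i\<close>, the local equation and its gradient vanish at the point, and
  its Hessian (a symmetric bilinear form on the \<open>(n-1)\<close>-dimensional space
  \<open>v\<^sub>i = 0\<close>) is nondegenerate there.
\<close>

definition is_node :: "('n::finite, 'k::field) mpoly \<Rightarrow> ('k ^ 'n) set \<Rightarrow> bool" where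
  "is_node f P \<longleftrightarrow>
     (\<exists>i p. P = proj_point (*s) p \<and> p $ i = 1 \<and>
        (let g = dehomogenize i f in
           eval_mpoly g p = 0 \<and>
           (\<forall>j. j \<noteq> i \<longrightarrow> eval_mpoly (partial j g) p = 0) \<and>
           (\<forall>v :: 'k ^ 'n.
              v $ i = 0 \<and>
              (\<forall>j. j \<noteq> i \<longrightarrow>
                 (\<Sum>l\<in>UNIV - {i}. eval_mpoly (partial j (partial l g)) p * v $ l) = 0)
              \<longrightarrow> v = 0)))"

definition nodal_locus :: "nat \<Rightarrow> ('n::finite, 'k::field) mpoly set set" where
  "nodal_locus d =
     {proj_point smult_mpoly f | f.
        f \<in> graded_piece d \<and> f \<noteq> 0 \<and> reduced_hypersurface f \<and>
        finite (singular_locus f) \<and> card (singular_locus f) = CARD('n) \<and>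
        (\<forall>P\<in>singular_locus f. is_node f P) \<and>
        vec.span (\<Union>(singular_locus f)) = UNIV}"

end

theory Submission
  imports Defs
begin

text \<open>
  Let \<open>J\<close> be the gradient ideal of a hypersurface whose singular points are \<open>n\<close> nodes spanning the space, and
  \<open>T = n (d - 2)\<close>. The inclusion of loci follows from one equality: the piece of \<open>J\<close> in degree \<open>T - 1\<close> consists of
  all forms that vanish at the nodes. Linearly independent points impose independent conditions, so the
  codimension is \<open>n\<close>; and if a power of a linear form vanishes at points that span the space, the linear form is
  zero (\<open>veronese_avoiding_of_nodes\<close>).

  For the equality, choose coordinates in which the nodes are the coordinate points. The forms through them are
  those whose monomials are mixed, that is, contain two different variables. At a node the partial derivatives
  generate the ideal of the point locally; together with the Nullstellensatz, which is proved here by extending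
  points along the adjunction of one variable after the other, this shows that \<open>J\<close> contains all mixed monomials
  of sufficiently high degree (\<open>mixed_monomials_in_ideal\<close>). The point is to get down to degree \<open>T - 1\<close>
  (\<open>mixed_forms_below_socle_degree\<close>).

  The partial derivatives \<open>g\<^sub>i\<close> have common zeros, so they are replaced by the complete intersection
  \<open>x\<^sub>i\<^sup>M + g\<^sub>i\<close> with large \<open>M\<close>. It has an explicit residue functional (\<open>residue_multiple\<close>), for which the Bezoutian is a
  reproducing kernel (\<open>residue_reproducing\<close>): every polynomial is recovered, modulo the family, as the residue in
  \<open>x\<close> of its product with the Bezoutian. For a mixed form \<open>u\<close> of degree \<open>T - 1\<close>, multiplied by a polynomial with constant
  term \<open>1\<close> that localises at the origin (\<open>localising_multiplier\<close>), everything that involves \<open>x\<^sub>i\<^sup>M\<close> drops out in degree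
  \<open>T - 1\<close>. So \<open>u\<close> is, modulo \<open>J\<close>, a combination of those coefficients of the Bezoutian of the \<open>g\<^sub>i\<close> that belong to the
  monomials \<open>x\<^sub>i\<close>; setting \<open>x\<close> to a coordinate point shows that they lie in \<open>J\<close>
  (\<open>bezoutian_linear_coefficient\<close>).

  The locus is nonempty because nodal hypersurfaces of this kind exist in every degree \<open>d \<ge> 3\<close>: the third elementary
  symmetric polynomial for \<open>d = 3\<close> (\<open>nodal_cubic\<close>), and for \<open>d \<ge> 4\<close> the homogenization of \<open>\<Sum>Q\<^sub>i(x\<^sub>i) = 1\<close>, with
  univariate polynomials \<open>Q\<^sub>i\<close> whose critical values add up to \<open>1\<close> in exactly \<open>n\<close> ways
  (\<open>nodal_hypersurface_exists\<close>).
\<close>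

section \<open>Polynomials as a monoid algebra\<close>

abbreviation (input) lookup :: "('a \<Rightarrow>\<^sub>0 'b::zero) \<Rightarrow> 'a \<Rightarrow> 'b" where "lookup \<equiv> Poly_Mapping.lookup"
abbreviation (input) single :: "'a \<Rightarrow> 'b::zero \<Rightarrow> 'a \<Rightarrow>\<^sub>0 'b" where "single \<equiv> Poly_Mapping.single"
abbreviation (input) keys :: "('a \<Rightarrow>\<^sub>0 'b::zero) \<Rightarrow> 'a set" where "keys \<equiv> Poly_Mapping.keys"

abbreviation Var :: "'n \<Rightarrow> ('n \<Rightarrow>\<^sub>0 nat) \<Rightarrow>\<^sub>0 'r::comm_ring_1" where
  "Var i \<equiv> single (single i (Suc 0)) 1"

abbreviation Const :: "'r \<Rightarrow> ('n \<Rightarrow>\<^sub>0 nat) \<Rightarrow>\<^sub>0 'r::comm_ring_1" where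
  "Const c \<equiv> single 0 c"

lemma poly_mapping_sum_single:
  "f = (\<Sum>\<mu>\<in>keys f. single \<mu> (lookup f \<mu>))"
proof (rule poly_mapping_eqI)
  fix k
  show "lookup f k = lookup
    (\<Sum>\<mu>\<in>keys f. single \<mu> (lookup f \<mu>)) k"
    by (auto simp: lookup_sum lookup_single when_def not_in_keys_iff_lookup_eq_zero)
qed

lemma poly_mapping_induct_single [case_names zero single add]:
  fixes f :: "'a \<Rightarrow>\<^sub>0 'b::comm_monoid_add"
  assumes "P 0" and "\<And>\<mu> c. P (single \<mu> c)" and "\<And>f g. P f \<Longrightarrow> P g \<Longrightarrow> P (f + g)"
  shows "P f"
proof -
  have "P (\<Sum>\<mu>\<in>A. single \<mu> (lookup f \<mu>))" if "finite A" for A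
    using that by (induction A rule: finite_induct) (auto intro: assms)
  then show ?thesis using poly_mapping_sum_single[of f] by (metis finite_keys)
qed

lemma total_degree_0 [simp]: "total_degree 0 = 0"
  by (simp add: total_degree_def)

lemma total_degree_add [simp]: "total_degree (\<mu> + \<nu>) = total_degree \<mu> + total_degree \<nu>"
  by (simp add: total_degree_def lookup_add sum.distrib)

lemma total_degree_single [simp]: "total_degree (single i a) = a"
  by (simp add: total_degree_def lookup_single when_def)

lemma total_degree_eq_0_iff [simp]: "total_degree \<mu> = 0 \<longleftrightarrow> \<mu> = 0"
  by (auto simp: total_degree_def poly_mapping_eq_iff fun_eq_iff)

lemma exponent_induct [case_names zero add_single]:
  fixes \<mu> :: "'n::finite \<Rightarrow>\<^sub>0 nat"
  assumes "P 0" and "\<And>\<mu> i. P \<mu> \<Longrightarrow> P (\<mu> + single i (Suc 0))"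
  shows "P \<mu>"
proof -
  have "P \<mu>" if "total_degree \<mu> = m" for m \<mu>
    using that
  proof (induction m arbitrary: \<mu>)
    case 0
    then have "\<mu> = 0" by (intro poly_mapping_eqI) (auto simp: total_degree_def)
    then show ?case using assms(1) by simp
  next
    case (Suc m)
    then have "total_degree \<mu> \<noteq> 0" by simp
    then obtain i where i: "lookup \<mu> i \<noteq> 0"
      unfolding total_degree_def by (auto dest: sum.not_neutral_contains_not_neutral)
    define \<nu> where "\<nu> = \<mu> - single i (Suc 0)"
    have \<mu>: "\<mu> = \<nu> + single i (Suc 0)"
    proof (rule poly_mapping_eqI)
      fix k
      show "lookup \<mu> k = lookup (\<nu> + single i (Suc 0)) k"
        using i by (cases "k = i") (auto simp: \<nu>_def lookup_add lookup_minus lookup_single when_def)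
    qed
    have "total_degree \<mu> = total_degree \<nu> + total_degree (single i (Suc 0))"
      unfolding \<mu> by (rule total_degree_add)
    then have "total_degree \<nu> = m" using Suc.prems by simp
    from assms(2)[OF Suc.IH[OF this], of i] show ?case using \<mu> by simp
  qed
  then show ?thesis by blast
qed

subsection \<open>Substitution\<close>

definition ring_map :: "('a::comm_ring_1 \<Rightarrow> 'b::comm_ring_1) \<Rightarrow> bool" where
  "ring_map h \<longleftrightarrow> h 1 = 1 \<and> (\<forall>x y. h (x + y) = h x + h y) \<and> (\<forall>x y. h (x * y) = h x * h y)"

lemma ring_mapD:
  assumes "ring_map h"
  shows "h 0 = 0" "h 1 = 1" "h (x + y) = h x + h y" "h (x * y) = h x * h y" "h (- x) = - h x"
    "h (x - y) = h x - h y" "h (x ^ m) = h x ^ m"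
    "h (sum f A) = (\<Sum>a\<in>A. h (f a))" "h (prod f A) = (\<Prod>a\<in>A. h (f a))"
proof -
  show 0: "h 0 = 0" using assms unfolding ring_map_def by (metis add_cancel_right_right)
  show 1: "h 1 = 1" and add: "\<And>x y. h (x + y) = h x + h y" and mul: "\<And>x y. h (x * y) = h x * h y"
    using assms unfolding ring_map_def by auto
  show neg: "h (- x) = - h x" for x using add[of x "-x"] 0 by (simp add: eq_neg_iff_add_eq_0 add.commute)
  show "h (x - y) = h x - h y" using add[of x "-y"] neg by simp
  show "h (x ^ m) = h x ^ m" by (induction m) (auto simp: 1 mul)
  show "h (sum f A) = (\<Sum>a\<in>A. h (f a))" by (induction A rule: infinite_finite_induct) (auto simp: 0 add)
  show "h (prod f A) = (\<Prod>a\<in>A. h (f a))" by (induction A rule: infinite_finite_induct) (auto simp: 1 mul)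
qed

lemma ring_map_id: "ring_map (\<lambda>x. x)" by (simp add: ring_map_def)

lemma ring_map_Const: "ring_map (Const :: 'r::comm_ring_1 \<Rightarrow> ('n \<Rightarrow>\<^sub>0 nat) \<Rightarrow>\<^sub>0 'r)"
  by (simp add: ring_map_def single_add mult_single)

lemma ring_map_comp: "ring_map f \<Longrightarrow> ring_map g \<Longrightarrow> ring_map (\<lambda>x. f (g x))"
  by (simp add: ring_map_def)

text \<open>
  The ring map that extends \<open>\<iota>\<close> on the coefficients and sends the variables to \<open>\<phi>\<close>.
\<close>

definition insert_vars ::
    "('r::comm_ring_1 \<Rightarrow> 's::comm_ring_1) \<Rightarrow> ('n::finite \<Rightarrow> 's) \<Rightarrow> (('n \<Rightarrow>\<^sub>0 nat) \<Rightarrow>\<^sub>0 'r) \<Rightarrow> 's" where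
  "insert_vars \<iota> \<phi> f =
     (\<Sum>\<mu>\<in>keys f. \<iota> (lookup f \<mu>) * (\<Prod>i\<in>UNIV. \<phi> i ^ lookup \<mu> i))"

lemma insert_vars_superset:
  assumes "ring_map \<iota>" "finite A" "keys f \<subseteq> A"
  shows "insert_vars \<iota> \<phi> f =
     (\<Sum>\<mu>\<in>A. \<iota> (lookup f \<mu>) * (\<Prod>i\<in>UNIV. \<phi> i ^ lookup \<mu> i))"
  unfolding insert_vars_def using assms
  by (intro sum.mono_neutral_left) (auto simp: not_in_keys_iff_lookup_eq_zero ring_mapD)

lemma insert_vars_single:
  assumes "ring_map \<iota>"
  shows "insert_vars \<iota> \<phi> (single \<mu> c) = \<iota> c * (\<Prod>i\<in>UNIV. \<phi> i ^ lookup \<mu> i)"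
  by (subst insert_vars_superset[OF assms, of "{\<mu>}"]) auto

lemma insert_vars_add:
  assumes "ring_map \<iota>"
  shows "insert_vars \<iota> \<phi> (f + g) = insert_vars \<iota> \<phi> f + insert_vars \<iota> \<phi> g"
proof -
  let ?A = "keys f \<union> keys g"
  have "keys (f + g) \<subseteq> ?A" by (rule keys_add)
  then show ?thesis
    by (simp add: insert_vars_superset[OF assms, of ?A] lookup_add ring_mapD(3)[OF assms] sum.distrib
        distrib_right)
qed

lemma ring_map_insert_vars:
  assumes "ring_map \<iota>"
  shows "ring_map (insert_vars \<iota> \<phi>)"
  unfolding ring_map_def
proof (intro conjI allI)
  show "insert_vars \<iota> \<phi> 1 = 1"
    using insert_vars_single[OF assms, of \<phi> 0 1] by (simp add: ring_mapD[OF assms])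
  have 0: "insert_vars \<iota> \<phi> 0 = 0" by (simp add: insert_vars_def)
  show "insert_vars \<iota> \<phi> (f + g) = insert_vars \<iota> \<phi> f + insert_vars \<iota> \<phi> g" for f g
    by (rule insert_vars_add[OF assms])
  have s: "insert_vars \<iota> \<phi> (single \<mu> c * g)
      = insert_vars \<iota> \<phi> (single \<mu> c) * insert_vars \<iota> \<phi> g" for \<mu> c g
  proof (induction g rule: poly_mapping_induct_single)
    case (single \<nu> b)
    then show ?case
      by (simp add: mult_single insert_vars_single[OF assms] lookup_add power_add prod.distrib
          ring_mapD[OF assms])
  qed (auto simp: 0 insert_vars_add[OF assms] algebra_simps)
  show "insert_vars \<iota> \<phi> (f * g) = insert_vars \<iota> \<phi> f * insert_vars \<iota> \<phi> g" for f g
    by (induction f rule: poly_mapping_induct_single)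
      (simp_all add: 0 s insert_vars_add[OF assms] distrib_right)
qed

lemma insert_vars_Const [simp]: "ring_map \<iota> \<Longrightarrow> insert_vars \<iota> \<phi> (Const c) = \<iota> c"
  by (simp add: insert_vars_single)

lemma insert_vars_Var [simp]:
  assumes "ring_map \<iota>" shows "insert_vars \<iota> \<phi> (Var i) = \<phi> i"
proof -
  have "(\<Prod>j\<in>UNIV. \<phi> j ^ (if i = j then Suc 0 else 0)) = (\<Prod>j\<in>UNIV. if i = j then \<phi> j else 1)"
    by (intro prod.cong) auto
  then show ?thesis
    by (simp add: insert_vars_single assms lookup_single when_def ring_mapD[OF assms])
qed

lemma single_eq_Const_mult_Vars:
  "single \<mu> c = Const c * (\<Prod>i\<in>UNIV. Var i ^ lookup \<mu> i)"
  for \<mu> :: "'n::finite \<Rightarrow>\<^sub>0 nat"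
proof -
  have *: "(\<Prod>i\<in>UNIV. Var i ^ lookup \<mu> i) = single \<mu> (1::'b::comm_ring_1)"
    for \<mu> :: "'n \<Rightarrow>\<^sub>0 nat"
  proof (induction \<mu> rule: exponent_induct)
    case (add_single \<mu> i)
    have "(\<Prod>j\<in>UNIV. (Var j :: ('n \<Rightarrow>\<^sub>0 nat) \<Rightarrow>\<^sub>0 'b) ^ (if i = j then Suc 0 else 0))
        = (\<Prod>j\<in>UNIV. if i = j then Var j else 1)"
      by (intro prod.cong) auto
    then show ?case using add_single
      by (simp add: lookup_add power_add prod.distrib lookup_single when_def mult_single)
  qed auto
  show ?thesis unfolding * by (simp add: mult_single)
qed

lemma ring_map_eqI:
  fixes g h :: "(('n::finite \<Rightarrow>\<^sub>0 nat) \<Rightarrow>\<^sub>0 'r::comm_ring_1) \<Rightarrow> 's::comm_ring_1"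
  assumes "ring_map g" "ring_map h" "\<And>c. g (Const c) = h (Const c)" "\<And>i. g (Var i) = h (Var i)"
  shows "g f = h f"
proof (induction f rule: poly_mapping_induct_single)
  case (single \<mu> c)
  show ?case
    unfolding single_eq_Const_mult_Vars[of \<mu> c]
    by (simp add: ring_mapD[OF assms(1)] ring_mapD[OF assms(2)] assms(3) assms(4))
qed (auto simp: ring_mapD[OF assms(1)] ring_mapD[OF assms(2)])

lemma eval_mpoly_eq: "eval_mpoly f p = insert_vars (\<lambda>c. c) (($) p) f"
  by (simp add: eval_mpoly_def insert_vars_def)

lemma ring_map_eval: "ring_map (\<lambda>f. eval_mpoly f p)"
  unfolding eval_mpoly_eq by (rule ring_map_insert_vars[OF ring_map_id])

lemmas eval_simps = ring_mapD[OF ring_map_eval]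

lemma eval_single: "eval_mpoly (single \<mu> c) p = c * (\<Prod>i\<in>UNIV. p $ i ^ lookup \<mu> i)"
  by (simp add: eval_mpoly_eq insert_vars_single ring_map_id)

lemma eval_Const [simp]: "eval_mpoly (Const c) p = c"
  by (simp add: eval_mpoly_eq ring_map_id)

lemma eval_Var [simp]: "eval_mpoly (Var i) p = p $ i"
  by (simp add: eval_mpoly_eq ring_map_id)

subsection \<open>Ideals generated by a finite family\<close>

definition ideal_gen :: "('i::finite \<Rightarrow> 'r::comm_ring_1) \<Rightarrow> 'r set" where
  "ideal_gen g = {(\<Sum>i\<in>UNIV. a i * g i) | a. True}"

lemma ideal_genI: "(\<Sum>i\<in>UNIV. a i * g i) \<in> ideal_gen g"
  by (auto simp: ideal_gen_def)

lemma ideal_gen_0 [simp]: "0 \<in> ideal_gen g"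
  using ideal_genI[of "\<lambda>_. 0" g] by simp

lemma ideal_gen_add: "x \<in> ideal_gen g \<Longrightarrow> y \<in> ideal_gen g \<Longrightarrow> x + y \<in> ideal_gen g"
  unfolding ideal_gen_def
proof clarify
  fix a b :: "_ \<Rightarrow> _"
  show "\<exists>c. (\<Sum>i\<in>UNIV. a i * g i) + (\<Sum>i\<in>UNIV. b i * g i) = (\<Sum>i\<in>UNIV. c i * g i) \<and> True"
    by (rule exI[of _ "\<lambda>i. a i + b i"]) (simp add: sum.distrib algebra_simps)
qed

lemma ideal_gen_mult: "x \<in> ideal_gen g \<Longrightarrow> r * x \<in> ideal_gen g"
  unfolding ideal_gen_def
proof clarify
  fix a :: "_ \<Rightarrow> _"
  show "\<exists>c. r * (\<Sum>i\<in>UNIV. a i * g i) = (\<Sum>i\<in>UNIV. c i * g i) \<and> True"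
    by (rule exI[of _ "\<lambda>i. r * a i"]) (simp add: sum_distrib_left algebra_simps)
qed

lemma ideal_gen_mult_right: "x \<in> ideal_gen g \<Longrightarrow> x * r \<in> ideal_gen g"
  using ideal_gen_mult[of x g r] by (simp add: mult.commute)

lemma ideal_gen_uminus: "x \<in> ideal_gen g \<Longrightarrow> - x \<in> ideal_gen g"
  using ideal_gen_mult[of x g "-1"] by simp

lemma ideal_gen_diff: "x \<in> ideal_gen g \<Longrightarrow> y \<in> ideal_gen g \<Longrightarrow> x - y \<in> ideal_gen g"
  using ideal_gen_add[of x g "-y"] ideal_gen_uminus[of y g] by simp

lemma ideal_gen_sum: "(\<And>a. a \<in> A \<Longrightarrow> f a \<in> ideal_gen g) \<Longrightarrow> sum f A \<in> ideal_gen g"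
  by (induction A rule: infinite_finite_induct) (auto intro: ideal_gen_add)

lemma ideal_gen_base [simp]: "g i \<in> ideal_gen g"
proof -
  have "(\<Sum>j\<in>UNIV. (if j = i then 1 else 0) * g j) = g i"
    by (simp add: if_distrib[of "\<lambda>x. x * _"] cong: if_cong)
  then show ?thesis using ideal_genI[of "\<lambda>j. if j = i then 1 else 0" g] by simp
qed

lemma ideal_gen_cong: "x - y \<in> ideal_gen g \<Longrightarrow> x \<in> ideal_gen g \<longleftrightarrow> y \<in> ideal_gen g"
  using ideal_gen_add[of "x - y" g y] ideal_gen_diff[of x g "x - y"] by auto

lemma gradient_ideal_eq: "gradient_ideal f = ideal_gen (\<lambda>i. partial i f)"
  by (simp add: gradient_ideal_def ideal_gen_def)

subsection \<open>Graded pieces\<close>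

lemma graded_pieceI: "(\<And>\<mu>. lookup f \<mu> \<noteq> 0 \<Longrightarrow> total_degree \<mu> = m) \<Longrightarrow> f \<in> graded_piece m"
  by (auto simp: graded_piece_def in_keys_iff)

lemma graded_pieceD: "f \<in> graded_piece m \<Longrightarrow> lookup f \<mu> \<noteq> 0 \<Longrightarrow> total_degree \<mu> = m"
  by (auto simp: graded_piece_def in_keys_iff)

lemma graded_0 [simp]: "0 \<in> graded_piece m"
  by (simp add: graded_piece_def)

lemma graded_single: "total_degree \<mu> = m \<Longrightarrow> single \<mu> c \<in> graded_piece m"
  by (auto simp: graded_piece_def)

lemma graded_add: "f \<in> graded_piece m \<Longrightarrow> g \<in> graded_piece m \<Longrightarrow> f + g \<in> graded_piece m"
  using keys_add[of f g] by (auto simp: graded_piece_def)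

lemma graded_uminus: "f \<in> graded_piece m \<Longrightarrow> - f \<in> graded_piece m"
  by (auto simp: graded_piece_def)

lemma graded_diff: "f \<in> graded_piece m \<Longrightarrow> g \<in> graded_piece m \<Longrightarrow> f - g \<in> graded_piece m"
  using graded_add[of f m "-g"] graded_uminus[of g m] by simp

lemma graded_sum: "(\<And>a. a \<in> A \<Longrightarrow> f a \<in> graded_piece m) \<Longrightarrow> sum f A \<in> graded_piece m"
  by (induction A rule: infinite_finite_induct) (auto intro: graded_add)

lemma graded_mult: "f \<in> graded_piece m \<Longrightarrow> g \<in> graded_piece l \<Longrightarrow> f * g \<in> graded_piece (m + l)"
  using keys_mult[of f g] unfolding graded_piece_def
  by (smt (verit) mem_Collect_eq subsetD total_degree_add)

lemma graded_Const: "Const c \<in> graded_piece 0"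
  by (simp add: graded_single)

lemma graded_Var: "Var i \<in> graded_piece 1"
  by (simp add: graded_single)

lemma graded_power: "f \<in> graded_piece m \<Longrightarrow> f ^ a \<in> graded_piece (a * m)"
proof (induction a)
  case 0
  then show ?case using graded_Const[of 1] by simp
next
  case (Suc a)
  then show ?case using graded_mult[of f m "f ^ a" "a * m"] by simp
qed

lemma graded_prod:
  "(\<And>a. a \<in> A \<Longrightarrow> f a \<in> graded_piece (m a)) \<Longrightarrow> prod f A \<in> graded_piece (sum m A)"
  by (induction A rule: infinite_finite_induct) (use graded_Const[of 1] in \<open>auto intro: graded_mult\<close>)

definition hom_part :: "nat \<Rightarrow> ('n::finite, 'k::field) mpoly \<Rightarrow> ('n, 'k) mpoly" where
  "hom_part m f = (\<Sum>\<mu>\<in>keys f.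
     if total_degree \<mu> = m then single \<mu> (lookup f \<mu>) else 0)"

lemma lookup_hom_part:
  "lookup (hom_part m f) \<mu> = (if total_degree \<mu> = m then lookup f \<mu> else 0)"
proof -
  have "lookup (hom_part m f) \<mu>
    = (\<Sum>\<nu>\<in>keys f. if \<nu> = \<mu> then (if total_degree \<mu> = m then lookup f \<mu> else 0) else 0)"
    unfolding hom_part_def lookup_sum by (intro sum.cong) (auto simp: lookup_single when_def)
  then show ?thesis by (auto simp: in_keys_iff)
qed

lemma hom_part_add: "hom_part m (f + g) = hom_part m f + hom_part m g"
  by (intro poly_mapping_eqI) (auto simp: lookup_hom_part lookup_add)

lemma hom_part_diff: "hom_part m (f - g) = hom_part m f - hom_part m g"
  by (intro poly_mapping_eqI) (auto simp: lookup_hom_part lookup_minus)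

lemma hom_part_0 [simp]: "hom_part m 0 = 0"
  by (simp add: hom_part_def)

lemma hom_part_sum: "hom_part m (sum f A) = (\<Sum>a\<in>A. hom_part m (f a))"
  by (induction A rule: infinite_finite_induct) (auto simp: hom_part_add)

lemma hom_part_graded [simp]: "hom_part m f \<in> graded_piece m"
  by (auto intro!: graded_pieceI simp: lookup_hom_part split: if_splits)

lemma hom_part_id: "f \<in> graded_piece m \<Longrightarrow> hom_part m f = f"
  by (intro poly_mapping_eqI) (auto simp: lookup_hom_part dest: graded_pieceD)

lemma hom_part_other: "f \<in> graded_piece m \<Longrightarrow> m \<noteq> l \<Longrightarrow> hom_part l f = 0"
  by (intro poly_mapping_eqI) (auto simp: lookup_hom_part dest: graded_pieceD)

lemma hom_part_mult:
  assumes "g \<in> graded_piece l"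
  shows "hom_part m (a * g) = (if l \<le> m then hom_part (m - l) a * g else 0)"
proof (induction a rule: poly_mapping_induct_single)
  case (single \<mu> c)
  have s: "single \<mu> c * g \<in> graded_piece (total_degree \<mu> + l)"
    by (intro graded_mult graded_single assms refl)
  have t: "single \<mu> c \<in> graded_piece (total_degree \<mu>)" by (simp add: graded_single)
  show ?case
    using hom_part_id[OF s] hom_part_other[OF s, of m] hom_part_id[OF t] hom_part_other[OF t, of "m - l"]
    by (cases "m = total_degree \<mu> + l") auto
qed (auto simp: hom_part_add algebra_simps)

lemma sum_hom_part:
  assumes "\<And>\<mu>. lookup f \<mu> \<noteq> 0 \<Longrightarrow> total_degree \<mu> \<le> N"
  shows "f = (\<Sum>m\<le>N. hom_part m f)"
proof (rule poly_mapping_eqI)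
  fix \<mu>
  have "lookup (\<Sum>m\<le>N. hom_part m f) \<mu>
      = (\<Sum>m\<le>N. if m = total_degree \<mu> then lookup f \<mu> else 0)"
    unfolding lookup_sum lookup_hom_part by (intro sum.cong) auto
  then show "lookup f \<mu> = lookup (\<Sum>m\<le>N. hom_part m f) \<mu>"
    using assms[of \<mu>] by auto
qed

lemma total_degree_bounded: "\<exists>N. \<forall>\<mu>. lookup f \<mu> \<noteq> 0 \<longrightarrow> total_degree \<mu> \<le> N"
  for f :: "('n::finite \<Rightarrow>\<^sub>0 nat) \<Rightarrow>\<^sub>0 'k::zero"
proof -
  have "finite (total_degree ` keys f)" by simp
  then show ?thesis by (meson Max_ge finite_imageI finite_keys imageI in_keys_iff)
qed

lemma ideal_gen_hom_part:
  assumes g: "\<forall>i. g i \<in> graded_piece l" and "f \<in> ideal_gen g"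
  obtains a where "\<And>i. a i \<in> graded_piece (m - l)" "hom_part m f = (\<Sum>i\<in>UNIV. a i * g i)"
proof -
  obtain b where b: "f = (\<Sum>i\<in>UNIV. b i * g i)" using assms(2) by (auto simp: ideal_gen_def)
  show ?thesis
    by (rule that[of "\<lambda>i. if l \<le> m then hom_part (m - l) (b i) else 0"])
      (auto simp: b hom_part_sum hom_part_mult[OF spec[OF g]] intro!: sum.cong)
qed

lemma hom_part_in_ideal_gen:
  assumes "\<forall>i. g i \<in> graded_piece l" "f \<in> ideal_gen g"
  shows "hom_part m f \<in> ideal_gen g"
  using ideal_gen_hom_part[OF assms, of m] ideal_genI by metis

section \<open>The Nullstellensatz\<close>

definition is_ideal :: "'r::comm_ring_1 set \<Rightarrow> bool" where
  "is_ideal I \<longleftrightarrow> 0 \<in> I \<and> (\<forall>x\<in>I. \<forall>y\<in>I. x + y \<in> I) \<and> (\<forall>x\<in>I. \<forall>r. r * x \<in> I)"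

definition prime_ideal :: "'r::comm_ring_1 set \<Rightarrow> bool" where
  "prime_ideal P \<longleftrightarrow> is_ideal P \<and> 1 \<notin> P \<and> (\<forall>a b. a * b \<in> P \<longrightarrow> a \<in> P \<or> b \<in> P)"

lemma is_ideal_uminus: "is_ideal I \<Longrightarrow> x \<in> I \<Longrightarrow> - x \<in> I"
  unfolding is_ideal_def by (metis mult_minus1)

lemma is_ideal_diff: "is_ideal I \<Longrightarrow> x \<in> I \<Longrightarrow> y \<in> I \<Longrightarrow> x - y \<in> I"
  using is_ideal_uminus[of I y] unfolding is_ideal_def by (metis diff_conv_add_uminus)

lemma is_ideal_sum: "is_ideal I \<Longrightarrow> (\<And>a. a \<in> S \<Longrightarrow> f a \<in> I) \<Longrightarrow> sum f S \<in> I"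
  by (induction S rule: infinite_finite_induct) (auto simp: is_ideal_def)

lemma is_ideal_ideal_gen: "is_ideal (ideal_gen g)"
  by (auto simp: is_ideal_def ideal_gen_add ideal_gen_mult)

lemma prime_ideal_power: "prime_ideal P \<Longrightarrow> a ^ m \<in> P \<Longrightarrow> a \<in> P"
  by (induction m) (auto simp: prime_ideal_def)

text \<open>
  Zorn's lemma: an ideal that is maximal among the ideals over \<open>I\<close> without powers of \<open>s\<close> is prime, because
  enlarging it by \<open>a\<close> and by \<open>b\<close> yields two powers of \<open>s\<close> whose product lies in it when \<open>a b\<close> does.
\<close>

lemma exists_prime_ideal_avoiding_powers:
  fixes I :: "'r::comm_ring_1 set"
  assumes I: "is_ideal I" and s: "\<And>m. s ^ m \<notin> I"
  obtains P where "prime_ideal P" "I \<subseteq> P" "s \<notin> P"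
proof -
  define \<A> where "\<A> = {K. is_ideal K \<and> I \<subseteq> K \<and> (\<forall>m. s ^ m \<notin> K)}"
  have chain: "\<Union>\<C> \<in> \<A>" if ch: "\<C> \<noteq> {}" "subset.chain \<A> \<C>" for \<C>
  proof -
    have sub: "\<C> \<subseteq> \<A>" and tot: "\<And>X Y. X \<in> \<C> \<Longrightarrow> Y \<in> \<C> \<Longrightarrow> X \<subseteq> Y \<or> Y \<subseteq> X"
      using ch(2) unfolding subset_chain_def by auto
    have add: "x + y \<in> \<Union>\<C>" if xy: "x \<in> \<Union>\<C>" "y \<in> \<Union>\<C>" for x y
    proof -
      obtain X Y where XY: "X \<in> \<C>" "x \<in> X" "Y \<in> \<C>" "y \<in> Y" using xy by (elim UnionE)
      then obtain Z where "Z \<in> \<C>" "x \<in> Z" "y \<in> Z" using tot[of X Y] by blast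
      then show ?thesis using sub unfolding \<A>_def is_ideal_def by blast
    qed
    obtain X where X: "X \<in> \<C>" using ch(1) by blast
    have "is_ideal (\<Union>\<C>)"
      unfolding is_ideal_def
    proof (intro conjI ballI allI)
      show "0 \<in> \<Union>\<C>" using X sub unfolding \<A>_def is_ideal_def by blast
      show "x + y \<in> \<Union>\<C>" if "x \<in> \<Union>\<C>" "y \<in> \<Union>\<C>" for x y using add that .
      show "r * x \<in> \<Union>\<C>" if "x \<in> \<Union>\<C>" for x r
        using that sub unfolding \<A>_def is_ideal_def by blast
    qed
    moreover have "I \<subseteq> \<Union>\<C>" "\<forall>m. s ^ m \<notin> \<Union>\<C>"
      using X sub unfolding \<A>_def by blast+
    ultimately show ?thesis by (simp add: \<A>_def)
  qed
  have "I \<in> \<A>" using I s by (simp add: \<A>_def)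
  then obtain P where P: "P \<in> \<A>" and max: "\<And>X. X \<in> \<A> \<Longrightarrow> P \<subseteq> X \<Longrightarrow> X = P"
    using subset_Zorn_nonempty[of \<A>] chain by blast
  have id: "is_ideal P" and IP: "I \<subseteq> P" and sP: "\<And>m. s ^ m \<notin> P" using P by (auto simp: \<A>_def)
  have power: "\<exists>m x r. x \<in> P \<and> s ^ m = x + r * a" if a: "a \<notin> P" for a
  proof (rule ccontr)
    assume neg: "\<not> (\<exists>m x r. x \<in> P \<and> s ^ m = x + r * a)"
    define K where "K = {x + r * a | x r. x \<in> P}"
    have "is_ideal K"
      unfolding is_ideal_def
    proof (intro conjI ballI allI)
      show "0 \<in> K" unfolding K_def using id by (auto simp: is_ideal_def intro!: exI[of _ 0])
      show "x + y \<in> K" if xyK: "x \<in> K" "y \<in> K" for x y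
      proof -
        obtain u r v t where "x = u + r * a" "y = v + t * a" "u \<in> P" "v \<in> P"
          using xyK by (auto simp: K_def)
        then have "x + y = (u + v) + (r + t) * a" "u + v \<in> P"
          using id by (auto simp: algebra_simps is_ideal_def)
        then show ?thesis unfolding K_def by blast
      qed
      show "t * x \<in> K" if xK: "x \<in> K" for x t
      proof -
        obtain u r where "x = u + r * a" "u \<in> P" using xK by (auto simp: K_def)
        then have "t * x = t * u + (t * r) * a" "t * u \<in> P"
          using id by (auto simp: algebra_simps is_ideal_def)
        then show ?thesis unfolding K_def by blast
      qed
    qed
    moreover have PK: "P \<subseteq> K"
    proof
      fix x assume "x \<in> P"
      moreover have "x = x + 0 * a" by simp
      ultimately show "x \<in> K" unfolding K_def by blast
    qed
    moreover have "\<forall>m. s ^ m \<notin> K" using neg unfolding K_def by blast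
    ultimately have "K = P" using max[of K] IP by (auto simp: \<A>_def)
    moreover have "a \<in> K"
    proof -
      have "a = 0 + 1 * a" "0 \<in> P" using id by (auto simp: is_ideal_def)
      then show ?thesis unfolding K_def by blast
    qed
    ultimately show False using a by simp
  qed
  have "a \<in> P \<or> b \<in> P" if ab: "a * b \<in> P" for a b
  proof (rule ccontr)
    assume "\<not> (a \<in> P \<or> b \<in> P)"
    then obtain m x r l y t where xy: "x \<in> P" "s ^ m = x + r * a" "y \<in> P" "s ^ l = y + t * b"
      using power[of a] power[of b] by blast
    have "s ^ (m + l) = s ^ l * x + r * a * y + (r * t) * (a * b)"
      unfolding power_add by (simp add: xy algebra_simps)
    moreover have "s ^ l * x + r * a * y + (r * t) * (a * b) \<in> P"
      using xy(1,3) ab id unfolding is_ideal_def by blast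
    ultimately show False using sP by metis
  qed
  moreover have "1 \<notin> P" using sP[of 0] by simp
  moreover have "s \<notin> P" using sP[of 1] by simp
  ultimately show ?thesis using that id IP unfolding prime_ideal_def by blast
qed

subsection \<open>Extending points along the adjunction of an element\<close>

definition is_subring :: "'r::comm_ring_1 set \<Rightarrow> bool" where
  "is_subring A \<longleftrightarrow> 1 \<in> A \<and> (\<forall>x\<in>A. \<forall>y\<in>A. x - y \<in> A \<and> x * y \<in> A)"

lemma is_subringD:
  assumes "is_subring A"
  shows "1 \<in> A" "0 \<in> A" "x \<in> A \<Longrightarrow> - x \<in> A" "x \<in> A \<Longrightarrow> y \<in> A \<Longrightarrow> x + y \<in> A"
    "x \<in> A \<Longrightarrow> y \<in> A \<Longrightarrow> x - y \<in> A" "x \<in> A \<Longrightarrow> y \<in> A \<Longrightarrow> x * y \<in> A" "x \<in> A \<Longrightarrow> x ^ m \<in> A"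
    "(\<And>s. s \<in> S \<Longrightarrow> f s \<in> A) \<Longrightarrow> sum f S \<in> A"
proof -
  show 1: "1 \<in> A" and diff: "\<And>x y. x \<in> A \<Longrightarrow> y \<in> A \<Longrightarrow> x - y \<in> A"
    and mult: "\<And>x y. x \<in> A \<Longrightarrow> y \<in> A \<Longrightarrow> x * y \<in> A" using assms by (auto simp: is_subring_def)
  show 0: "0 \<in> A" using diff[OF 1 1] by simp
  show neg: "- x \<in> A" if "x \<in> A" for x using diff[OF 0 that] by simp
  show add: "x + y \<in> A" if "x \<in> A" "y \<in> A" for x y using diff[OF that(1) neg[OF that(2)]] by simp
  show "x \<in> A \<Longrightarrow> x ^ m \<in> A" by (induction m) (auto simp: 1 mult)
  show "(\<And>s. s \<in> S \<Longrightarrow> f s \<in> A) \<Longrightarrow> sum f S \<in> A"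
    by (induction S rule: infinite_finite_induct) (auto simp: 0 add)
qed

definition coeffs_in :: "'r::comm_ring_1 set \<Rightarrow> 'r poly \<Rightarrow> bool" where
  "coeffs_in A p \<longleftrightarrow> (\<forall>n. coeff p n \<in> A)"

lemma coeffs_in_intros:
  assumes "is_subring A"
  shows "coeffs_in A p \<Longrightarrow> coeffs_in A q \<Longrightarrow> coeffs_in A (p + q)"
    "coeffs_in A p \<Longrightarrow> coeffs_in A q \<Longrightarrow> coeffs_in A (p - q)"
    "coeffs_in A p \<Longrightarrow> coeffs_in A q \<Longrightarrow> coeffs_in A (p * q)"
    "a \<in> A \<Longrightarrow> coeffs_in A p \<Longrightarrow> coeffs_in A (smult a p)"
    "a \<in> A \<Longrightarrow> coeffs_in A (monom a n)" "a \<in> A \<Longrightarrow> coeffs_in A [:a:]" "coeffs_in A 0"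
  using is_subringD(2,4-6)[OF assms] unfolding coeffs_in_def coeff_mult
  by (auto simp: coeff_monom coeff_pCons split: nat.split intro!: is_subringD(8)[OF assms])

text \<open>
  Division with remainder by a polynomial whose leading coefficient \<open>coeff w D\<close> is not inverted, but
  multiplied to the dividend often enough.
\<close>

lemma pseudo_division:
  fixes p w :: "'r::comm_ring_1 poly"
  assumes A: "is_subring A" and w: "coeffs_in A w" "\<forall>n>D. coeff w n = 0"
    and "coeffs_in A p" "\<forall>n\<ge>N. coeff p n = 0"
  shows "\<exists>m q r. coeffs_in A q \<and> coeffs_in A r \<and> smult (coeff w D ^ m) p = w * q + r
    \<and> (\<forall>n\<ge>D. coeff r n = 0) \<and> (\<forall>n. N \<le> n + D \<longrightarrow> coeff q n = 0)"
  using assms(4,5)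
proof (induction N arbitrary: p)
  case 0
  then show ?case
    by (intro exI[of _ 0] exI[of _ 0] exI[of _ p]) (auto simp: coeffs_in_intros[OF A])
next
  case (Suc N)
  show ?case
  proof (cases "Suc N \<le> D")
    case True
    then show ?thesis using Suc.prems
      by (intro exI[of _ 0] exI[of _ 0] exI[of _ p]) (auto simp: coeffs_in_intros[OF A])
  next
    case False
    define c a where "c = coeff w D" and "a = coeff p N"
    have cA: "c \<in> A" "a \<in> A" using w Suc.prems by (auto simp: c_def a_def coeffs_in_def)
    define p1 where "p1 = smult c p - monom a (N - D) * w"
    have "coeffs_in A p1"
      unfolding p1_def using cA w Suc.prems by (intro coeffs_in_intros[OF A]) auto
    moreover have "coeff p1 n = 0" if "n \<ge> N" for n
    proof (cases "n = N")
      case True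
      then show ?thesis using False by (simp add: p1_def coeff_monom_mult c_def a_def)
    next
      case False
      then show ?thesis using that \<open>\<not> Suc N \<le> D\<close> Suc.prems(2) w(2)
        by (simp add: p1_def coeff_monom_mult)
    qed
    ultimately obtain m q r where IH: "coeffs_in A q" "coeffs_in A r"
      "smult (c ^ m) p1 = w * q + r" "\<forall>n\<ge>D. coeff r n = 0" "\<forall>n. N \<le> n + D \<longrightarrow> coeff q n = 0"
      using Suc.IH[of p1] unfolding c_def by blast
    have p: "smult c p = p1 + monom a (N - D) * w" by (simp add: p1_def)
    have "smult (c ^ Suc m) p = smult (c ^ m) (smult c p)" by (simp add: mult.commute)
    also have "\<dots> = w * (q + smult (c ^ m) (monom a (N - D))) + r"
      unfolding p smult_add_right IH(3) by (simp add: algebra_simps)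
    finally show ?thesis
      using IH cA is_subringD(7)[OF A] \<open>\<not> Suc N \<le> D\<close> unfolding c_def[symmetric]
      by (intro exI[of _ "Suc m"] exI[of _ "q + smult (c ^ m) (monom a (N - D))"] exI[of _ r])
        (auto simp: coeffs_in_intros[OF A] coeff_monom)
  qed
qed

text \<open>
  For a field \<open>k\<close> embedded by \<open>C\<close>, these are the \<open>k\<close>-rational points of the spectrum of \<open>A / (A \<inter> P)\<close>, as
  functions on the whole ring that are constrained on the subring \<open>A\<close>. This avoids forming quotients.
\<close>

definition point_on :: "('k::field \<Rightarrow> 'r::comm_ring_1) \<Rightarrow> 'r set \<Rightarrow> 'r set \<Rightarrow> ('r \<Rightarrow> 'k) \<Rightarrow> bool" where
  "point_on C P A \<phi> \<longleftrightarrow> (\<forall>x\<in>A. \<forall>y\<in>A. \<phi> (x + y) = \<phi> x + \<phi> y \<and> \<phi> (x * y) = \<phi> x * \<phi> y)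
     \<and> (\<forall>c. \<phi> (C c) = c) \<and> (\<forall>x\<in>A \<inter> P. \<phi> x = 0)"

text \<open>
  The strengthening of the existence of points that survives adjoining an element: extending a point may
  require that some element outside \<open>P\<close> is nonzero there.
\<close>

definition enough_points :: "('k::field \<Rightarrow> 'r::comm_ring_1) \<Rightarrow> 'r set \<Rightarrow> 'r set \<Rightarrow> bool" where
  "enough_points C P A \<longleftrightarrow> (\<forall>h\<in>A - P. \<exists>\<phi>. point_on C P A \<phi> \<and> \<phi> h \<noteq> 0)"

definition adjoin :: "'r::comm_ring_1 set \<Rightarrow> 'r \<Rightarrow> 'r set" where
  "adjoin A v = {poly p v | p. coeffs_in A p}"

lemma map_poly_point_on:
  fixes C :: "'k::field \<Rightarrow> 'r::comm_ring_1"
  assumes A: "is_subring A" and \<phi>: "point_on C P A \<phi>" and C: "ring_map C" "range C \<subseteq> A"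
  shows "coeff (map_poly \<phi> p) n = \<phi> (coeff p n)"
    "coeffs_in A p \<Longrightarrow> coeffs_in A q \<Longrightarrow> map_poly \<phi> (p + q) = map_poly \<phi> p + map_poly \<phi> q"
    "coeffs_in A p \<Longrightarrow> coeffs_in A q \<Longrightarrow> map_poly \<phi> (p * q) = map_poly \<phi> p * map_poly \<phi> q"
proof -
  have C0: "\<phi> 0 = 0" using \<phi> ring_mapD(1)[OF C(1)] unfolding point_on_def by metis
  show co: "coeff (map_poly \<phi> p) n = \<phi> (coeff p n)" for p n by (simp add: coeff_map_poly C0)
  have sum: "\<phi> (sum f S) = (\<Sum>s\<in>S. \<phi> (f s))" if "\<And>s. f s \<in> A" for f and S :: "nat set"
  proof (induction S rule: infinite_finite_induct)
    case (insert x F)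
    have "sum f F \<in> A" using that by (intro is_subringD(8)[OF A])
    then show ?case using insert \<phi> that[of x] by (simp add: point_on_def)
  qed (auto simp: C0)
  show "coeffs_in A p \<Longrightarrow> coeffs_in A q \<Longrightarrow> map_poly \<phi> (p + q) = map_poly \<phi> p + map_poly \<phi> q"
    using \<phi> by (intro poly_eqI) (auto simp: co coeffs_in_def point_on_def)
  show "map_poly \<phi> (p * q) = map_poly \<phi> p * map_poly \<phi> q" if "coeffs_in A p" "coeffs_in A q"
  proof (rule poly_eqI)
    fix n
    have "\<phi> (\<Sum>i\<le>n. coeff p i * coeff q (n - i)) = (\<Sum>i\<le>n. \<phi> (coeff p i * coeff q (n - i)))"
      using that is_subringD(6)[OF A] by (intro sum) (auto simp: coeffs_in_def)
    then show "coeff (map_poly \<phi> (p * q)) n = coeff (map_poly \<phi> p * map_poly \<phi> q) n"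
      using that \<phi> by (simp add: co coeff_mult coeffs_in_def point_on_def)
  qed
qed

text \<open>
  A point of \<open>A\<close> extends to \<open>A[v]\<close> by sending \<open>v\<close> to \<open>a\<close> as soon as \<open>a\<close> satisfies the images of all
  polynomial relations that \<open>v\<close> satisfies modulo \<open>P\<close>.
\<close>

lemma point_on_adjoin:
  fixes C :: "'k::field \<Rightarrow> 'r::comm_ring_1"
  assumes A: "is_subring A" and \<phi>: "point_on C P A \<phi>" and C: "ring_map C" "range C \<subseteq> A"
    and P: "prime_ideal P"
    and a: "\<And>q. coeffs_in A q \<Longrightarrow> poly q v \<in> P \<Longrightarrow> poly (map_poly \<phi> q) a = 0"
  shows "\<exists>\<psi>. point_on C P (adjoin A v) \<psi>
    \<and> (\<forall>q. coeffs_in A q \<longrightarrow> \<psi> (poly q v) = poly (map_poly \<phi> q) a)"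
proof -
  define \<psi> where "\<psi> x = poly (map_poly \<phi> (SOME q. coeffs_in A q \<and> poly q v = x)) a" for x
  note mp = map_poly_point_on[OF A \<phi> C]
  have P0: "0 \<in> P" using P by (simp add: prime_ideal_def is_ideal_def)
  have \<psi>: "\<psi> (poly q v) = poly (map_poly \<phi> q) a" if q: "coeffs_in A q" for q
  proof -
    define q' where "q' = (SOME q'. coeffs_in A q' \<and> poly q' v = poly q v)"
    have q': "coeffs_in A q'" "poly q' v = poly q v"
      using someI[of "\<lambda>q'. coeffs_in A q' \<and> poly q' v = poly q v" q] q unfolding q'_def by auto
    have d: "coeffs_in A (q' - q)" using q q' by (intro coeffs_in_intros[OF A])
    have "poly (map_poly \<phi> (q' - q)) a = 0" using q' P0 by (intro a d) auto
    moreover have "map_poly \<phi> q' = map_poly \<phi> (q' - q) + map_poly \<phi> q"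
      using mp(2)[OF d q] by simp
    ultimately show ?thesis unfolding \<psi>_def q'_def[symmetric] by simp
  qed
  have "point_on C P (adjoin A v) \<psi>"
    unfolding point_on_def
  proof (intro conjI ballI allI)
    fix x y assume "x \<in> adjoin A v" "y \<in> adjoin A v"
    then obtain p q where pq: "x = poly p v" "y = poly q v" "coeffs_in A p" "coeffs_in A q"
      by (auto simp: adjoin_def)
    show "\<psi> (x + y) = \<psi> x + \<psi> y"
      using \<psi>[of "p + q"] \<psi>[of p] \<psi>[of q] pq mp(2)[of p q] coeffs_in_intros(1)[OF A, of p q] by simp
    show "\<psi> (x * y) = \<psi> x * \<psi> y"
      using \<psi>[of "p * q"] \<psi>[of p] \<psi>[of q] pq mp(3)[of p q] coeffs_in_intros(3)[OF A, of p q] by simp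
  next
    fix c
    have "coeffs_in A [:C c:]" using C by (intro coeffs_in_intros[OF A]) auto
    moreover have "map_poly \<phi> [:C c:] = [:c:]"
    proof (rule poly_eqI)
      have "\<phi> 0 = 0" using \<phi> ring_mapD(1)[OF C(1)] unfolding point_on_def by metis
      then show "coeff (map_poly \<phi> [:C c:]) n = coeff [:c:] n" for n
        using \<phi> by (simp add: mp(1) coeff_pCons point_on_def split: nat.split)
    qed
    ultimately show "\<psi> (C c) = c" using \<psi>[of "[:C c:]"] by simp
  next
    fix x assume "x \<in> adjoin A v \<inter> P"
    then show "\<psi> x = 0" using \<psi> a by (auto simp: adjoin_def)
  qed
  then show ?thesis using \<psi> by blast
qed

lemma truncate_poly_mod_ideal:
  fixes p :: "'r::comm_ring_1 poly"
  assumes A: "is_subring A" and P: "is_ideal P" and p: "coeffs_in A p"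
    and N: "\<And>n. n \<ge> N \<Longrightarrow> coeff p n \<in> P"
  obtains q where "coeffs_in A q" "poly p v - poly q v \<in> P" "\<And>n. n \<ge> N \<Longrightarrow> coeff q n = 0"
    "\<And>n. n < N \<Longrightarrow> coeff q n = coeff p n"
proof -
  define q where "q = (\<Sum>i<N. monom (coeff p i) i)"
  have cq: "coeff q n = (if n < N then coeff p n else 0)" for n
    by (simp add: q_def coeff_sum coeff_monom)
  have "coeffs_in A q" using p is_subringD(2)[OF A] by (simp add: coeffs_in_def cq)
  moreover have "poly p v - poly q v \<in> P"
  proof -
    have "poly p v - poly q v = (\<Sum>i\<le>degree (p - q). coeff (p - q) i * v ^ i)"
      unfolding poly_diff[symmetric] by (rule poly_altdef)
    also have "\<dots> \<in> P"
      using P N by (intro is_ideal_sum) (auto simp: cq is_ideal_def mult.commute[of _ "v ^ _"])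
    finally show ?thesis .
  qed
  ultimately show ?thesis using that[of q] by (simp add: cq)
qed

text \<open>
  If \<open>v\<close> satisfies no relation modulo \<open>P\<close>, it may be sent to any field element that is not a root of
  the image of the polynomial representing \<open>h\<close>.
\<close>

lemma enough_points_adjoin_transcendental:
  fixes C :: "'k::{alg_closed_field,field_char_0} \<Rightarrow> 'r::comm_ring_1"
  assumes A: "is_subring A" and C: "ring_map C" "range C \<subseteq> A" and P: "prime_ideal P"
    and ep: "enough_points C P A"
    and tr: "\<And>p n. coeffs_in A p \<Longrightarrow> poly p v \<in> P \<Longrightarrow> coeff p n \<in> P"
  shows "enough_points C P (adjoin A v)"
  unfolding enough_points_def
proof
  fix h assume h: "h \<in> adjoin A v - P"
  then obtain \<eta> where \<eta>: "coeffs_in A \<eta>" "h = poly \<eta> v" by (auto simp: adjoin_def)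
  have id: "is_ideal P" using P by (simp add: prime_ideal_def)
  have "\<exists>i. coeff \<eta> i \<notin> P"
  proof (rule ccontr)
    assume "\<nexists>i. coeff \<eta> i \<notin> P"
    then have "(\<Sum>i\<le>degree \<eta>. coeff \<eta> i * v ^ i) \<in> P"
      using id by (intro is_ideal_sum) (auto simp: is_ideal_def mult.commute[of _ "v ^ _"])
    then show False using h by (simp add: \<eta> poly_altdef)
  qed
  then obtain i where i: "coeff \<eta> i \<notin> P" by blast
  then obtain \<phi> where \<phi>: "point_on C P A \<phi>" "\<phi> (coeff \<eta> i) \<noteq> 0"
    using ep \<eta> unfolding enough_points_def coeffs_in_def by blast
  note mp = map_poly_point_on[OF A \<phi>(1) C]
  have "map_poly \<phi> \<eta> \<noteq> 0" using \<phi>(2) mp(1)[of \<eta> i] by auto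
  then have "finite {a. poly (map_poly \<phi> \<eta>) a = 0}" by (rule poly_roots_finite)
  then obtain a where a: "poly (map_poly \<phi> \<eta>) a \<noteq> 0"
    using infinite_UNIV_char_0[where 'a='k] by (metis (mono_tags, lifting) UNIV_I finite_subset mem_Collect_eq subsetI)
  have "poly (map_poly \<phi> q) a = 0" if "coeffs_in A q" "poly q v \<in> P" for q
  proof -
    have "map_poly \<phi> q = 0"
      using tr[OF that] that(1) \<phi>(1) by (intro poly_eqI) (auto simp: mp(1) point_on_def coeffs_in_def)
    then show ?thesis by simp
  qed
  from point_on_adjoin[OF A \<phi>(1) C P this]
  show "\<exists>\<phi>. point_on C P (adjoin A v) \<phi> \<and> \<phi> h \<noteq> 0" using a \<eta> by metis
qed

text \<open>
  The algebraic case: a minimal relation \<open>p\<close> of \<open>v\<close> modulo \<open>P\<close>, with leading coefficient \<open>c\<close>,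
  divides all relations up to powers of \<open>c\<close>; and an element of \<open>A[v]\<close> outside \<open>P\<close> has a multiple
  \<open>\<epsilon> \<in> A - P\<close> modulo \<open>P\<close>. So every root of the image of \<open>p\<close> gives an extension of a point with
  \<open>c \<epsilon> \<noteq> 0\<close>.
\<close>

lemma enough_points_adjoin_algebraic:
  fixes C :: "'k::{alg_closed_field,field_char_0} \<Rightarrow> 'r::comm_ring_1"
  assumes A: "is_subring A" and C: "ring_map C" "range C \<subseteq> A" and P: "prime_ideal P"
    and ep: "enough_points C P A"
    and p: "coeffs_in A p" "poly p v \<in> P" "coeff p D \<notin> P" "\<forall>n>D. coeff p n = 0"
    and min: "\<And>r n. coeffs_in A r \<Longrightarrow> poly r v \<in> P \<Longrightarrow> (\<And>n. n \<ge> D \<Longrightarrow> coeff r n = 0) \<Longrightarrow> coeff r n \<in> P"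
  shows "enough_points C P (adjoin A v)"
  unfolding enough_points_def
proof
  fix h assume h: "h \<in> adjoin A v - P"
  then obtain \<eta> where \<eta>: "coeffs_in A \<eta>" "h = poly \<eta> v" by (auto simp: adjoin_def)
  have id: "is_ideal P" and prime: "\<And>a b. a * b \<in> P \<Longrightarrow> a \<in> P \<or> b \<in> P" and one: "1 \<notin> P"
    using P by (auto simp: prime_ideal_def)
  have Pmult: "\<And>x r. x \<in> P \<Longrightarrow> r * x \<in> P" and Padd: "\<And>x y. x \<in> P \<Longrightarrow> y \<in> P \<Longrightarrow> x + y \<in> P"
    using id by (auto simp: is_ideal_def)
  have Pdiff: "\<And>x y. x \<in> P \<Longrightarrow> y \<in> P \<Longrightarrow> x - y \<in> P" using is_ideal_diff[OF id] .
  define c where "c = coeff p D"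
  have cA: "c \<in> A" and cP: "\<And>m. c ^ m \<notin> P"
    using p(1,3) prime_ideal_power[OF P, of c] by (auto simp: c_def coeffs_in_def)
  have D: "D > 0"
  proof (rule ccontr)
    assume "\<not> D > 0"
    then have "p = [:c:]" using p(4) by (intro poly_eqI) (auto simp: c_def coeff_pCons split: nat.split)
    then show False using p(2) cP[of 1] by simp
  qed
  \<comment> \<open>The polynomials with value outside \<open>P\<close> that is a multiple of \<open>h\<close> modulo \<open>P\<close>. One of minimal
    degree turns out to be constant: its leading coefficient is the multiple \<open>\<epsilon>\<close> of \<open>h\<close>.\<close>
  define mult where "mult w \<longleftrightarrow> coeffs_in A w \<and> poly w v \<notin> P
    \<and> (\<exists>\<alpha>. coeffs_in A \<alpha> \<and> poly w v - h * poly \<alpha> v \<in> P)" for w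
  define E where "E = (LEAST E. \<exists>w. mult w \<and> (\<forall>n>E. coeff w n = 0))"
  have "mult \<eta>"
    unfolding mult_def using \<eta> h id is_subringD(1)[OF A]
    by (auto simp: is_ideal_def intro!: exI[of _ "[:1:]"] coeffs_in_intros[OF A])
  then have "\<exists>w. mult w \<and> (\<forall>n>degree \<eta>. coeff w n = 0)" by (auto intro!: exI[of _ \<eta>] coeff_eq_0)
  then have "\<exists>w. mult w \<and> (\<forall>n>E. coeff w n = 0)" unfolding E_def by (rule LeastI)
  then obtain w where w: "mult w" "\<forall>n>E. coeff w n = 0" by blast
  have Emin: "\<not> mult r" if "\<And>n. n \<ge> E \<Longrightarrow> coeff r n = 0" "E > 0" for r
  proof
    assume "mult r"
    moreover have "\<forall>n>E - 1. coeff r n = 0" using that by auto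
    ultimately have "\<exists>w. mult w \<and> (\<forall>n>E - 1. coeff w n = 0)" by blast
    then have "(LEAST E. \<exists>w. mult w \<and> (\<forall>n>E. coeff w n = 0)) \<le> E - 1" by (rule Least_le)
    then show False using that(2) unfolding E_def[symmetric] by simp
  qed
  obtain \<alpha> where \<alpha>: "coeffs_in A \<alpha>" "poly w v - h * poly \<alpha> v \<in> P" and wA: "coeffs_in A w" "poly w v \<notin> P"
    using w(1) by (auto simp: mult_def)
  define \<epsilon> where "\<epsilon> = coeff w E"
  have \<epsilon>A: "\<epsilon> \<in> A" using wA by (auto simp: \<epsilon>_def coeffs_in_def)
  have \<epsilon>P: "\<epsilon> \<notin> P"
  proof
    assume "\<epsilon> \<in> P"
    then have N: "coeff w n \<in> P" if "n \<ge> E" for n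
      using w(2) that id by (cases "n = E") (auto simp: \<epsilon>_def is_ideal_def)
    obtain q where q: "coeffs_in A q" "poly w v - poly q v \<in> P" "\<And>n. n \<ge> E \<Longrightarrow> coeff q n = 0"
      using N truncate_poly_mod_ideal[OF A id wA(1), of E v] by blast
    show False
    proof (cases "E = 0")
      case True
      then have "q = 0" using q(3) by (intro poly_eqI) auto
      then show False using q(2) wA(2) by simp
    next
      case False
      have "poly q v - h * poly \<alpha> v \<in> P"
        using Pdiff[OF \<alpha>(2) q(2)] by (simp add: algebra_simps)
      moreover have "poly q v \<notin> P" using Padd[OF q(2), of "poly q v"] wA(2) by auto
      ultimately have "mult q" using q(1) \<alpha>(1) by (auto simp: mult_def)
      then show False using Emin[of q] q(3) False by simp
    qed
  qed
  have multred: "mult r" if r: "coeffs_in A r" "poly r v \<notin> P" "poly r v = b * poly u v + x"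
    "x \<in> P" "mult u" "b \<in> adjoin A v" for r b u x
  proof -
    obtain \<beta> where \<beta>: "coeffs_in A \<beta>" "b = poly \<beta> v" using r(6) by (auto simp: adjoin_def)
    obtain \<gamma> where \<gamma>: "coeffs_in A \<gamma>" "poly u v - h * poly \<gamma> v \<in> P" using r(5) by (auto simp: mult_def)
    have "poly r v - h * poly (\<beta> * \<gamma>) v = b * (poly u v - h * poly \<gamma> v) + x"
      by (simp add: r(3) \<beta> algebra_simps)
    also have "\<dots> \<in> P" using Pmult[OF \<gamma>(2)] r(4) Padd by blast
    finally show ?thesis using r coeffs_in_intros(3)[OF A \<beta>(1) \<gamma>(1)] unfolding mult_def by blast
  qed
  have const_adj: "a \<in> adjoin A v" if "a \<in> A" for a
    unfolding adjoin_def using that coeffs_in_intros(6)[OF A that] by (auto intro!: exI[of _ "[:a:]"])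
  \<comment> \<open>Otherwise the remainder of \<open>w\<close> by \<open>p\<close> would be a multiple of \<open>h\<close> of smaller degree.\<close>
  have E_less: "E < D"
  proof (rule ccontr)
    assume "\<not> E < D"
    obtain m q r where d: "coeffs_in A q" "coeffs_in A r" "smult (c ^ m) w = p * q + r"
      "\<forall>n\<ge>D. coeff r n = 0"
      using pseudo_division[OF A p(1) p(4) wA(1), of "Suc E"] w(2) unfolding c_def Suc_le_eq by blast
    have ev: "c ^ m * poly w v = poly p v * poly q v + poly r v"
      using arg_cong[OF d(3), of "\<lambda>f. poly f v"] by simp
    have "c ^ m * poly w v \<notin> P" using prime cP wA(2) by blast
    then have "poly r v \<notin> P" using ev Pmult[OF p(2), of "poly q v"] Padd by (metis mult.commute)
    moreover have "poly r v = c ^ m * poly w v + (- (poly q v * poly p v))" using ev by (simp add: algebra_simps)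
    moreover have "- (poly q v * poly p v) \<in> P" using Pmult[OF p(2)] is_ideal_uminus[OF id] by blast
    ultimately have "mult r" using multred d(2) w(1) const_adj is_subringD(7)[OF A cA] by blast
    then show False using Emin[of r] d(4) \<open>\<not> E < D\<close> D by auto
  qed
  \<comment> \<open>Division of \<open>p\<close> by \<open>w\<close>: the remainder has too small a degree to be a multiple of \<open>h\<close> outside \<open>P\<close>,
    so up to a power of \<open>\<epsilon>\<close> the quotient would be a relation of smaller degree than \<open>p\<close>.\<close>
  have E0: "E = 0"
  proof (rule ccontr)
    assume "E \<noteq> 0"
    obtain m q r where d: "coeffs_in A q" "coeffs_in A r" "smult (\<epsilon> ^ m) p = w * q + r"
      "\<forall>n\<ge>E. coeff r n = 0" "\<forall>n. Suc D \<le> n + E \<longrightarrow> coeff q n = 0"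
      using pseudo_division[OF A wA(1) w(2) p(1), of "Suc D"] p(4) unfolding \<epsilon>_def Suc_le_eq by blast
    have ev: "\<epsilon> ^ m * poly p v = poly w v * poly q v + poly r v"
      using arg_cong[OF d(3), of "\<lambda>f. poly f v"] by simp
    have "poly r v = (- poly q v) * poly w v + \<epsilon> ^ m * poly p v" using ev by (simp add: algebra_simps)
    moreover have "- poly q v \<in> adjoin A v"
      unfolding adjoin_def using coeffs_in_intros(2)[OF A coeffs_in_intros(7)[OF A] d(1)]
      by (auto intro!: exI[of _ "- q"])
    ultimately have rP: "poly r v \<in> P"
      using multred[OF d(2), of "- poly q v" w] w(1) Pmult[OF p(2)] Emin[of r] d(4) \<open>E \<noteq> 0\<close> by blast
    then have "poly w v * poly q v \<in> P"
      using ev Pdiff[OF Pmult[OF p(2), of "\<epsilon> ^ m"] rP] by simp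
    then have "poly q v \<in> P" using prime wA(2) by blast
    then have qP: "coeff q n \<in> P" for n
      using min[OF d(1), of n] d(5) \<open>E \<noteq> 0\<close> by auto
    have "coeff r D \<in> P" by (rule min[OF d(2) rP]) (use d(4) E_less in auto)
    moreover have "coeff (w * q) D \<in> P"
      unfolding coeff_mult using qP Pmult by (intro is_ideal_sum[OF id]) auto
    ultimately have "\<epsilon> ^ m * c \<in> P"
      using arg_cong[OF d(3), of "\<lambda>f. coeff f D"] Padd by (simp add: c_def)
    then show False using prime prime_ideal_power[OF P] \<epsilon>P cP[of 1] by auto
  qed
  have weq: "w = [:\<epsilon>:]"
    using w(2) E0 by (intro poly_eqI) (auto simp: \<epsilon>_def coeff_pCons split: nat.split)
  have "c * \<epsilon> \<in> A - P" using is_subringD(6)[OF A cA \<epsilon>A] prime cP[of 1] \<epsilon>P by auto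
  then obtain \<phi> where \<phi>: "point_on C P A \<phi>" "\<phi> (c * \<epsilon>) \<noteq> 0"
    using ep unfolding enough_points_def by blast
  then have nz: "\<phi> c \<noteq> 0" "\<phi> \<epsilon> \<noteq> 0" using cA \<epsilon>A by (auto simp: point_on_def)
  note mp = map_poly_point_on[OF A \<phi>(1) C]
  have \<phi>0: "\<phi> x = 0" if "x \<in> P" "x \<in> A" for x using \<phi>(1) that by (auto simp: point_on_def)
  have "degree (map_poly \<phi> p) > 0"
    using le_degree[of "map_poly \<phi> p" D] nz D by (auto simp: mp(1) c_def)
  then obtain a where a: "poly (map_poly \<phi> p) a = 0"
    using alg_closed_imp_poly_has_root by blast
  \<comment> \<open>By minimality, \<open>p\<close> divides every relation \<open>q\<close> modulo \<open>P\<close>, up to a power of \<open>c\<close>.\<close>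
  have rel: "poly (map_poly \<phi> q) a = 0" if q: "coeffs_in A q" "poly q v \<in> P" for q
  proof -
    obtain m s r where d: "coeffs_in A s" "coeffs_in A r" "smult (c ^ m) q = p * s + r"
      "\<forall>n\<ge>D. coeff r n = 0"
      using pseudo_division[OF A p(1) p(4) q(1), of "Suc (degree q)"] coeff_eq_0[of q]
      unfolding c_def Suc_le_eq by blast
    have ev: "c ^ m * poly q v = poly p v * poly s v + poly r v"
      using arg_cong[OF d(3), of "\<lambda>f. poly f v"] by simp
    have "poly r v = c ^ m * poly q v - poly s v * poly p v" using ev by (simp add: algebra_simps)
    then have "poly r v \<in> P" using Pdiff[OF Pmult[OF q(2)] Pmult[OF p(2)]] by simp
    then have "coeff r n \<in> P" for n using min[OF d(2)] d(4) by blast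
    then have r0: "map_poly \<phi> r = 0"
      using d(2) by (intro poly_eqI) (auto simp: mp(1) coeffs_in_def \<phi>0)
    have "coeffs_in A [:c ^ m:]" using is_subringD(7)[OF A cA] by (rule coeffs_in_intros(6)[OF A])
    from mp(3)[OF this q(1)] have "map_poly \<phi> (smult (c ^ m) q) = map_poly \<phi> [:c ^ m:] * map_poly \<phi> q" by simp
    also have "map_poly \<phi> [:c ^ m:] = [:\<phi> c ^ m:]"
    proof (rule poly_eqI)
      have "\<phi> (c ^ m) = \<phi> c ^ m"
      proof (induction m)
        case 0
        then show ?case using \<phi>(1) ring_mapD(2)[OF C(1)] unfolding point_on_def by (metis power_0)
      next
        case (Suc m)
        then show ?case using \<phi>(1) cA is_subringD(7)[OF A cA] by (auto simp: point_on_def)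
      qed
      moreover have "\<phi> 0 = 0" using id is_subringD(2)[OF A] by (auto intro!: \<phi>0 simp: is_ideal_def)
      ultimately show "coeff (map_poly \<phi> [:c ^ m:]) n = coeff [:\<phi> c ^ m:] n" for n
        by (simp add: mp(1) coeff_pCons split: nat.split)
    qed
    finally have "[:\<phi> c ^ m:] * map_poly \<phi> q = map_poly \<phi> p * map_poly \<phi> s"
      using d mp(2)[OF coeffs_in_intros(3)[OF A p(1) d(1)] d(2)] mp(3)[OF p(1) d(1)] r0 by simp
    from arg_cong[OF this, of "\<lambda>f. poly f a"] show ?thesis using a nz by simp
  qed
  obtain \<psi> where \<psi>: "point_on C P (adjoin A v) \<psi>"
    "\<And>q. coeffs_in A q \<Longrightarrow> \<psi> (poly q v) = poly (map_poly \<phi> q) a"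
    using point_on_adjoin[OF A \<phi>(1) C P rel] by blast
  have "poly (map_poly \<phi> (w - \<eta> * \<alpha>)) a = 0"
    using \<alpha> \<eta> wA by (intro rel coeffs_in_intros[OF A]) auto
  moreover have "map_poly \<phi> w = map_poly \<phi> (w - \<eta> * \<alpha>) + map_poly \<phi> \<eta> * map_poly \<phi> \<alpha>"
    using mp(2)[of "w - \<eta> * \<alpha>" "\<eta> * \<alpha>"] mp(3)[OF \<eta>(1) \<alpha>(1)] coeffs_in_intros(2,3)[OF A] \<alpha>(1) \<eta>(1) wA(1)
    by simp
  moreover have "poly (map_poly \<phi> w) a = \<phi> \<epsilon>"
  proof -
    have "\<phi> 0 = 0" using id is_subringD(2)[OF A] by (auto intro!: \<phi>0 simp: is_ideal_def)
    then have "map_poly \<phi> w = [:\<phi> \<epsilon>:]"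
      by (intro poly_eqI) (simp add: weq mp(1) coeff_pCons split: nat.split)
    then show ?thesis by simp
  qed
  ultimately have "poly (map_poly \<phi> \<eta>) a \<noteq> 0" using nz by auto
  then show "\<exists>\<phi>. point_on C P (adjoin A v) \<phi> \<and> \<phi> h \<noteq> 0" using \<psi> \<eta> by metis
qed

lemma enough_points_adjoin:
  fixes C :: "'k::{alg_closed_field,field_char_0} \<Rightarrow> 'r::comm_ring_1"
  assumes A: "is_subring A" and C: "ring_map C" "range C \<subseteq> A" and P: "prime_ideal P"
    and ep: "enough_points C P A"
  shows "enough_points C P (adjoin A v)"
proof (cases "\<forall>p n. coeffs_in A p \<longrightarrow> poly p v \<in> P \<longrightarrow> coeff p n \<in> P")
  case True
  then show ?thesis using enough_points_adjoin_transcendental[OF A C P ep] by blast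
next
  case False
  define rel where "rel D p \<longleftrightarrow> coeffs_in A p \<and> poly p v \<in> P \<and> coeff p D \<notin> P
      \<and> (\<forall>n>D. coeff p n = 0)" for D p
  have id: "is_ideal P" using P by (simp add: prime_ideal_def)
  have ex: "\<exists>p' D. rel D p' \<and> D \<le> N"
    if p: "coeffs_in A p" "poly p v \<in> P" "coeff p n \<notin> P" "\<And>n. n > N \<Longrightarrow> coeff p n = 0" for p n N
  proof -
    define D where "D = Max {n. coeff p n \<notin> P}"
    have sub: "{n. coeff p n \<notin> P} \<subseteq> {..N}"
      using p(4) id by (auto simp: is_ideal_def) (metis not_le)
    then have fin: "finite {n. coeff p n \<notin> P}" by (rule finite_subset) simp
    have Dn: "coeff p D \<notin> P" using Max_in[OF fin] p(3) by (auto simp: D_def)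
    have "coeff p n \<in> P" if "n \<ge> Suc D" for n
      using Max_ge[OF fin, of n] that unfolding D_def by force
    then obtain q where q: "coeffs_in A q" "poly p v - poly q v \<in> P" "\<And>n. n \<ge> Suc D \<Longrightarrow> coeff q n = 0"
      "\<And>n. n < Suc D \<Longrightarrow> coeff q n = coeff p n"
      using truncate_poly_mod_ideal[OF A id p(1), of "Suc D" v] by blast
    have "poly q v \<in> P" using is_ideal_diff[OF id p(2) q(2)] by simp
    then have "rel D q" using q Dn by (auto simp: rel_def)
    then show ?thesis using Dn sub by blast
  qed
  define D where "D = (LEAST D. \<exists>p. rel D p)"
  obtain p n where "coeffs_in A p" "poly p v \<in> P" "coeff p n \<notin> P" using False by blast
  then have "\<exists>D p. rel D p" using ex[of p n "degree p"] coeff_eq_0 by blast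
  then have "\<exists>p. rel D p" unfolding D_def by (rule LeastI_ex)
  then obtain p where p: "rel D p" by blast
  have min: "coeff r n \<in> P" if r: "coeffs_in A r" "poly r v \<in> P" "\<And>n. n \<ge> D \<Longrightarrow> coeff r n = 0" for r n
  proof (rule ccontr)
    assume n: "coeff r n \<notin> P"
    then have "D > 0" using r(3)[of n] id by (cases D) (auto simp: is_ideal_def)
    then have "\<And>n. n > D - 1 \<Longrightarrow> coeff r n = 0" using r(3) by auto
    then obtain q D' where "rel D' q" "D' \<le> D - 1" using ex[OF r(1,2) n] by blast
    then have "\<exists>p. rel D' p" by blast
    then have "(LEAST D. \<exists>p. rel D p) \<le> D'" by (rule Least_le)
    then show False using \<open>D > 0\<close> \<open>D' \<le> D - 1\<close> unfolding D_def[symmetric] by simp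
  qed
  show ?thesis
    using enough_points_adjoin_algebraic[OF A C P ep, of p v D] p min unfolding rel_def by blast
qed

lemma is_subring_adjoin:
  assumes A: "is_subring A" shows "is_subring (adjoin A v)" "A \<subseteq> adjoin A v" "v \<in> adjoin A v"
proof -
  show "A \<subseteq> adjoin A v"
    unfolding adjoin_def using coeffs_in_intros(6)[OF A] by (force intro: exI[of _ "[:_:]"])
  have "coeffs_in A (monom 1 1)" using is_subringD(1)[OF A] by (rule coeffs_in_intros(5)[OF A])
  moreover have "poly (monom 1 1) v = v" by (simp add: poly_monom)
  ultimately show "v \<in> adjoin A v" unfolding adjoin_def by force
  show "is_subring (adjoin A v)"
    unfolding is_subring_def
  proof (intro conjI ballI)
    show "1 \<in> adjoin A v" using is_subringD(1)[OF A] \<open>A \<subseteq> adjoin A v\<close> by auto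
    fix x y assume "x \<in> adjoin A v" "y \<in> adjoin A v"
    then obtain p q where pq: "x = poly p v" "y = poly q v" "coeffs_in A p" "coeffs_in A q"
      by (auto simp: adjoin_def)
    show "x - y \<in> adjoin A v"
      unfolding adjoin_def using pq coeffs_in_intros(2)[OF A] by (auto intro!: exI[of _ "p - q"])
    show "x * y \<in> adjoin A v"
      unfolding adjoin_def using pq coeffs_in_intros(3)[OF A] by (auto intro!: exI[of _ "p * q"])
  qed
qed

text \<open>
  If no power of \<open>s\<close> lies in the ideal, some prime ideal \<open>P\<close> over it does not contain \<open>s\<close>. Adjoining the
  variables one after the other to the field yields a point of the whole polynomial ring modulo \<open>P\<close> at which
  \<open>s\<close> is nonzero: its coordinates are a common zero of the family.
\<close>

theorem nullstellensatz:
  fixes g :: "'i::finite \<Rightarrow> ('n::finite, 'k::{alg_closed_field,field_char_0}) mpoly"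
  assumes zeros: "\<And>p. (\<And>i. eval_mpoly (g i) p = 0) \<Longrightarrow> eval_mpoly s p = 0"
  shows "\<exists>m. s ^ m \<in> ideal_gen g"
proof (rule ccontr)
  assume "\<nexists>m. s ^ m \<in> ideal_gen g"
  then obtain P where P: "prime_ideal P" "ideal_gen g \<subseteq> P" "s \<notin> P"
    using exists_prime_ideal_avoiding_powers[OF is_ideal_ideal_gen] by metis
  let ?C = "Const :: 'k \<Rightarrow> ('n, 'k) mpoly"
  have C: "ring_map ?C" by (rule ring_map_Const)
  have id: "is_ideal P" and one: "1 \<notin> P" using P by (auto simp: prime_ideal_def)
  have "\<exists>A. is_subring A \<and> range ?C \<subseteq> A \<and> enough_points ?C P A \<and> Var ` V \<subseteq> A" for V :: "'n set"
    using finite[of V]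
  proof (induction V rule: finite_induct)
    case empty
    have "is_subring (range ?C)"
      unfolding is_subring_def
    proof (intro conjI ballI)
      show "1 \<in> range ?C" using ring_mapD(2)[OF C] by (metis rangeI)
      fix x y assume "x \<in> range ?C" "y \<in> range ?C"
      then show "x - y \<in> range ?C" "x * y \<in> range ?C"
        by (auto simp flip: ring_mapD(4)[OF C] ring_mapD(6)[OF C])
    qed
    moreover have "enough_points ?C P (range ?C)"
      unfolding enough_points_def
    proof
      fix h assume h: "h \<in> range ?C - P"
      define \<phi> where "\<phi> f = lookup f 0" for f :: "('n, 'k) mpoly"
      have "c = 0" if "?C c \<in> P" for c
      proof (rule ccontr)
        assume "c \<noteq> 0"
        then have "?C (inverse c) * ?C c = 1" by (simp add: mult_single)
        then show False using that id one unfolding is_ideal_def by metis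
      qed
      then have "point_on ?C P (range ?C) \<phi>"
        by (auto simp: point_on_def \<phi>_def mult_single lookup_add)
      moreover have "\<phi> h \<noteq> 0" using h id by (auto simp: \<phi>_def is_ideal_def)
      ultimately show "\<exists>\<phi>. point_on ?C P (range ?C) \<phi> \<and> \<phi> h \<noteq> 0" by blast
    qed
    ultimately show ?case by (intro exI[of _ "range ?C"]) auto
  next
    case (insert i V)
    then obtain A where A: "is_subring A" "range ?C \<subseteq> A" "enough_points ?C P A" "Var ` V \<subseteq> A" by blast
    have "enough_points ?C P (adjoin A (Var i))"
      by (rule enough_points_adjoin[OF A(1) C A(2) P(1) A(3)])
    then show ?case
      using is_subring_adjoin[OF A(1), of "Var i"] A by (intro exI[of _ "adjoin A (Var i)"]) auto
  qed
  then obtain A where A: "is_subring A" "range ?C \<subseteq> A" "enough_points ?C P A" "range Var \<subseteq> A"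
    by blast
  have "f \<in> A" for f
  proof (induction f rule: poly_mapping_induct_single)
    case zero
    then show ?case by (rule is_subringD(2)[OF A(1)])
  next
    case (single \<mu> c)
    have "(\<Prod>i\<in>V. Var i ^ lookup \<mu> i) \<in> A" for V
      by (induction V rule: infinite_finite_induct)
        (use A(4) is_subringD(1)[OF A(1)] in \<open>auto intro!: is_subringD(6,7)[OF A(1)]\<close>)
    then show ?case
      unfolding single_eq_Const_mult_Vars[of \<mu> c] using A by (intro is_subringD(6)[OF A(1)]) auto
  next
    case (add f g)
    then show ?case by (rule is_subringD(4)[OF A(1)])
  qed
  then have AU: "A = UNIV" by auto
  then obtain \<phi> where \<phi>: "point_on ?C P UNIV \<phi>" "\<phi> s \<noteq> 0"
    using A(3) P(3) unfolding enough_points_def by blast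
  have C1: "?C 1 = 1" by simp
  have "\<phi> 1 = 1" using \<phi>(1) C1 unfolding point_on_def by metis
  then have hom: "ring_map \<phi>" using \<phi>(1) by (auto simp: ring_map_def point_on_def)
  define p where "p = (\<chi> i. \<phi> (Var i))"
  have ev: "\<phi> f = eval_mpoly f p" for f
    by (rule ring_map_eqI[OF hom ring_map_eval]) (use \<phi>(1) in \<open>auto simp: point_on_def p_def\<close>)
  have "eval_mpoly (g i) p = 0" for i
    using \<phi>(1) subsetD[OF P(2) ideal_gen_base[of g i]] unfolding ev[symmetric] point_on_def by blast
  then have "\<phi> s = 0" using zeros ev by simp
  then show False using \<phi>(2) by simp
qed

section \<open>The residue functional of a perturbed family\<close>

lemma finite_total_degree_le: "finite {\<mu> :: 'n::finite \<Rightarrow>\<^sub>0 nat. total_degree \<mu> \<le> D}"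
proof (induction D)
  case 0
  then show ?case by simp
next
  case (Suc D)
  have "{\<mu> :: 'n \<Rightarrow>\<^sub>0 nat. total_degree \<mu> \<le> Suc D}
      \<subseteq> insert 0 (\<Union>i. (\<lambda>\<mu>. \<mu> + single i (Suc 0)) ` {\<mu>. total_degree \<mu> \<le> D})"
  proof
    fix \<mu> :: "'n \<Rightarrow>\<^sub>0 nat" assume \<mu>: "\<mu> \<in> {\<mu>. total_degree \<mu> \<le> Suc D}"
    have "\<mu> = 0 \<or> (\<exists>\<nu> i. \<mu> = \<nu> + single i (Suc 0))"
      by (induction \<mu> rule: exponent_induct) blast+
    then show "\<mu> \<in> insert 0 (\<Union>i. (\<lambda>\<mu>. \<mu> + single i (Suc 0)) ` {\<mu>. total_degree \<mu> \<le> D})"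
    proof
      assume "\<exists>\<nu> i. \<mu> = \<nu> + single i (Suc 0)"
      then obtain \<nu> i where \<nu>: "\<mu> = \<nu> + single i (Suc 0)" by blast
      then have "\<nu> \<in> {\<mu>. total_degree \<mu> \<le> D}" using \<mu> by simp
      then show ?thesis using \<nu> by blast
    qed simp
  qed
  then show ?case using Suc by (auto intro: finite_subset)
qed

lemma lookup_mult_single_one:
  fixes f :: "('n \<Rightarrow>\<^sub>0 nat) \<Rightarrow>\<^sub>0 'k::comm_ring_1"
  shows "lookup (f * single \<nu> 1) (\<mu> + \<nu>) = lookup f \<mu>"
  by (induction f rule: poly_mapping_induct_single)
    (auto simp: mult_single lookup_single when_def lookup_add distrib_right)

lemma lookup_mult_single_one_eq_0:
  fixes f :: "('n \<Rightarrow>\<^sub>0 nat) \<Rightarrow>\<^sub>0 'k::comm_ring_1"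
  assumes "lookup \<mu> i < lookup \<nu> i"
  shows "lookup (f * single \<nu> 1) \<mu> = 0"
  by (induction f rule: poly_mapping_induct_single)
    (use assms in \<open>auto simp: mult_single lookup_single when_def lookup_add distrib_right\<close>)

text \<open>
  Expanding \<open>h / \<Prod>(x\<^sub>i\<^sup>M + g\<^sub>i)\<close> by geometric series in \<open>g\<^sub>i / x\<^sub>i\<^sup>M\<close> gives the sum over the exponents \<open>k\<close> of
  \<open>\<plusminus> h g\<^sup>k / x\<^sup>M\<^sup>(\<^sup>k\<^sup>+\<^sup>1\<^sup>)\<close>. The residue collects the coefficients of \<open>1 / x\<^sub>1 \<cdots> x\<^sub>n\<close>, which come from the
  monomials of \<open>h g\<^sup>k\<close> with exponent \<open>M (k + 1) - 1\<close> in every variable.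
\<close>

definition top_exponent :: "nat \<Rightarrow> ('n::finite \<Rightarrow>\<^sub>0 nat) \<Rightarrow> 'n \<Rightarrow>\<^sub>0 nat" where
  "top_exponent M k = Abs_poly_mapping (\<lambda>i. M * Suc (lookup k i) - 1)"

definition family_power :: "('n::finite \<Rightarrow> 'r::comm_ring_1) \<Rightarrow> ('n \<Rightarrow>\<^sub>0 nat) \<Rightarrow> 'r" where
  "family_power g k = (\<Prod>i\<in>UNIV. g i ^ lookup k i)"

definition residue_term :: "nat \<Rightarrow> ('n::finite \<Rightarrow> ('n, 'k::field) mpoly) \<Rightarrow> ('n, 'k) mpoly
    \<Rightarrow> ('n \<Rightarrow>\<^sub>0 nat) \<Rightarrow> 'k" where
  "residue_term M g h k =
     (- 1) ^ total_degree k * lookup (h * family_power g k) (top_exponent M k)"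

definition residue :: "nat \<Rightarrow> ('n::finite \<Rightarrow> ('n, 'k::field) mpoly) \<Rightarrow> ('n, 'k) mpoly \<Rightarrow> 'k" where
  "residue M g h = Sum_any (residue_term M g h)"

lemma lookup_top_exponent [simp]:
  "lookup (top_exponent M k) i = M * Suc (lookup k i) - 1"
  unfolding top_exponent_def by (subst lookup_Abs_poly_mapping) auto

lemma total_degree_top_exponent:
  fixes k :: "'n::finite \<Rightarrow>\<^sub>0 nat"
  assumes "M > 0"
  shows "total_degree (top_exponent M k) = CARD('n) * (M - 1) + M * total_degree k"
proof -
  have "M * Suc a - 1 = (M - 1) + M * a" for a using assms by simp
  then show ?thesis by (simp add: total_degree_def sum.distrib sum_distrib_left)
qed

lemma family_power_add: "family_power g (k + l) = family_power g k * family_power g l"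
  by (simp add: family_power_def lookup_add power_add prod.distrib)

lemma family_power_single: "family_power g (single i (Suc 0)) = g i"
proof -
  have "family_power g (single i (Suc 0)) = (\<Prod>j\<in>UNIV. if i = j then g j else 1)"
    unfolding family_power_def by (intro prod.cong) (auto simp: lookup_single when_def)
  then show ?thesis by simp
qed

lemma family_power_graded:
  assumes "\<forall>i. g i \<in> graded_piece e"
  shows "family_power g k \<in> graded_piece (e * total_degree k)"
proof -
  have "family_power g k \<in> graded_piece (\<Sum>i\<in>UNIV. lookup k i * e)"
    unfolding family_power_def using assms by (intro graded_prod graded_power) auto
  then show ?thesis by (simp add: total_degree_def sum_distrib_left mult.commute)
qed

lemma residue_term_add: "residue_term M g (h + h') k = residue_term M g h k + residue_term M g h' k"
  by (simp add: residue_term_def distrib_right distrib_left lookup_add)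

lemma residue_term_single_nz:
  fixes g :: "'n::finite \<Rightarrow> ('n, 'k::field) mpoly"
  assumes g: "\<forall>i. g i \<in> graded_piece e" and "M > 0"
    and nz: "residue_term M g (single \<nu> c) k \<noteq> 0"
  shows "CARD('n) * (M - 1) + M * total_degree k = total_degree \<nu> + e * total_degree k"
proof -
  have "single \<nu> c * family_power g k \<in> graded_piece (total_degree \<nu> + e * total_degree k)"
    by (intro graded_mult graded_single family_power_graded[OF g] refl)
  then show ?thesis
    using nz graded_pieceD total_degree_top_exponent[OF \<open>M > 0\<close>, of k]
    unfolding residue_term_def by fastforce
qed

text \<open>
  Comparing degrees in a nonzero term gives \<open>n (M - 1) + (M - e) |k| = |\<nu>|\<close>. This bounds \<open>k\<close>, makes the residue
  vanish in degrees below \<open>n (M - 1)\<close>, and leaves only \<open>k = 0\<close> in that degree.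
\<close>

lemma residue_term_bounded:
  fixes g :: "'n::finite \<Rightarrow> ('n, 'k::field) mpoly"
  assumes g: "\<forall>i. g i \<in> graded_piece e" and M: "e < M"
  shows "\<exists>N. \<forall>k. residue_term M g h k \<noteq> 0 \<longrightarrow> total_degree k \<le> N"
proof (induction h rule: poly_mapping_induct_single)
  case zero
  then show ?case by (simp add: residue_term_def)
next
  case (single \<nu> c)
  have "total_degree k \<le> total_degree \<nu>" if "residue_term M g (single \<nu> c) k \<noteq> 0" for k
  proof -
    have "CARD('n) * (M - 1) + M * total_degree k = total_degree \<nu> + e * total_degree k"
      using residue_term_single_nz[OF g _ that] M by auto
    moreover have "e * total_degree k + total_degree k \<le> M * total_degree k"
      using M mult_le_mono1[of "Suc e" M "total_degree k"] by simp
    ultimately show ?thesis by linarith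
  qed
  then show ?case by blast
next
  case (add f h)
  then obtain N N' where "\<forall>k. residue_term M g f k \<noteq> 0 \<longrightarrow> total_degree k \<le> N"
    "\<forall>k. residue_term M g h k \<noteq> 0 \<longrightarrow> total_degree k \<le> N'" by blast
  then have "\<forall>k. residue_term M g (f + h) k \<noteq> 0 \<longrightarrow> total_degree k \<le> max N N'"
    unfolding residue_term_add by (metis add_0 le_max_iff_disj)
  then show ?case by blast
qed

lemma finite_residue_support:
  assumes "\<forall>i. g i \<in> graded_piece e" "e < M"
  shows "finite {k. residue_term M g h k \<noteq> 0}"
proof -
  obtain N where "\<forall>k. residue_term M g h k \<noteq> 0 \<longrightarrow> total_degree k \<le> N"
    using residue_term_bounded[OF assms] by blast
  then have "{k. residue_term M g h k \<noteq> 0} \<subseteq> {k. total_degree k \<le> N}" by blast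
  then show ?thesis using finite_total_degree_le by (rule finite_subset)
qed

lemma residue_add:
  assumes "\<forall>i. g i \<in> graded_piece e" "e < M"
  shows "residue M g (h + h') = residue M g h + residue M g h'"
  unfolding residue_def residue_term_add
  by (intro Sum_any.distrib finite_residue_support[OF assms])

lemma residue_0: "residue M g 0 = 0"
  by (simp add: residue_def residue_term_def)

lemma residue_single:
  assumes "\<forall>i. g i \<in> graded_piece e" "e < M"
  shows "residue M g (single \<nu> c) = c * residue M g (single \<nu> 1)"
proof -
  have s: "single \<nu> c = Const c * single \<nu> 1" by (simp add: mult_single)
  have l: "lookup (Const c * f) \<mu> = c * lookup f \<mu>" for f :: "('a, 'b) mpoly" and \<mu>
    by (induction f rule: poly_mapping_induct_single)
      (auto simp: mult_single lookup_single when_def lookup_add distrib_left)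
  have "residue_term M g (single \<nu> c) k = c * residue_term M g (single \<nu> 1) k" for k
    unfolding residue_term_def s mult.assoc l by (simp add: ac_simps)
  then show ?thesis
    unfolding residue_def by (simp add: Sum_any_right_distrib[OF finite_residue_support[OF assms]])
qed

lemma residue_low_degree:
  fixes g :: "'n::finite \<Rightarrow> ('n, 'k::field) mpoly"
  assumes g: "\<forall>i. g i \<in> graded_piece e" and M: "e < M" and \<nu>: "total_degree \<nu> < CARD('n) * (M - 1)"
  shows "residue M g (single \<nu> c) = 0"
proof -
  have "residue_term M g (single \<nu> c) k = 0" for k
  proof (rule ccontr)
    assume "residue_term M g (single \<nu> c) k \<noteq> 0"
    then have "CARD('n) * (M - 1) + M * total_degree k = total_degree \<nu> + e * total_degree k"
      using residue_term_single_nz[OF g] M by auto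
    moreover have "e * total_degree k \<le> M * total_degree k" using M by simp
    ultimately show False using \<nu> by linarith
  qed
  then show ?thesis by (simp add: residue_def)
qed

lemma residue_top:
  fixes g :: "'n::finite \<Rightarrow> ('n, 'k::field) mpoly"
  assumes g: "\<forall>i. g i \<in> graded_piece e" and M: "e < M"
  shows "residue M g (single (top_exponent M 0) 1) = 1"
proof -
  let ?h = "single (top_exponent M 0) 1 :: ('n, 'k) mpoly"
  have "residue_term M g ?h k = (1 when k = 0)" for k
  proof (cases "k = 0")
    case True
    then show ?thesis by (simp add: residue_term_def family_power_def)
  next
    case False
    have "residue_term M g ?h k = 0"
    proof (rule ccontr)
      assume "residue_term M g ?h k \<noteq> 0"
      from residue_term_single_nz[OF g _ this] M
      have "M * total_degree k = e * total_degree k"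
        by (simp add: total_degree_top_exponent)
      then show False using M False by simp
    qed
    then show ?thesis using False by simp
  qed
  then show ?thesis unfolding residue_def by simp
qed

lemma Var_power: "Var i ^ a = single (single i a) (1 :: 'r::comm_ring_1)"
  by (induction a) (simp_all add: mult_single flip: single_add)

text \<open>
  When the factor \<open>x\<^sub>i\<^sup>M + g\<^sub>i\<close> of the denominator divides the numerator, the series telescopes: the term
  of \<open>h x\<^sub>i\<^sup>M\<close> for \<open>k + e\<^sub>i\<close> cancels the term of \<open>h g\<^sub>i\<close> for \<open>k\<close>, and a term of \<open>h x\<^sub>i\<^sup>M\<close> with \<open>k\<^sub>i = 0\<close>
  contains no negative power of \<open>x\<^sub>i\<close>.
\<close>

lemma residue_multiple:
  fixes g :: "'n::finite \<Rightarrow> ('n, 'k::field) mpoly"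
  assumes g: "\<forall>i. g i \<in> graded_piece e" and M: "e < M"
  shows "residue M g (h * (Var i ^ M + g i)) = 0"
proof -
  let ?e = "single i (Suc 0)" and ?X = "single (single i M) 1"
  obtain N where N: "\<And>k. residue_term M g (h * ?X) k \<noteq> 0 \<Longrightarrow> total_degree k \<le> N"
    using residue_term_bounded[OF g M] by blast
  obtain N' where N': "\<And>k. residue_term M g (h * g i) k \<noteq> 0 \<Longrightarrow> total_degree k \<le> N'"
    using residue_term_bounded[OF g M] by blast
  define A where "A = {k :: 'n \<Rightarrow>\<^sub>0 nat. total_degree k \<le> N + N'}"
  have A: "finite A" unfolding A_def by (rule finite_total_degree_le)
  have zero: "residue_term M g (h * ?X) k = 0" if "lookup k i = 0" for k
  proof -
    have "lookup ((h * family_power g k) * ?X) (top_exponent M k) = 0"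
      using that M by (intro lookup_mult_single_one_eq_0[of _ i]) simp
    then show ?thesis by (simp add: residue_term_def ac_simps)
  qed
  have shift: "residue_term M g (h * ?X) (k + ?e) = - residue_term M g (h * g i) k" for k
  proof -
    have t: "top_exponent M (k + ?e) = top_exponent M k + single i M"
    proof (rule poly_mapping_eqI)
      show "lookup (top_exponent M (k + ?e)) j
          = lookup (top_exponent M k + single i M) j" for j
        using M by (cases "i = j") (simp_all add: lookup_add lookup_single)
    qed
    have r: "h * ?X * family_power g (k + ?e) = (h * g i * family_power g k) * ?X"
      by (simp add: family_power_add family_power_single ac_simps)
    show ?thesis unfolding residue_term_def t r lookup_mult_single_one by simp
  qed
  have inj: "inj_on (\<lambda>k. k + ?e) A" by (auto simp: inj_on_def)
  have "residue M g (h * ?X) = sum (residue_term M g (h * ?X)) ((\<lambda>k. k + ?e) ` A)"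
    unfolding residue_def
  proof (rule Sum_any.expand_superset)
    show "finite ((\<lambda>k. k + ?e) ` A)" using A by simp
    show "{k. residue_term M g (h * ?X) k \<noteq> 0} \<subseteq> (\<lambda>k. k + ?e) ` A"
    proof
      fix k assume k: "k \<in> {k. residue_term M g (h * ?X) k \<noteq> 0}"
      then have "lookup k i \<noteq> 0" using zero by auto
      then have ke: "k = (k - ?e) + ?e"
        by (intro poly_mapping_eqI) (auto simp: lookup_add lookup_minus lookup_single when_def)
      have "total_degree k = total_degree (k - ?e) + 1" by (subst ke) simp
      then have "k - ?e \<in> A" using N[of k] k by (auto simp: A_def)
      then show "k \<in> (\<lambda>k. k + ?e) ` A" using ke by (rule rev_image_eqI)
    qed
  qed
  also have "\<dots> = (\<Sum>k\<in>A. - residue_term M g (h * g i) k)"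
    by (simp add: sum.reindex[OF inj] shift)
  also have "\<dots> = - residue M g (h * g i)"
    unfolding residue_def sum_negf
    by (subst Sum_any.expand_superset[OF A]) (use N' in \<open>auto simp: A_def intro: trans_le_add2\<close>)
  finally show ?thesis
    by (simp add: distrib_left Var_power residue_add[OF g M])
qed

section \<open>Polynomials in two sets of variables\<close>

text \<open>
  The ring of polynomials in \<open>x\<close> with coefficients in the polynomial ring in \<open>y\<close>: the outer exponents
  belong to \<open>x\<close>, the inner ones to \<open>y\<close>. The embedding of polynomials in \<open>y\<close> is \<open>Const\<close>.
\<close>

type_synonym ('n, 'k) bipoly = "('n \<Rightarrow>\<^sub>0 nat) \<Rightarrow>\<^sub>0 (('n \<Rightarrow>\<^sub>0 nat) \<Rightarrow>\<^sub>0 'k)"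

definition in_x :: "('n::finite, 'k::field) mpoly \<Rightarrow> ('n, 'k) bipoly" where
  "in_x = insert_vars (\<lambda>c. Const (Const c)) Var"

lemma ring_map_in_x: "ring_map in_x"
  unfolding in_x_def by (intro ring_map_insert_vars ring_map_comp[OF ring_map_Const ring_map_Const])

lemmas in_x_simps = ring_mapD[OF ring_map_in_x]

lemma in_x_Const [simp]: "in_x (Const c) = Const (Const c)"
  unfolding in_x_def by (intro insert_vars_Const ring_map_comp[OF ring_map_Const ring_map_Const])

lemma in_x_Var [simp]: "in_x (Var i) = Var i"
  unfolding in_x_def by (intro insert_vars_Var ring_map_comp[OF ring_map_Const ring_map_Const])

lemma in_x_single: "in_x (single \<nu> c) = single \<nu> (Const c)"
  by (subst single_eq_Const_mult_Vars, subst (2) single_eq_Const_mult_Vars) (simp add: in_x_simps)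

lemma single_bipoly: "single \<nu> r = in_x (single \<nu> 1) * Const r"
  by (simp add: in_x_single mult_single)

lemmas Const_simps = ring_mapD[OF ring_map_Const]

text \<open>Extension of the residue in the variables \<open>x\<close> to a functional that is linear over the ring in \<open>y\<close>.\<close>

definition residue_x :: "nat \<Rightarrow> ('n::finite \<Rightarrow> ('n, 'k::field) mpoly) \<Rightarrow> ('n, 'k) bipoly \<Rightarrow> ('n, 'k) mpoly" where
  "residue_x M g s = (\<Sum>\<nu>\<in>keys s.
     lookup s \<nu> * Const (residue M g (single \<nu> 1)))"

lemma residue_x_superset:
  assumes "finite A" "keys s \<subseteq> A"
  shows "residue_x M g s = (\<Sum>\<nu>\<in>A.
     lookup s \<nu> * Const (residue M g (single \<nu> 1)))"
  unfolding residue_x_def using assms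
  by (intro sum.mono_neutral_left) (auto simp: not_in_keys_iff_lookup_eq_zero)

lemma residue_x_single:
  "residue_x M g (single \<nu> r) = r * Const (residue M g (single \<nu> 1))"
  by (subst residue_x_superset[of "{\<nu>}"]) auto

lemma residue_x_0 [simp]: "residue_x M g 0 = 0"
  by (simp add: residue_x_def)

lemma residue_x_add: "residue_x M g (s + t) = residue_x M g s + residue_x M g t"
proof -
  let ?A = "keys s \<union> keys t"
  have "keys (s + t) \<subseteq> ?A" by (rule keys_add)
  then show ?thesis
    by (simp add: residue_x_superset[of ?A] lookup_add sum.distrib distrib_right)
qed

lemma residue_x_sum: "residue_x M g (sum f A) = (\<Sum>a\<in>A. residue_x M g (f a))"
  by (induction A rule: infinite_finite_induct) (auto simp: residue_x_add)

lemma residue_x_Const_mult: "residue_x M g (Const r * s) = r * residue_x M g s"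
  by (induction s rule: poly_mapping_induct_single)
    (auto simp: residue_x_add residue_x_single mult_single distrib_left mult.assoc)

lemma residue_x_diff: "residue_x M g (s - t) = residue_x M g s - residue_x M g t"
proof -
  have "residue_x M g (s - t) = residue_x M g (s + Const (- 1) * t)"
    by (simp add: Const_simps)
  then show ?thesis by (simp only: residue_x_add residue_x_Const_mult) simp
qed

lemma residue_x_in_x:
  assumes "\<forall>i. g i \<in> graded_piece e" "e < M"
  shows "residue_x M g (in_x h * Const r) = Const (residue M g h) * r"
proof (induction h rule: poly_mapping_induct_single)
  case zero
  then show ?case by (simp add: in_x_simps residue_0)
next
  case (single \<nu> c)
  have 1: "Const (c * residue M g (single \<nu> 1)) = Const c * Const (residue M g (single \<nu> 1))"
    by (rule Const_simps(4))
  have 2: "in_x (single \<nu> c) * Const r = single \<nu> (Const c * r)"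
    by (simp add: in_x_single mult_single)
  show ?case
    unfolding 2 residue_x_single residue_single[OF assms, of \<nu> c] 1 by (simp only: ac_simps)
next
  case (add f h)
  then show ?case
    by (simp only: in_x_simps(3) distrib_right residue_x_add residue_add[OF assms] Const_simps(3))
qed

lemma residue_x_multiple:
  assumes "\<forall>i. g i \<in> graded_piece e" "e < M"
  shows "residue_x M g (s * in_x (Var i ^ M + g i)) = 0"
proof (induction s rule: poly_mapping_induct_single)
  case (single \<nu> r)
  have "single \<nu> r * in_x (Var i ^ M + g i)
      = in_x (single \<nu> 1 * (Var i ^ M + g i)) * Const r"
    unfolding single_bipoly[of \<nu> r] by (simp only: in_x_simps(4) ac_simps)
  then show ?case by (simp only: residue_x_in_x[OF assms] residue_multiple[OF assms]) simp
qed (auto simp: distrib_right residue_x_add)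

subsection \<open>Weights\<close>

text \<open>
  The \<open>x\<close>-degree plus \<open>w\<close> times the \<open>y\<close>-degree: the total degree for \<open>w = 1\<close>, the \<open>x\<close>-degree for \<open>w = 0\<close>.
  Sets of weights express both homogeneity and upper bounds.
\<close>

definition weighted :: "nat \<Rightarrow> nat set \<Rightarrow> ('n::finite, 'k::field) bipoly set" where
  "weighted w A = {s. \<forall>\<nu> \<mu>. lookup (lookup s \<nu>) \<mu> \<noteq> 0
     \<longrightarrow> total_degree \<nu> + w * total_degree \<mu> \<in> A}"

lemma weighted_0 [simp]: "0 \<in> weighted w A"
  by (simp add: weighted_def)

lemma weighted_add: "s \<in> weighted w A \<Longrightarrow> t \<in> weighted w A \<Longrightarrow> s + t \<in> weighted w A"
  by (auto simp: weighted_def lookup_add) (metis add_0)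

lemma weighted_uminus: "s \<in> weighted w A \<Longrightarrow> - s \<in> weighted w A"
  by (auto simp: weighted_def)

lemma weighted_sum: "(\<And>a. a \<in> S \<Longrightarrow> f a \<in> weighted w A) \<Longrightarrow> sum f S \<in> weighted w A"
  by (induction S rule: infinite_finite_induct) (auto intro: weighted_add)

lemma weighted_mono: "s \<in> weighted w A \<Longrightarrow> A \<subseteq> B \<Longrightarrow> s \<in> weighted w B"
  by (auto simp: weighted_def)

lemma weighted_single2:
  "total_degree \<nu> + w * total_degree \<mu> \<in> A \<Longrightarrow> single \<nu> (single \<mu> c) \<in> weighted w A"
  by (auto simp: weighted_def lookup_single when_def)

lemma weighted_induct [consumes 1, case_names zero single add]:
  assumes s: "s \<in> weighted w A" and "P 0"
    and single: "\<And>\<nu> \<mu> c. total_degree \<nu> + w * total_degree \<mu> \<in> A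
      \<Longrightarrow> P (single \<nu> (single \<mu> c))"
    and add: "\<And>s t. P s \<Longrightarrow> P t \<Longrightarrow> P (s + t)"
  shows "P s"
proof -
  have sum: "P (sum f S)" if "finite S" "\<And>a. a \<in> S \<Longrightarrow> P (f a)" for f and S :: "('a \<Rightarrow>\<^sub>0 nat) set"
    using that by (induction S rule: finite_induct) (auto intro: assms)
  have inner: "P (single \<nu> (lookup s \<nu>))" for \<nu>
  proof -
    have ss: "single \<nu> (sum f S) = (\<Sum>a\<in>S. single \<nu> (f a))"
      for f :: "_ \<Rightarrow> ('a \<Rightarrow>\<^sub>0 nat) \<Rightarrow>\<^sub>0 'b" and S :: "('a \<Rightarrow>\<^sub>0 nat) set"
      by (induction S rule: infinite_finite_induct) (auto simp: single_add)
    show ?thesis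
      by (subst poly_mapping_sum_single[of "lookup s \<nu>"], subst ss)
        (use s in \<open>auto intro!: sum single simp: weighted_def in_keys_iff\<close>)
  qed
  show ?thesis
    by (subst poly_mapping_sum_single[of s]) (auto intro!: sum inner)
qed

lemma weighted_mult:
  assumes s: "s \<in> weighted w A" and t: "t \<in> weighted w B" and C: "\<And>a b. a \<in> A \<Longrightarrow> b \<in> B \<Longrightarrow> a + b \<in> C"
  shows "s * t \<in> weighted w C"
  using s
proof (induction s rule: weighted_induct)
  case (single \<nu> \<mu> c)
  note 1 = single
  show ?case
    using t
  proof (induction t rule: weighted_induct)
    case (single \<nu>' \<mu>' c')
    then show ?case
      using C[OF 1 single] by (auto simp: mult_single algebra_simps intro!: weighted_single2)
  qed (auto simp: distrib_left intro: weighted_add)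
qed (auto simp: distrib_right intro: weighted_add)

lemma weighted_one: "1 \<in> weighted w {0}"
  using weighted_single2[of 0 w 0 "{0}" 1] by simp

lemma weighted_prod:
  assumes "\<And>i. i \<in> S \<Longrightarrow> f i \<in> weighted w {m}" "finite S"
  shows "prod f S \<in> weighted w {card S * m}"
  using assms(2,1)
  by (induction S rule: finite_induct) (auto simp: weighted_one intro: weighted_mult)

lemma weighted_prod_perturbed:
  assumes "finite S" "\<And>i. i \<in> S \<Longrightarrow> d i \<in> weighted w {m}" "\<And>i. i \<in> S \<Longrightarrow> h i \<in> weighted w {..<m}"
  shows "(\<Prod>i\<in>S. d i + h i) - (\<Prod>i\<in>S. d i) \<in> weighted w {..<card S * m}"
  using assms
proof (induction S rule: finite_induct)
  case (insert i S)
  let ?P = "\<Prod>i\<in>S. d i + h i" and ?Q = "\<Prod>i\<in>S. d i"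
  have IH: "?P - ?Q \<in> weighted w {..<card S * m}" using insert by blast
  have Q: "?Q \<in> weighted w {card S * m}" using insert by (intro weighted_prod) auto
  have "?Q + (?P - ?Q) \<in> weighted w {..card S * m}"
    by (intro weighted_add weighted_mono[OF Q] weighted_mono[OF IH]) auto
  then have P: "?P \<in> weighted w {..card S * m}" by simp
  have "d i * (?P - ?Q) \<in> weighted w {..<m + card S * m}"
    by (rule weighted_mult[of _ _ "{m}", OF _ IH]) (use insert in auto)
  moreover have "h i * ?P \<in> weighted w {..<m + card S * m}"
    by (rule weighted_mult[of _ _ "{..<m}", OF _ P]) (use insert in auto)
  ultimately have "d i * (?P - ?Q) + h i * ?P \<in> weighted w {..<m + card S * m}"
    by (rule weighted_add)
  moreover have "(d i + h i) * ?P - d i * ?Q = d i * (?P - ?Q) + h i * ?P"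
    by (simp add: algebra_simps)
  ultimately show ?case using insert by simp
qed simp

lemma residue_x_low_weight:
  fixes g :: "'n::finite \<Rightarrow> ('n, 'k::field) mpoly"
  assumes g: "\<forall>i. g i \<in> graded_piece e" "e < M" and s: "s \<in> weighted w {..<CARD('n) * (M - 1)}"
  shows "residue_x M g s = 0"
  using s
proof (induction s rule: weighted_induct)
  case (single \<nu> \<mu> c)
  then show ?case by (simp add: residue_x_single residue_low_degree[OF g])
qed (auto simp: residue_x_add)

subsection \<open>Bezoutians\<close>

text \<open>
  Cramer's rule: replacing a column of \<open>A\<close> by \<open>w\<close> multiplies the determinant by \<open>z j\<close>, and the determinant
  of the new matrix is linear in \<open>w\<close>.
\<close>

lemma cramer_ideal:
  fixes A :: "'r::comm_ring_1 ^ 'n ^ 'n"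
  assumes w: "\<And>i. w i = (\<Sum>j\<in>UNIV. A $ i $ j * z j)"
  shows "det A * z j \<in> ideal_gen w"
proof -
  let ?B = "transpose A"
  have row: "(\<Sum>l\<in>UNIV. z l *s row l ?B) = (\<chi> i. w i)"
    by (simp add: vec_eq_iff row_def transpose_def w mult.commute)
  have "det (\<chi> k. if k = j then (\<Sum>l\<in>UNIV. z l *s row l ?B) else row k ?B)
      = (\<Sum>l\<in>UNIV. det (\<chi> k. if k = j then z l *s row l ?B else row k ?B))"
    by (rule det_linear_row_sum) simp
  also have "\<dots> = (\<Sum>l\<in>UNIV. if l = j then z j * det ?B else 0)"
  proof (rule sum.cong[OF refl])
    fix l
    have "det (\<chi> k. if k = j then z l *s row l ?B else row k ?B)
        = z l * det (\<chi> k. if k = j then row l ?B else row k ?B)"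
      by (rule det_row_mul)
    also have "\<dots> = (if l = j then z j * det ?B else 0)"
    proof (cases "l = j")
      case True
      then have "(\<chi> k. if k = j then row l ?B else row k ?B) = ?B"
        by (auto simp: vec_eq_iff row_def)
      then show ?thesis using True by simp
    next
      case False
      then have "det (\<chi> k. if k = j then row l ?B else row k ?B) = 0"
        by (intro det_identical_rows[of l j]) (auto simp: row_def)
      then show ?thesis using False by simp
    qed
    finally show "det (\<chi> k. if k = j then z l *s row l ?B else row k ?B) = (if l = j then z j * det ?B else 0)" .
  qed
  finally have "det (\<chi> k. if k = j then (\<chi> i. w i) else row k ?B) = z j * det A"
    unfolding row by (simp add: det_transpose)
  moreover have "det (\<chi> k. if k = j then (\<chi> i. w i) else row k ?B) \<in> ideal_gen w"
    unfolding det_def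
  proof (rule ideal_gen_sum)
    fix p
    let ?f = "\<lambda>i. (\<chi> k. if k = j then (\<chi> i. w i) else row k ?B) $ i $ p i"
    have "(\<Prod>i\<in>UNIV. ?f i) = w (p j) * (\<Prod>i\<in>UNIV - {j}. ?f i)"
      by (subst prod.remove[of _ j]) auto
    then show "of_int (sign p) * (\<Prod>i\<in>UNIV. ?f i) \<in> ideal_gen w"
      by (simp add: ideal_gen_mult ideal_gen_mult_right)
  qed
  ultimately show ?thesis by (simp add: mult.commute)
qed

abbreviation diagonal_var :: "'n::finite \<Rightarrow> ('n, 'k::field) bipoly" where
  "diagonal_var j \<equiv> Var j - Const (Var j)"

lemma divided_differences_monomial:
  "\<exists>h :: 'n::finite \<Rightarrow> ('n, 'k::field) bipoly.
     in_x (single \<mu> 1) - Const (single \<mu> 1) = (\<Sum>j\<in>UNIV. h j * diagonal_var j)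
     \<and> (\<forall>j. h j \<in> weighted 1 {m. Suc m = total_degree \<mu>})"
proof (induction \<mu> rule: exponent_induct)
  case zero
  have "in_x (single 0 1) - Const (single 0 (1::'k)) = 0"
    by (simp add: in_x_simps(2))
  then show ?case by (intro exI[of _ "\<lambda>_. 0"]) simp
next
  case (add_single \<mu> i)
  then obtain h :: "'n \<Rightarrow> ('n, 'k) bipoly"
    where h: "in_x (single \<mu> 1) - Const (single \<mu> 1) = (\<Sum>j\<in>UNIV. h j * diagonal_var j)"
      "\<And>j. h j \<in> weighted 1 {m. Suc m = total_degree \<mu>}" by blast
  let ?X = "in_x (single \<mu> 1) :: ('n, 'k) bipoly"
  let ?Y = "Const (single \<mu> 1) :: ('n, 'k) bipoly"
  define h' where "h' j = Const (Var i) * h j + (if j = i then ?X else 0)" for j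
  have X: "?X \<in> weighted 1 {total_degree \<mu>}"
    unfolding in_x_single by (intro weighted_single2) simp
  have Y: "Const (Var i) \<in> weighted 1 {1 :: nat}" by (intro weighted_single2) simp
  have "(\<Sum>j\<in>UNIV. h' j * diagonal_var j)
      = Const (Var i) * (\<Sum>j\<in>UNIV. h j * diagonal_var j) + (\<Sum>j\<in>UNIV. if j = i then ?X * diagonal_var i else 0)"
    unfolding h'_def sum_distrib_left sum.distrib[symmetric]
    by (intro sum.cong) (auto simp: algebra_simps)
  also have "\<dots> = Const (Var i) * (?X - ?Y) + ?X * diagonal_var i"
    unfolding h(1)[symmetric] by simp
  also have "\<dots> = ?X * Var i - ?Y * Const (Var i)"
    by (simp add: algebra_simps)
  also have "\<dots> = in_x (single (\<mu> + single i (Suc 0)) 1)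
      - Const (single (\<mu> + single i (Suc 0)) 1)"
    by (simp add: in_x_single mult_single)
  finally have "in_x (single (\<mu> + single i (Suc 0)) 1)
      - Const (single (\<mu> + single i (Suc 0)) 1)
      = (\<Sum>j\<in>UNIV. h' j * diagonal_var j)" by simp
  moreover have "h' j \<in> weighted 1 {m. Suc m = total_degree (\<mu> + single i (Suc 0))}" for j
    unfolding h'_def
  proof (rule weighted_add)
    show "Const (Var i) * h j \<in> weighted 1 {m. Suc m = total_degree (\<mu> + single i (Suc 0))}"
      by (rule weighted_mult[OF Y h(2)]) auto
    show "(if j = i then ?X else 0) \<in> weighted 1 {m. Suc m = total_degree (\<mu> + single i (Suc 0))}"
      using weighted_mono[OF X] by auto
  qed
  ultimately show ?case by blast
qed

lemma divided_differences:
  fixes g :: "('n::finite, 'k::field) mpoly"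
  assumes g: "g \<in> graded_piece e"
  obtains h where "in_x g - Const g = (\<Sum>j\<in>UNIV. h j * diagonal_var j)"
    "\<And>j. h j \<in> weighted 1 {m. Suc m = e}"
proof -
  have "\<exists>h :: 'n \<Rightarrow> ('n, 'k) bipoly. in_x f - Const f = (\<Sum>j\<in>UNIV. h j * diagonal_var j)
     \<and> (\<forall>j. h j \<in> weighted 1 {m. Suc m = e})"
    if "f = (\<Sum>\<mu>\<in>A. single \<mu> (c \<mu>))" "finite A" "\<And>\<mu>. \<mu> \<in> A \<Longrightarrow> total_degree \<mu> = e" for A c f
    using that(2,1,3)
  proof (induction A arbitrary: f rule: finite_induct)
    case empty
    then show ?case by (intro exI[of _ "\<lambda>_. 0"]) (simp add: in_x_simps)
  next
    case (insert \<mu> A)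
    let ?f = "\<Sum>\<mu>\<in>A. single \<mu> (c \<mu>)"
    obtain h :: "'n \<Rightarrow> ('n, 'k) bipoly" where h: "in_x ?f - Const ?f = (\<Sum>j\<in>UNIV. h j * diagonal_var j)"
      "\<And>j. h j \<in> weighted 1 {m. Suc m = e}" using insert.IH[of ?f] insert.prems(2) by blast
    obtain h' :: "'n \<Rightarrow> ('n, 'k) bipoly" where
      h': "in_x (single \<mu> 1) - Const (single \<mu> 1) = (\<Sum>j\<in>UNIV. h' j * diagonal_var j)"
      "\<And>j. h' j \<in> weighted 1 {m. Suc m = total_degree \<mu>}"
      using divided_differences_monomial[of \<mu>] by blast
    let ?c = "Const (Const (c \<mu>)) :: ('n, 'k) bipoly"
    have f: "f = Const (c \<mu>) * single \<mu> 1 + ?f"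
      using insert by (simp add: mult_single)
    have "in_x f - Const f = ?c * (in_x (single \<mu> 1) - Const (single \<mu> 1))
        + (in_x ?f - Const ?f)"
      unfolding f by (simp add: in_x_simps(3,4) Const_simps(3,4) algebra_simps del: mult_single)
    also have "\<dots> = (\<Sum>j\<in>UNIV. (?c * h' j + h j) * diagonal_var j)"
      unfolding h h' sum_distrib_left sum.distrib[symmetric]
      by (intro sum.cong refl) (simp only: algebra_simps)
    finally have "in_x f - Const f = (\<Sum>j\<in>UNIV. (?c * h' j + h j) * diagonal_var j)" .
    moreover have "?c * h' j + h j \<in> weighted 1 {m. Suc m = e}" for j
    proof (rule weighted_add[OF _ h(2)])
      have "?c \<in> weighted 1 {0}" by (intro weighted_single2) simp
      then show "?c * h' j \<in> weighted 1 {m. Suc m = e}"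
        by (rule weighted_mult[OF _ h'(2)]) (use insert.prems(2)[of \<mu>] in auto)
    qed
    ultimately show ?case by (intro exI[of _ "\<lambda>j. ?c * h' j + h j"] conjI allI)
  qed
  from this[OF poly_mapping_sum_single[of g]] that show ?thesis
    using g by (auto simp: graded_piece_def)
qed

lemma in_x_minus_Const_ideal:
  fixes v :: "('n::finite, 'k::field) mpoly"
  shows "in_x v - Const v \<in> ideal_gen diagonal_var"
proof -
  obtain N where N: "\<And>\<mu>. lookup v \<mu> \<noteq> 0 \<Longrightarrow> total_degree \<mu> \<le> N"
    using total_degree_bounded[of v] by blast
  have "in_x (hom_part m v) - Const (hom_part m v) \<in> ideal_gen diagonal_var" for m
  proof -
    obtain h where "in_x (hom_part m v) - Const (hom_part m v) = (\<Sum>j\<in>UNIV. h j * diagonal_var j)"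
      using divided_differences[OF hom_part_graded[of m v]] by blast
    then show ?thesis by (simp only: ideal_genI)
  qed
  then have "(\<Sum>m\<le>N. in_x (hom_part m v) - Const (hom_part m v)) \<in> ideal_gen diagonal_var"
    by (intro ideal_gen_sum)
  moreover have "in_x v - Const v = (\<Sum>m\<le>N. in_x (hom_part m v) - Const (hom_part m v))"
  proof -
    have v: "v = (\<Sum>m\<le>N. hom_part m v)" by (rule sum_hom_part[OF N])
    have "in_x v = (\<Sum>m\<le>N. in_x (hom_part m v))" "(Const v :: ('n, 'k) bipoly) = (\<Sum>m\<le>N. Const (hom_part m v))"
      using arg_cong[OF v, of in_x] arg_cong[OF v, of "Const :: _ \<Rightarrow> ('n, 'k) bipoly"] unfolding in_x_simps(8) Const_simps(8) .
    then show ?thesis by (simp only: sum_subtractf)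
  qed
  ultimately show ?thesis by (simp only:)
qed

section \<open>The degree just below the socle degree\<close>

text \<open>
  The generators \<open>y b\<close> are removed one at a time: the relation for \<open>y c\<close> expresses \<open>(1 - a c) y c\<close> by the
  others, and \<open>\<epsilon>\<close> maps \<open>1 - a c\<close> to \<open>1\<close>. The multiplier \<open>e\<close> is the product of these factors.
\<close>

lemma nakayama:
  fixes \<epsilon> :: "'r::comm_ring_1 \<Rightarrow> 's::comm_ring_1" and y :: "'b \<Rightarrow> 'r"
  assumes \<epsilon>: "ring_map \<epsilon>" and I: "is_ideal I" and B: "finite B"
    and rel: "\<forall>b\<in>B. \<exists>a. (\<forall>b'. \<epsilon> (a b') = 0) \<and> y b - (\<Sum>b'\<in>B. a b' * y b') \<in> I"
  shows "\<exists>e. \<epsilon> e = 1 \<and> (\<forall>b\<in>B. e * y b \<in> I)"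
  using B rel
proof (induction B rule: finite_induct)
  case empty
  then show ?case using ring_mapD(2)[OF \<epsilon>] by blast
next
  case (insert c B)
  have add: "\<And>x y. x \<in> I \<Longrightarrow> y \<in> I \<Longrightarrow> x + y \<in> I" and mult: "\<And>r x. x \<in> I \<Longrightarrow> r * x \<in> I"
    using I by (auto simp: is_ideal_def)
  obtain a where a: "\<And>b'. \<epsilon> (a b') = 0" "y c - (a c * y c + (\<Sum>b'\<in>B. a b' * y b')) \<in> I"
    using insert by auto
  have "\<exists>a'. (\<forall>b'. \<epsilon> (a' b') = 0) \<and> y b - (\<Sum>b'\<in>B. a' b' * y b') \<in> I" if b: "b \<in> B" for b
  proof -
    obtain a1 where a1: "\<And>b'. \<epsilon> (a1 b') = 0" "y b - (a1 c * y c + (\<Sum>b'\<in>B. a1 b' * y b')) \<in> I"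
      using bspec[OF insert.prems, of b] b insert(1,2) by auto
    \<comment> \<open>The relations for the remaining generators, after \<open>y c\<close> is eliminated by cross-multiplication
      with \<open>1 - a c\<close>.\<close>
    define a' where "a' b' = (if b' = b then a c else 0) + (1 - a c) * a1 b' + a1 c * a b'" for b'
    have "(\<Sum>b'\<in>B. (if b' = b then a c else 0) * y b') = (\<Sum>b'\<in>B. if b' = b then a c * y b else 0)"
      by (intro sum.cong) auto
    also have "\<dots> = a c * y b" using b insert(1) by simp
    finally have d: "(\<Sum>b'\<in>B. (if b' = b then a c else 0) * y b') = a c * y b" .
    have "(\<Sum>b'\<in>B. a' b' * y b') = a c * y b + (1 - a c) * (\<Sum>b'\<in>B. a1 b' * y b') + a1 c * (\<Sum>b'\<in>B. a b' * y b')"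
      unfolding a'_def sum_distrib_left d[symmetric] sum.distrib[symmetric]
      by (intro sum.cong refl) (simp only: algebra_simps)
    then have "y b - (\<Sum>b'\<in>B. a' b' * y b') = (1 - a c) * (y b - (a1 c * y c + (\<Sum>b'\<in>B. a1 b' * y b')))
        + a1 c * (y c - (a c * y c + (\<Sum>b'\<in>B. a b' * y b')))"
      by (simp add: algebra_simps)
    also have "\<dots> \<in> I" by (intro add mult a a1)
    finally have "y b - (\<Sum>b'\<in>B. a' b' * y b') \<in> I" .
    moreover have "\<epsilon> (a' b') = 0" for b' by (simp add: a'_def ring_mapD[OF \<epsilon>] a a1)
    ultimately show ?thesis by blast
  qed
  then obtain e where e: "\<epsilon> e = 1" "\<And>b. b \<in> B \<Longrightarrow> e * y b \<in> I" using insert.IH by blast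
  let ?e = "e * (1 - a c)"
  have "?e * y b \<in> I" if "b \<in> B" for b
    using mult[OF e(2)[OF that], of "1 - a c"] by (simp add: ac_simps)
  moreover have "?e * y c \<in> I"
  proof -
    have "?e * y c = e * (y c - (a c * y c + (\<Sum>b'\<in>B. a b' * y b'))) + (\<Sum>b'\<in>B. a b' * (e * y b'))"
      by (simp add: algebra_simps sum_distrib_left)
    also have "\<dots> \<in> I" by (intro add mult a is_ideal_sum[OF I] e)
    finally show ?thesis .
  qed
  moreover have "\<epsilon> ?e = 1" by (simp add: ring_mapD[OF \<epsilon>] e a)
  ultimately show ?case by blast
qed

text \<open>
  A form vanishes at all coordinate points if and only if its monomials are mixed.
\<close>

definition mixed :: "('n \<Rightarrow>\<^sub>0 nat) \<Rightarrow> bool" where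
  "mixed \<mu> \<longleftrightarrow> (\<exists>i j. i \<noteq> j \<and> lookup \<mu> i \<noteq> 0 \<and> lookup \<mu> j \<noteq> 0)"

text \<open>
  The powers of the maximal ideal of the origin.
\<close>

definition order_ge :: "nat \<Rightarrow> ('n::finite, 'k::field) mpoly set" where
  "order_ge K = {f. \<forall>\<mu>. lookup f \<mu> \<noteq> 0 \<longrightarrow> K \<le> total_degree \<mu>}"

lemma mixed_add: "mixed \<mu> \<Longrightarrow> mixed (\<mu> + \<nu>)"
  unfolding mixed_def by (auto simp: lookup_add)

lemma not_mixedE:
  assumes "\<not> mixed \<mu>" obtains i where "\<mu> = single i (total_degree \<mu>)"
proof (cases "\<exists>i. lookup \<mu> i \<noteq> 0")
  case True
  then obtain i where i: "lookup \<mu> i \<noteq> 0" by blast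
  have "\<mu> = single i (lookup \<mu> i)"
  proof (rule poly_mapping_eqI)
    show "lookup \<mu> k = lookup (single i (lookup \<mu> i)) k" for k
      using assms i unfolding mixed_def by (metis lookup_single_eq lookup_single_not_eq)
  qed
  then have "\<mu> = single i (total_degree \<mu>)" by (metis total_degree_single)
  then show ?thesis using that by blast
next
  case False
  then have "\<mu> = 0" by (intro poly_mapping_eqI) simp
  then show ?thesis using that by simp
qed

lemma order_ge_0 [simp]: "0 \<in> order_ge K"
  by (simp add: order_ge_def)

lemma order_ge_add: "f \<in> order_ge K \<Longrightarrow> g \<in> order_ge K \<Longrightarrow> f + g \<in> order_ge K"
  by (auto simp: order_ge_def lookup_add) (metis add_0)

lemma order_ge_uminus: "f \<in> order_ge K \<Longrightarrow> - f \<in> order_ge K"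
  by (auto simp: order_ge_def)

lemma order_ge_sum: "(\<And>a. a \<in> A \<Longrightarrow> f a \<in> order_ge K) \<Longrightarrow> sum f A \<in> order_ge K"
  by (induction A rule: infinite_finite_induct) (auto intro: order_ge_add)

lemma order_ge_mono: "f \<in> order_ge K \<Longrightarrow> L \<le> K \<Longrightarrow> f \<in> order_ge L"
  by (force simp: order_ge_def)

lemma order_ge_graded: "f \<in> graded_piece m \<Longrightarrow> K \<le> m \<Longrightarrow> f \<in> order_ge K"
  by (auto simp: order_ge_def dest: graded_pieceD)

lemma order_ge_mult:
  assumes "f \<in> order_ge K" "g \<in> order_ge L" shows "f * g \<in> order_ge (K + L)"
  unfolding order_ge_def
proof clarify
  fix \<mu> assume "lookup (f * g) \<mu> \<noteq> 0"
  then obtain a b where "\<mu> = a + b" "a \<in> keys f" "b \<in> keys g"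
    using keys_mult[of f g] by (auto simp: in_keys_iff)
  then show "K + L \<le> total_degree \<mu>"
    using assms by (auto simp: order_ge_def in_keys_iff intro: add_mono)
qed

lemma order_ge_mult_left: "g \<in> order_ge L \<Longrightarrow> f * g \<in> order_ge L"
  using order_ge_mult[of f 0 g L] by (simp add: order_ge_def)

lemma hom_part_order_ge: "f \<in> order_ge K \<Longrightarrow> m < K \<Longrightarrow> hom_part m f = 0"
  by (intro poly_mapping_eqI) (force simp: lookup_hom_part order_ge_def)

lemma split_exponent:
  "m \<le> total_degree \<mu> \<Longrightarrow> \<exists>\<nu> \<sigma>. \<mu> = \<nu> + \<sigma> \<and> total_degree \<nu> = m" for \<mu> :: "'n::finite \<Rightarrow>\<^sub>0 nat"
proof (induction \<mu> rule: exponent_induct)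
  case zero
  then show ?case by (intro exI[of _ 0]) simp
next
  case (add_single \<mu> i)
  show ?case
  proof (cases "m \<le> total_degree \<mu>")
    case True
    then obtain \<nu> \<sigma> where "\<mu> = \<nu> + \<sigma>" "total_degree \<nu> = m" using add_single.IH by blast
    then show ?thesis
      by (intro exI[of _ \<nu>] exI[of _ "\<sigma> + single i (Suc 0)"]) (simp add: add.assoc)
  next
    case False
    then have "m = total_degree (\<mu> + single i (Suc 0))" using add_single.prems by simp
    then show ?thesis by (intro exI[of _ "\<mu> + single i (Suc 0)"] exI[of _ 0]) simp
  qed
qed

lemma order_ge_decompose:
  fixes f :: "('n::finite, 'k::field) mpoly"
  assumes "f \<in> order_ge (m + l)"
  shows "\<exists>b. (\<forall>\<nu>. b \<nu> \<in> order_ge l)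
    \<and> f = (\<Sum>\<nu>\<in>{\<nu>. total_degree \<nu> = m}. b \<nu> * single \<nu> 1)"
proof -
  have fin: "finite {\<nu> :: 'n \<Rightarrow>\<^sub>0 nat. total_degree \<nu> = m}"
    by (rule finite_subset[OF _ finite_total_degree_le[of m]]) auto
  have "\<exists>b :: _ \<Rightarrow> ('n, 'k) mpoly. (\<forall>\<nu>. b \<nu> \<in> order_ge l)
    \<and> (\<Sum>\<mu>\<in>A. single \<mu> (c \<mu>)) = (\<Sum>\<nu>\<in>{\<nu>. total_degree \<nu> = m}. b \<nu> * single \<nu> 1)"
    if "finite A" "\<forall>\<mu>\<in>A. m + l \<le> total_degree \<mu>" for A c
    using that
  proof (induction A rule: finite_induct)
    case empty
    then show ?case by (intro exI[of _ "\<lambda>_. 0"]) simp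
  next
    case (insert \<mu> A)
    then obtain b :: "_ \<Rightarrow> ('n, 'k) mpoly" where b: "\<And>\<nu>. b \<nu> \<in> order_ge l"
      "(\<Sum>\<mu>\<in>A. single \<mu> (c \<mu>)) = (\<Sum>\<nu>\<in>{\<nu>. total_degree \<nu> = m}. b \<nu> * single \<nu> 1)"
      by auto
    obtain \<nu>0 \<sigma> where \<nu>0: "\<mu> = \<nu>0 + \<sigma>" "total_degree \<nu>0 = m"
      using split_exponent[of m \<mu>] insert.prems by auto
    have "single \<sigma> (c \<mu>) \<in> order_ge l"
      using insert.prems \<nu>0 by (intro order_ge_graded[OF graded_single[OF refl]]) auto
    moreover have "(\<Sum>\<nu>\<in>{\<nu>. total_degree \<nu> = m}.
        (b \<nu> + (if \<nu> = \<nu>0 then single \<sigma> (c \<mu>) else 0)) * single \<nu> 1)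
      = single \<mu> (c \<mu>) + (\<Sum>\<mu>\<in>A. single \<mu> (c \<mu>))"
    proof -
      have "(\<Sum>\<nu>\<in>{\<nu>. total_degree \<nu> = m}.
          (if \<nu> = \<nu>0 then single \<sigma> (c \<mu>) else 0) * single \<nu> (1::'k))
        = (\<Sum>\<nu>\<in>{\<nu>. total_degree \<nu> = m}. if \<nu> = \<nu>0 then single \<mu> (c \<mu>) else 0)"
        by (intro sum.cong) (auto simp: mult_single \<nu>0 add.commute)
      then show ?thesis using fin \<nu>0 by (simp add: distrib_right sum.distrib b(2))
    qed
    ultimately show ?case
      using b(1) insert by (intro exI[of _ "\<lambda>\<nu>. b \<nu> + (if \<nu> = \<nu>0 then single \<sigma> (c \<mu>) else 0)"])
        (auto intro: order_ge_add)
  qed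
  from this[of "keys f" "lookup f"] show ?thesis
    using assms by (simp add: order_ge_def in_keys_iff flip: poly_mapping_sum_single)
qed

lemma ring_map_constant_term: "ring_map (\<lambda>f :: ('n::finite, 'k::field) mpoly. lookup f 0)"
proof -
  have "eval_mpoly f 0 = lookup f 0" for f :: "('n, 'k) mpoly"
  proof (induction f rule: poly_mapping_induct_single)
    case (single \<mu> c)
    have "(\<Prod>i\<in>UNIV. (0::'k) ^ lookup \<mu> i) = (1 when \<mu> = 0)"
    proof (cases "\<mu> = 0")
      case False
      then obtain i where "lookup \<mu> i \<noteq> 0" by (metis poly_mapping_eqI lookup_zero)
      then have "(\<Prod>i\<in>UNIV. (0::'k) ^ lookup \<mu> i) = 0" by (intro prod_zero) auto
      then show ?thesis using False by simp
    qed simp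
    then show ?case by (auto simp: eval_single lookup_single when_def)
  qed (auto simp: eval_simps lookup_add)
  then have "(\<lambda>f :: ('n, 'k) mpoly. lookup f 0) = (\<lambda>f. eval_mpoly f 0)" by auto
  then show ?thesis by (simp only: ring_map_eval)
qed

subsection \<open>Determinants\<close>

lemma weighted_of_int_sign:
  "s \<in> weighted w A \<Longrightarrow> of_int (sign p) * s \<in> weighted w A"
  by (cases "evenperm p") (auto simp: sign_def weighted_uminus)

lemma det_weighted:
  fixes A :: "('n::finite, 'k::field) bipoly ^ 'n ^ 'n"
  assumes "\<And>i j. A $ i $ j \<in> weighted w {m}"
  shows "det A \<in> weighted w {CARD('n) * m}"
  unfolding det_def
proof (intro weighted_sum weighted_of_int_sign)
  fix p :: "'n \<Rightarrow> 'n"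
  show "(\<Prod>i\<in>UNIV. A $ i $ p i) \<in> weighted w {CARD('n) * m}"
    using weighted_prod[of UNIV "\<lambda>i. A $ i $ p i" w m] assms by simp
qed

lemma det_diagonal_perturbed:
  fixes D :: "'n::finite \<Rightarrow> ('n, 'k::field) bipoly"
  assumes D: "\<And>i. D i \<in> weighted w {m}" and h: "\<And>i j. h i j \<in> weighted w {..<m}"
  shows "det (\<chi> i j. (if i = j then D i else 0) + h i j) - (\<Prod>i\<in>UNIV. D i) \<in> weighted w {..<CARD('n) * m}"
proof -
  have "(\<Prod>i\<in>UNIV. D i) = det (\<chi> i j. if i = j then D i else 0)"
    by (subst det_diagonal) auto
  then have "det (\<chi> i j. (if i = j then D i else 0) + h i j) - (\<Prod>i\<in>UNIV. D i)
    = (\<Sum>p | p permutes (UNIV :: 'n set). of_int (sign p) *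
        ((\<Prod>i\<in>UNIV. (if i = p i then D i else 0) + h i (p i)) - (\<Prod>i\<in>UNIV. if i = p i then D i else 0)))"
    by (simp add: det_def right_diff_distrib sum_subtractf)
  also have "\<dots> \<in> weighted w {..<CARD('n) * m}"
    using D h by (intro weighted_sum weighted_of_int_sign weighted_prod_perturbed) auto
  finally show ?thesis .
qed

lemma prod_diff_ideal_gen:
  assumes "finite S" "\<And>i. i \<in> S \<Longrightarrow> f i - h i \<in> ideal_gen g"
  shows "prod f S - prod h S \<in> ideal_gen g"
  using assms
proof (induction S rule: finite_induct)
  case (insert i S)
  then have "f i * (prod f S - prod h S) + (f i - h i) * prod h S \<in> ideal_gen g"
    by (intro ideal_gen_add ideal_gen_mult ideal_gen_mult_right) auto
  then show ?case using insert by (simp add: algebra_simps)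
qed simp

lemma det_diagonal_perturbed_ideal:
  fixes D :: "'n::finite \<Rightarrow> 'r::comm_ring_1"
  shows "det (\<chi> i j. (if i = j then D i else 0) + h i j) - det (\<chi> i j. h i j) \<in> ideal_gen D"
proof -
  have "det (\<chi> i j. (if i = j then D i else 0) + h i j) - det (\<chi> i j. h i j)
    = (\<Sum>p | p permutes (UNIV :: 'n set). of_int (sign p) *
        ((\<Prod>i\<in>UNIV. (if i = p i then D i else 0) + h i (p i)) - (\<Prod>i\<in>UNIV. h i (p i))))"
    by (simp add: det_def right_diff_distrib sum_subtractf)
  also have "\<dots> \<in> ideal_gen D"
    by (intro ideal_gen_sum ideal_gen_mult prod_diff_ideal_gen) auto
  finally show ?thesis .
qed

lemma weighted_lookup_graded:
  assumes "s \<in> weighted 1 {T}"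
  shows "lookup s \<nu> \<in> graded_piece (T - total_degree \<nu>)"
    "lookup s \<nu> \<noteq> 0 \<Longrightarrow> total_degree \<nu> \<le> T"
proof -
  show "lookup s \<nu> \<in> graded_piece (T - total_degree \<nu>)"
    using assms by (intro graded_pieceI) (fastforce simp: weighted_def)
  assume "lookup s \<nu> \<noteq> 0"
  then obtain \<mu> where "lookup (lookup s \<nu>) \<mu> \<noteq> 0"
    by (metis poly_mapping_eqI lookup_zero)
  then have "total_degree \<nu> + 1 * total_degree \<mu> = T" using assms unfolding weighted_def by blast
  then show "total_degree \<nu> \<le> T" by linarith
qed

lemma ideal_gen_image:
  assumes "ring_map \<phi>" "\<And>l. \<phi> (w l) \<in> ideal_gen g" "x \<in> ideal_gen w"
  shows "\<phi> x \<in> ideal_gen g"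
proof -
  obtain a where "x = (\<Sum>i\<in>UNIV. a i * w i)" using assms(3) by (auto simp: ideal_gen_def)
  then show ?thesis
    using assms(2) by (auto simp: ring_mapD[OF assms(1)] intro!: ideal_gen_sum ideal_gen_mult)
qed

lemma total_degree_eq_1:
  assumes "total_degree \<nu> = Suc 0" obtains i where "\<nu> = single i (Suc 0)"
proof (cases "mixed \<nu>")
  case True
  then obtain i j where ij: "i \<noteq> j" "lookup \<nu> i \<noteq> 0" "lookup \<nu> j \<noteq> 0"
    by (auto simp: mixed_def)
  have "(\<Sum>l\<in>{i, j}. lookup \<nu> l) \<le> total_degree \<nu>"
    unfolding total_degree_def by (intro sum_mono2) auto
  then show ?thesis using assms ij by simp
next
  case False
  then show ?thesis using not_mixedE[of \<nu>] assms that by metis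
qed

text \<open>
  Restricting the Bezoutian to the point \<open>x = e\<^sub>i\<close>, where all \<open>g\<^sub>l\<close> vanish, makes it a multiple of every
  \<open>y\<^sub>j - \<delta>\<^sub>i\<^sub>j\<close> modulo \<open>g(y)\<close>. Since \<open>1 - y\<^sub>i\<close> times it lies in the homogeneous ideal \<open>(g)\<close>, so does it.
\<close>

lemma bezoutian_linear_coefficient:
  fixes g :: "'n::finite \<Rightarrow> ('n, 'k::field) mpoly" and A :: "('n, 'k) bipoly ^ 'n ^ 'n"
  assumes g: "\<forall>i. g i \<in> graded_piece e" and gm: "\<forall>i \<mu>. lookup (g i) \<mu> \<noteq> 0 \<longrightarrow> mixed \<mu>"
    and A: "\<And>i. in_x (g i) - Const (g i) = (\<Sum>j\<in>UNIV. A $ i $ j * diagonal_var j)"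
    and dA: "det A \<in> weighted 1 {T}"
  shows "lookup (det A) (single i (Suc 0)) \<in> ideal_gen g"
proof -
  define at_axis :: "('n, 'k) bipoly \<Rightarrow> ('n, 'k) mpoly" where
    "at_axis = insert_vars (\<lambda>c. c) (\<lambda>j. if j = i then 1 else 0)"
  have at_axis: "ring_map at_axis" unfolding at_axis_def by (rule ring_map_insert_vars[OF ring_map_id])
  have at_axis_Const: "at_axis (Const r) = r" for r by (simp add: at_axis_def ring_map_id)
  have at_axis_Var: "at_axis (Var j) = (if j = i then 1 else 0)" for j by (simp add: at_axis_def ring_map_id)
  define p where "p = (\<chi> j. if j = i then 1 else (0::'k))"
  \<comment> \<open>The substitution of the coordinate point for \<open>x\<close>, which leaves \<open>y\<close> alone.\<close>
  have at_axis_in_x: "at_axis (in_x f) = Const (eval_mpoly f p)" for f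
    by (rule ring_map_eqI[of "\<lambda>f. at_axis (in_x f)" "\<lambda>f. Const (eval_mpoly f p)"])
      (auto simp: at_axis_Const at_axis_Var p_def intro: ring_map_comp[OF at_axis ring_map_in_x] ring_map_comp[OF ring_map_Const ring_map_eval])
  have "eval_mpoly (g l) p = 0" for l
    unfolding eval_mpoly_def
  proof (rule sum.neutral, rule ballI)
    fix \<mu> assume "\<mu> \<in> keys (g l)"
    then have "mixed \<mu>" using gm by (auto simp: in_keys_iff)
    then obtain j where "j \<noteq> i" "lookup \<mu> j \<noteq> 0" unfolding mixed_def by metis
    then have "(\<Prod>j\<in>UNIV. p $ j ^ lookup \<mu> j) = 0"
      by (intro prod_zero) (auto simp: p_def)
    then show "lookup (g l) \<mu> * (\<Prod>j\<in>UNIV. p $ j ^ lookup \<mu> j) = 0" by simp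
  qed
  then have atg: "at_axis (in_x (g l) - Const (g l)) \<in> ideal_gen g" for l
    by (simp add: ring_mapD(6)[OF at_axis] at_axis_in_x at_axis_Const ideal_gen_uminus)
  define q where "q = at_axis (det A)"
  have "at_axis (det A * diagonal_var i) \<in> ideal_gen g"
    by (rule ideal_gen_image[OF at_axis atg cramer_ideal[OF A]])
  then have q: "q - q * Var i \<in> ideal_gen g"
    by (simp add: ring_mapD(4,6)[OF at_axis] at_axis_Var at_axis_Const q_def right_diff_distrib)
  \<comment> \<open>The difference \<open>q - q y\<^sub>i\<close> determines the homogeneous parts of \<open>q\<close> from below.\<close>
  have "hom_part m q \<in> ideal_gen g" for m
  proof (induction m)
    case 0
    then show ?case using hom_part_in_ideal_gen[OF g q, of 0]
      by (simp add: hom_part_diff hom_part_mult[OF graded_Var])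
  next
    case (Suc m)
    have "hom_part (Suc m) q - hom_part m q * Var i \<in> ideal_gen g"
      using hom_part_in_ideal_gen[OF g q, of "Suc m"]
      by (simp add: hom_part_diff hom_part_mult[OF graded_Var])
    moreover have "hom_part m q * Var i \<in> ideal_gen g" using Suc by (rule ideal_gen_mult_right)
    ultimately show ?case using ideal_gen_add by fastforce
  qed
  moreover have "hom_part (T - 1) q = lookup (det A) (single i (Suc 0))"
    if T: "T > 0"
  proof -
    let ?L = "lookup (det A)"
    have t: "hom_part (T - 1) (?L \<nu> * (\<Prod>j\<in>UNIV. (if j = i then 1 else 0) ^ lookup \<nu> j))
        = (if \<nu> = single i (Suc 0) then ?L \<nu> else 0)" if "\<nu> \<in> keys (det A)" for \<nu>
    proof (cases "\<exists>j. j \<noteq> i \<and> lookup \<nu> j \<noteq> 0")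
      case True
      then obtain j where j: "j \<noteq> i" "lookup \<nu> j \<noteq> 0" by blast
      then have "(\<Prod>j\<in>UNIV. (if j = i then 1 else 0 :: ('n, 'k) mpoly) ^ lookup \<nu> j) = 0"
        by (intro prod_zero[OF finite] bexI[of _ j]) (simp_all add: zero_power)
      moreover have "\<nu> \<noteq> single i (Suc 0)" using j by (auto simp: lookup_single)
      ultimately show ?thesis by simp
    next
      case False
      then have "(\<Prod>j\<in>UNIV. (if j = i then 1 else 0 :: ('n, 'k) mpoly) ^ lookup \<nu> j) = 1"
        by (intro prod.neutral) auto
      moreover have \<nu>: "\<nu> = single i (total_degree \<nu>)"
      proof -
        have "\<not> mixed \<nu>" using False unfolding mixed_def by metis
        then obtain l where l: "\<nu> = single l (total_degree \<nu>)" by (rule not_mixedE)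
        show ?thesis
        proof (cases "total_degree \<nu> = 0")
          case False
          then have "lookup \<nu> l \<noteq> 0" by (subst l) simp
          then show ?thesis using \<open>\<nexists>j. j \<noteq> i \<and> lookup \<nu> j \<noteq> 0\<close> l by metis
        qed simp
      qed
      moreover have "total_degree \<nu> \<le> T"
        using weighted_lookup_graded(2)[OF dA, of \<nu>] that by (auto simp: in_keys_iff)
      moreover have "total_degree \<nu> = 1 \<longleftrightarrow> \<nu> = single i (Suc 0)"
        using \<nu> by (metis One_nat_def total_degree_single)
      ultimately show ?thesis
        using weighted_lookup_graded(1)[OF dA, of \<nu>] T
          hom_part_id[of "?L \<nu>" "T - total_degree \<nu>"] hom_part_other[of "?L \<nu>" "T - total_degree \<nu>" "T - 1"]
        by (cases "total_degree \<nu> = 1") auto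
    qed
    have "hom_part (T - 1) q = (\<Sum>\<nu>\<in>keys (det A). if \<nu> = single i (Suc 0) then ?L \<nu> else 0)"
      unfolding q_def at_axis_def insert_vars_def hom_part_sum by (intro sum.cong t refl)
    then show ?thesis by (auto simp: not_in_keys_iff_lookup_eq_zero)
  qed
  moreover have "lookup (det A) (single i (Suc 0)) = 0" if "T = 0"
    using weighted_lookup_graded(2)[OF dA, of "single i (Suc 0)"] that by auto
  ultimately show ?thesis by (cases "T = 0") (metis ideal_gen_0, metis neq0_conv)
qed

subsection \<open>The perturbed family near the origin\<close>

text \<open>
  A mixed form of large degree is a combination \<open>\<Sum>a\<^sub>i g\<^sub>i\<close>, which is \<open>- \<Sum>a\<^sub>i x\<^sub>i\<^sup>M\<close> modulo the perturbed family;
  since \<open>M > e\<close> in the applications, this raises the order.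
\<close>

lemma mixed_form_reduces:
  fixes g :: "'n::finite \<Rightarrow> ('n, 'k::field) mpoly"
  assumes g: "\<forall>i. g i \<in> graded_piece e"
    and c: "\<forall>\<mu>. mixed \<mu> \<longrightarrow> c \<le> total_degree \<mu> \<longrightarrow> single \<mu> 1 \<in> ideal_gen g"
    and f: "f \<in> graded_piece D" "\<forall>\<mu>. lookup f \<mu> \<noteq> 0 \<longrightarrow> mixed \<mu>" and D: "c \<le> D"
  obtains r where "r \<in> order_ge (M + (D - e))" "f - r \<in> ideal_gen (\<lambda>i. Var i ^ M + g i)"
proof -
  have "f = (\<Sum>\<mu>\<in>keys f. Const (lookup f \<mu>) * single \<mu> 1)"
    by (simp add: mult_single flip: poly_mapping_sum_single)
  moreover have "\<dots> \<in> ideal_gen g"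
    using f c D graded_pieceD[OF f(1)] by (intro ideal_gen_sum ideal_gen_mult) (auto simp: in_keys_iff)
  ultimately have "f \<in> ideal_gen g" by simp
  then obtain a where a: "\<And>i. a i \<in> graded_piece (D - e)" "hom_part D f = (\<Sum>i\<in>UNIV. a i * g i)"
    using ideal_gen_hom_part[OF g, of f D] by blast
  have f_eq: "f = (\<Sum>i\<in>UNIV. a i * g i)" using a(2) hom_part_id[OF f(1)] by simp
  define r where "r = - (\<Sum>i\<in>UNIV. a i * Var i ^ M)"
  have "(Var i :: ('n, 'k) mpoly) ^ M \<in> order_ge M" for i
    unfolding Var_power by (intro order_ge_graded[OF graded_single]) auto
  then have "a i * Var i ^ M \<in> order_ge (M + (D - e))" for i
    using order_ge_mult[of "Var i ^ M" M "a i" "D - e"] order_ge_graded[OF a(1)[of i], of "D - e"]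
    by (simp add: mult.commute)
  then have "r \<in> order_ge (M + (D - e))"
    unfolding r_def by (intro order_ge_uminus order_ge_sum)
  moreover have "f - r = (\<Sum>i\<in>UNIV. a i * (Var i ^ M + g i))"
    unfolding r_def f_eq by (simp add: distrib_left sum.distrib)
  then have "f - r \<in> ideal_gen (\<lambda>i. Var i ^ M + g i)" by (simp only: ideal_genI)
  ultimately show ?thesis using that[of r] by blast
qed

text \<open>
  On the line through \<open>e\<^sub>i\<close> the form \<open>g\<^sub>i\<close> vanishes to second order. So \<open>x\<^sub>i\<^sup>2\<^sup>c g\<^sub>i\<close> is a combination of
  the \<open>g\<^sub>l\<close> with mixed coefficients, and modulo the perturbed family \<open>x\<^sub>i\<^sup>M\<^sup>+\<^sup>2\<^sup>c\<close> becomes a mixed form of the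
  same degree, which reduces to a higher order.
\<close>

lemma monomial_reduces:
  fixes g :: "'n::finite \<Rightarrow> ('n, 'k::field) mpoly"
  assumes g: "\<forall>i. g i \<in> graded_piece e"
    and g2: "\<forall>i \<mu>. lookup (g i) \<mu> \<noteq> 0 \<longrightarrow> lookup \<mu> i + 2 \<le> e"
    and c: "\<forall>\<mu>. mixed \<mu> \<longrightarrow> c \<le> total_degree \<mu> \<longrightarrow> single \<mu> 1 \<in> ideal_gen g"
    and c1: "c \<ge> 1" and M: "e < M" and \<mu>: "total_degree \<mu> = M + 2 * c"
  obtains r where "r \<in> order_ge (Suc (M + 2 * c))"
    "single \<mu> 1 - r \<in> ideal_gen (\<lambda>i. Var i ^ M + g i)"
proof -
  let ?G = "\<lambda>i. Var i ^ M + g i"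
  have mixed: "\<exists>r\<in>order_ge (Suc (M + 2 * c)). f - r \<in> ideal_gen ?G"
    if f: "f \<in> graded_piece (M + 2 * c)" "\<forall>\<mu>. lookup f \<mu> \<noteq> 0 \<longrightarrow> mixed \<mu>" for f
  proof -
    obtain r where r: "r \<in> order_ge (M + (M + 2 * c - e))" "f - r \<in> ideal_gen ?G"
      by (rule mixed_form_reduces[OF g c f]) auto
    have "r \<in> order_ge (Suc (M + 2 * c))" using M by (intro order_ge_mono[OF r(1)]) linarith
    then show ?thesis using r(2) by blast
  qed
  have "\<exists>r\<in>order_ge (Suc (M + 2 * c)). single \<mu> 1 - r \<in> ideal_gen ?G"
  proof (cases "mixed \<mu>")
    case True
    then show ?thesis
      using \<mu> by (intro mixed graded_single) (auto simp: lookup_single when_def)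
  next
    case False
    then obtain i where i: "\<mu> = single i (M + 2 * c)" using \<mu> by (metis not_mixedE)
    let ?X = "Var i ^ (2 * c) :: ('n, 'k) mpoly"
    have ex: "\<exists>f. f \<in> graded_piece (M + 2 * c) \<and> (\<forall>\<mu>. lookup f \<mu> \<noteq> 0 \<longrightarrow> mixed \<mu>)
        \<and> ?X * single \<gamma> a - f \<in> ideal_gen ?G"
      if \<gamma>: "lookup \<gamma> i + 2 \<le> e" "total_degree \<gamma> = e" for \<gamma> a
    proof -
      have "total_degree \<gamma> = lookup \<gamma> i + (\<Sum>j\<in>UNIV - {i}. lookup \<gamma> j)"
        unfolding total_degree_def by (rule sum.remove) auto
      then have two: "(\<Sum>j\<in>UNIV - {i}. lookup \<gamma> j) \<ge> 2" using \<gamma> by simp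
      then have "\<exists>j\<in>UNIV - {i}. lookup \<gamma> j \<noteq> 0"
        by (metis (no_types, lifting) not_numeral_le_zero sum.neutral)
      then obtain j where j: "j \<noteq> i" "lookup \<gamma> j \<noteq> 0" by auto
      define \<gamma>' where "\<gamma>' = \<gamma> - single j (Suc 0)"
      have \<gamma>': "\<gamma> = single j (Suc 0) + \<gamma>'"
      proof (rule poly_mapping_eqI)
        show "lookup \<gamma> l = lookup (single j (Suc 0) + \<gamma>') l" for l
          using j by (cases "l = j") (auto simp: \<gamma>'_def lookup_add lookup_minus lookup_single)
      qed
      have "(\<Sum>l\<in>UNIV - {i}. lookup \<gamma> l)
          = (\<Sum>l\<in>UNIV - {i}. lookup (single j (Suc 0)) l)
            + (\<Sum>l\<in>UNIV - {i}. lookup \<gamma>' l)"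
        unfolding \<gamma>' lookup_add by (rule sum.distrib)
      also have "(\<Sum>l\<in>UNIV - {i}. lookup (single j (Suc 0)) l) = 1"
        using j by (simp add: lookup_single when_def)
      finally have "(\<Sum>l\<in>UNIV - {i}. lookup \<gamma>' l) \<noteq> 0" using two by linarith
      then have "\<exists>l\<in>UNIV - {i}. lookup \<gamma>' l \<noteq> 0"
        by (metis (no_types, lifting) sum.neutral)
      then obtain l where l: "l \<noteq> i" "lookup \<gamma>' l \<noteq> 0" by auto
      \<comment> \<open>Both factors of \<open>x\<^sub>i\<^sup>2\<^sup>c \<gamma> = (x\<^sub>i\<^sup>c x\<^sub>j) (x\<^sub>i\<^sup>c \<gamma>')\<close> are mixed, because \<open>\<gamma>\<close> contains two variables other than
        \<open>x\<^sub>i\<close>, possibly equal. The second factor lies in the ideal, the first one keeps its coefficients mixed.\<close>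
      define \<delta> where "\<delta> = single i c + \<gamma>'"
      have mdelta: "mixed \<delta>" unfolding mixed_def
        by (rule exI[of _ i], rule exI[of _ l]) (use l c1 in \<open>auto simp: \<delta>_def lookup_add lookup_single\<close>)
      have tg: "Suc (total_degree \<gamma>') = e" using \<gamma>(2) unfolding \<gamma>' by simp
      then have td: "total_degree \<delta> = c + (e - 1)" "e \<ge> 1" by (auto simp: \<delta>_def)
      obtain b where b: "\<And>l. b l \<in> graded_piece (c + (e - 1) - e)"
        "hom_part (c + (e - 1)) (single \<delta> 1) = (\<Sum>l\<in>UNIV. b l * g l)"
        using ideal_gen_hom_part[OF g, of "single \<delta> 1" "c + (e - 1)"] c mdelta td by auto
      have b_eq: "single \<delta> 1 = (\<Sum>l\<in>UNIV. b l * g l)"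
        using b(2) hom_part_id[OF graded_single[OF td(1), of "1::'k"]] by simp
      define \<nu> where "\<nu> = single i c + single j (Suc 0)"
      have m\<nu>: "mixed \<nu>" unfolding mixed_def
        by (rule exI[of _ i], rule exI[of _ j]) (use j c1 in \<open>auto simp: \<nu>_def lookup_add lookup_single\<close>)
      define f where "f = - (\<Sum>l\<in>UNIV. single \<nu> a * (b l * Var l ^ M))"
      have keys: "mixed \<mu>" if "lookup (single \<nu> a * h) \<mu> \<noteq> 0" for h \<mu>
      proof -
        have "\<mu> \<in> keys (single \<nu> a * h)" using that by (simp add: in_keys_iff)
        then obtain x y where "\<mu> = x + y" "x \<in> keys (single \<nu> a)"
          using keys_mult by blast
        then show ?thesis using mixed_add[OF m\<nu>] by (auto split: if_splits)
      qed
      have f': "f = single \<nu> a * (- (\<Sum>l\<in>UNIV. b l * Var l ^ M))"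
        by (simp add: f_def sum_distrib_left)
      have "single \<nu> a * (b l * Var l ^ M) \<in> graded_piece (Suc c + ((c + (e - 1) - e) + M))" for l
        unfolding Var_power by (intro graded_mult b graded_single) (auto simp: \<nu>_def)
      moreover have "Suc c + ((c + (e - 1) - e) + M) = M + 2 * c" using c1 td(2) by simp
      ultimately have "single \<nu> a * (b l * Var l ^ M) \<in> graded_piece (M + 2 * c)" for l
        by (simp only:)
      then have "f \<in> graded_piece (M + 2 * c)"
        unfolding f_def by (intro graded_uminus graded_sum)
      moreover have "\<forall>\<mu>. lookup f \<mu> \<noteq> 0 \<longrightarrow> mixed \<mu>" unfolding f' using keys by blast
      moreover have "?X * single \<gamma> a - f \<in> ideal_gen ?G"
      proof -
        have "?X * single \<gamma> a = single \<nu> a * single \<delta> 1"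
          unfolding Var_power \<gamma>' \<nu>_def \<delta>_def mult_2 by (simp add: mult_single single_add ac_simps)
        also have "\<dots> - f = (\<Sum>l\<in>UNIV. (single \<nu> a * b l) * ?G l)"
          unfolding b_eq f_def by (simp add: sum_distrib_left distrib_left sum.distrib mult.assoc)
        finally show ?thesis by (simp only: ideal_genI)
      qed
      ultimately show ?thesis by blast
    qed
    have "\<forall>\<gamma>\<in>keys (g i). \<exists>f. f \<in> graded_piece (M + 2 * c)
        \<and> (\<forall>\<mu>. lookup f \<mu> \<noteq> 0 \<longrightarrow> mixed \<mu>)
        \<and> ?X * single \<gamma> (lookup (g i) \<gamma>) - f \<in> ideal_gen ?G"
    proof
      fix \<gamma> assume "\<gamma> \<in> keys (g i)"
      then have nz: "lookup (g i) \<gamma> \<noteq> 0" by (simp add: in_keys_iff)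
      have "lookup \<gamma> i + 2 \<le> e" using g2 nz by blast
      moreover have "total_degree \<gamma> = e" using spec[OF g] nz by (rule graded_pieceD)
      ultimately show "\<exists>f. f \<in> graded_piece (M + 2 * c) \<and> (\<forall>\<mu>. lookup f \<mu> \<noteq> 0 \<longrightarrow> mixed \<mu>)
        \<and> ?X * single \<gamma> (lookup (g i) \<gamma>) - f \<in> ideal_gen ?G"
        by (rule ex)
    qed
    from bchoice[OF this] obtain F where F: "\<forall>\<gamma>\<in>keys (g i). F \<gamma> \<in> graded_piece (M + 2 * c)
        \<and> (\<forall>\<mu>. lookup (F \<gamma>) \<mu> \<noteq> 0 \<longrightarrow> mixed \<mu>)
        \<and> ?X * single \<gamma> (lookup (g i) \<gamma>) - F \<gamma> \<in> ideal_gen ?G"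
      by blast
    define f where "f = - (\<Sum>\<gamma>\<in>keys (g i). F \<gamma>)"
    have "f \<in> graded_piece (M + 2 * c)"
      unfolding f_def using F by (intro graded_uminus graded_sum) auto
    moreover have "\<forall>\<mu>. lookup f \<mu> \<noteq> 0 \<longrightarrow> mixed \<mu>"
    proof (intro allI impI)
      fix \<mu> assume "lookup f \<mu> \<noteq> 0"
      then have "(\<Sum>\<gamma>\<in>keys (g i). lookup (F \<gamma>) \<mu>) \<noteq> 0"
        by (simp add: f_def lookup_sum)
      then obtain \<gamma> where "\<gamma> \<in> keys (g i)" "lookup (F \<gamma>) \<mu> \<noteq> 0"
        by (rule sum.not_neutral_contains_not_neutral)
      then show "mixed \<mu>" using F by blast
    qed
    ultimately obtain r where r: "r \<in> order_ge (Suc (M + 2 * c))" "f - r \<in> ideal_gen ?G"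
      using mixed by blast
    have Xg: "?X * g i = (\<Sum>\<gamma>\<in>keys (g i). ?X * single \<gamma> (lookup (g i) \<gamma>))"
      by (subst (1) poly_mapping_sum_single[of "g i"]) (simp only: sum_distrib_left)
    have "single \<mu> 1 = ?X * Var i ^ M"
      unfolding i Var_power by (simp add: mult_single add.commute flip: single_add)
    also have "\<dots> - r = ?X * ?G i - (\<Sum>\<gamma>\<in>keys (g i).
        ?X * single \<gamma> (lookup (g i) \<gamma>) - F \<gamma>) + (f - r)"
      unfolding sum_subtractf Xg[symmetric] f_def by (simp add: algebra_simps)
    also have "\<dots> \<in> ideal_gen ?G"
    proof -
      have 1: "?X * ?G i \<in> ideal_gen ?G" by (rule ideal_gen_mult[OF ideal_gen_base[of ?G i]])
      have 2: "(\<Sum>\<gamma>\<in>keys (g i). ?X * single \<gamma> (lookup (g i) \<gamma>) - F \<gamma>)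
          \<in> ideal_gen ?G"
        by (rule ideal_gen_sum) (use F in blast)
      show ?thesis by (rule ideal_gen_add[OF ideal_gen_diff[OF 1 2] r(2)])
    qed
    finally show ?thesis using r(1) by blast
  qed
  then show ?thesis using that by blast
qed

text \<open>
  By the previous lemma the ideal of the perturbed family absorbs a fixed power of the maximal ideal
  of the origin, locally at the origin; the multiplier \<open>e0\<close>, which is invertible there, removes the
  other zeros of the family.
\<close>

lemma localising_multiplier:
  fixes g :: "'n::finite \<Rightarrow> ('n, 'k::field) mpoly"
  assumes g: "\<forall>i. g i \<in> graded_piece e"
    and g2: "\<forall>i \<mu>. lookup (g i) \<mu> \<noteq> 0 \<longrightarrow> lookup \<mu> i + 2 \<le> e"
    and c: "\<forall>\<mu>. mixed \<mu> \<longrightarrow> c \<le> total_degree \<mu> \<longrightarrow> single \<mu> 1 \<in> ideal_gen g"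
    and c1: "c \<ge> 1" and M: "e < M"
  obtains e0 where "lookup e0 0 = 1"
    "\<And>f. f \<in> order_ge (M + 2 * c) \<Longrightarrow> e0 * f \<in> ideal_gen (\<lambda>i. Var i ^ M + g i)"
proof -
  let ?G = "\<lambda>i. Var i ^ M + g i" and ?K = "M + 2 * c"
  let ?N = "{\<nu> :: 'n \<Rightarrow>\<^sub>0 nat. total_degree \<nu> = ?K}"
  have fin: "finite ?N" by (rule finite_subset[OF _ finite_total_degree_le[of ?K]]) auto
  have red: "\<exists>a :: _ \<Rightarrow> ('n, 'k) mpoly. (\<forall>\<nu>'. lookup (a \<nu>') 0 = 0)
      \<and> single \<nu> 1 - (\<Sum>\<nu>'\<in>?N. a \<nu>' * single \<nu>' 1) \<in> ideal_gen ?G"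
    if N: "\<nu> \<in> ?N" for \<nu>
  proof -
    obtain r where r: "r \<in> order_ge (?K + 1)" "single \<nu> 1 - r \<in> ideal_gen ?G"
      using monomial_reduces[OF g g2 c c1 M, of \<nu>] N by auto
    obtain b :: "_ \<Rightarrow> ('n, 'k) mpoly" where b: "\<And>\<nu>. b \<nu> \<in> order_ge 1" "r = (\<Sum>\<nu>\<in>?N. b \<nu> * single \<nu> 1)"
      using order_ge_decompose[OF r(1)] by blast
    have "lookup (b \<nu>') 0 = 0" for \<nu>' using b(1)[of \<nu>'] by (force simp: order_ge_def)
    then show ?thesis using r(2) b(2) by blast
  qed
  have "\<exists>e0 :: ('n, 'k) mpoly. lookup e0 0 = 1
      \<and> (\<forall>\<nu>\<in>?N. e0 * single \<nu> 1 \<in> ideal_gen ?G)"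
    by (rule nakayama[OF ring_map_constant_term is_ideal_ideal_gen fin]) (intro ballI red)
  then obtain e0 :: "('n, 'k) mpoly" where e0: "lookup e0 0 = 1"
    "\<And>\<nu>. \<nu> \<in> ?N \<Longrightarrow> e0 * single \<nu> 1 \<in> ideal_gen ?G"
    by blast
  have "e0 * f \<in> ideal_gen ?G" if f: "f \<in> order_ge ?K" for f
  proof -
    have "f \<in> order_ge (?K + 0)" using f by simp
    from order_ge_decompose[OF this] obtain b :: "_ \<Rightarrow> ('n, 'k) mpoly"
      where "f = (\<Sum>\<nu>\<in>?N. b \<nu> * single \<nu> 1)" by blast
    then have "e0 * f = (\<Sum>\<nu>\<in>?N. b \<nu> * (e0 * single \<nu> 1))"
      by (simp add: sum_distrib_left ac_simps)
    also have "\<dots> \<in> ideal_gen ?G" by (intro ideal_gen_sum ideal_gen_mult e0(2))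
    finally show ?thesis .
  qed
  then show ?thesis using that e0(1) by blast
qed

lemma residue_x_times_ideal:
  fixes g :: "'n::finite \<Rightarrow> ('n, 'k::field) mpoly"
  assumes g: "\<forall>i. g i \<in> graded_piece e" "e < M" and x: "x \<in> ideal_gen (\<lambda>i. Var i ^ M + g i)"
  shows "residue_x M g (s * in_x x) = 0"
proof -
  obtain b where b: "x = (\<Sum>i\<in>UNIV. b i * (Var i ^ M + g i))" using x by (auto simp: ideal_gen_def)
  have "s * in_x x = (\<Sum>i\<in>UNIV. (s * in_x (b i)) * in_x (Var i ^ M + g i))"
    unfolding b in_x_simps(8) sum_distrib_left in_x_simps(4) by (simp only: mult.assoc)
  then show ?thesis by (simp only: residue_x_sum residue_x_multiple[OF g]) simp
qed

text \<open>
  The Bezoutian of the perturbed family is a reproducing kernel for the residue: multiplication by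
  \<open>v(x)\<close> and by \<open>v(y)\<close> agree on it modulo the family, and its own residue is \<open>1\<close>.
\<close>

lemma residue_reproducing:
  fixes g :: "'n::finite \<Rightarrow> ('n, 'k::field) mpoly" and A :: "('n, 'k) bipoly ^ 'n ^ 'n"
  assumes g: "\<forall>i. g i \<in> graded_piece e" "e < M"
    and A: "\<And>i. in_x (Var i ^ M + g i) - Const (Var i ^ M + g i) = (\<Sum>j\<in>UNIV. A $ i $ j * diagonal_var j)"
    and one: "residue_x M g (det A) = 1"
  shows "v - residue_x M g (in_x v * det A) \<in> ideal_gen (\<lambda>i. Var i ^ M + g i)"
proof -
  let ?G = "\<lambda>i. Var i ^ M + g i"
  obtain r where r: "in_x v - Const v = (\<Sum>j\<in>UNIV. r j * diagonal_var j)"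
    using in_x_minus_Const_ideal[of v] by (auto simp: ideal_gen_def)
  have "(in_x v - Const v) * det A = (\<Sum>j\<in>UNIV. r j * (det A * diagonal_var j))"
    unfolding r sum_distrib_right by (simp only: ac_simps)
  also have "\<dots> \<in> ideal_gen (\<lambda>i. in_x (?G i) - Const (?G i))"
    by (intro ideal_gen_sum ideal_gen_mult cramer_ideal[OF A])
  finally obtain s where s: "(in_x v - Const v) * det A = (\<Sum>i\<in>UNIV. s i * (in_x (?G i) - Const (?G i)))"
    by (auto simp: ideal_gen_def)
  have t: "residue_x M g (s i * (in_x (?G i) - Const (?G i))) = - residue_x M g (s i) * ?G i" for i
  proof -
    have "s i * (in_x (?G i) - Const (?G i)) = s i * in_x (?G i) - Const (?G i) * s i"
      by (simp only: right_diff_distrib mult.commute[of "s i" "Const _"])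
    then show ?thesis by (simp only: residue_x_diff residue_x_multiple[OF g] residue_x_Const_mult) simp
  qed
  have "residue_x M g (in_x v * det A) - v = residue_x M g ((in_x v - Const v) * det A)"
    by (simp only: left_diff_distrib residue_x_diff residue_x_Const_mult one mult_1_right)
  also have "\<dots> = (\<Sum>i\<in>UNIV. - residue_x M g (s i) * ?G i)"
    unfolding s residue_x_sum t ..
  also have "\<dots> \<in> ideal_gen ?G" by (rule ideal_genI)
  finally show ?thesis using ideal_gen_uminus by fastforce
qed

text \<open>
  Below degree \<open>M\<close> the perturbation \<open>x\<^sub>i\<^sup>M\<close> is invisible.
\<close>

lemma hom_part_perturbed_ideal:
  fixes g :: "'n::finite \<Rightarrow> ('n, 'k::field) mpoly"
  assumes g: "\<forall>i. g i \<in> graded_piece e" and m: "m < M" and x: "x \<in> ideal_gen (\<lambda>i. Var i ^ M + g i)"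
  shows "hom_part m x \<in> ideal_gen g"
proof -
  obtain a where a: "x = (\<Sum>i\<in>UNIV. a i * (Var i ^ M + g i))" using x by (auto simp: ideal_gen_def)
  have "(Var i :: ('n, 'k) mpoly) ^ M \<in> order_ge M" for i
    unfolding Var_power by (intro order_ge_graded[OF graded_single]) auto
  then have "hom_part m (a i * Var i ^ M) = 0" for i
    by (intro hom_part_order_ge[OF order_ge_mult_left m])
  then have "hom_part m x = (\<Sum>i\<in>UNIV. hom_part m (a i * g i))"
    unfolding a hom_part_sum by (simp add: distrib_left hom_part_add)
  also have "\<dots> \<in> ideal_gen g"
    by (intro ideal_gen_sum hom_part_in_ideal_gen[OF g] ideal_gen_mult ideal_gen_base)
  finally show ?thesis .
qed

text \<open>
  The heart of the proof. Let \<open>v = e0 u\<close> with the localising multiplier \<open>e0\<close>, so that \<open>u\<close> is the part of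
  \<open>v\<close> of degree \<open>m\<close>. Modulo the perturbed family, \<open>v\<close> is the residue in \<open>x\<close> of \<open>v(x)\<close> times the Bezoutian.
  The Bezoutian is the determinant of divided differences of \<open>x\<^sub>i\<^sup>M + g\<^sub>i\<close>; the contributions of \<open>x\<^sub>i\<^sup>M\<close> either
  have large degree in \<open>y\<close> or a large power of \<open>x\<^sub>i\<close>, which \<open>v\<close> absorbs. What is left in degree \<open>m\<close> comes from
  the Bezoutian of the \<open>g\<^sub>i\<close> alone, which is a form of degree \<open>m + 1\<close> in \<open>x\<close> and \<open>y\<close>: only its terms linear in
  \<open>x\<close> count, and their coefficients lie in the ideal of the \<open>g\<^sub>i\<close>.
\<close>

theorem mixed_forms_below_socle_degree:
  fixes g :: "'n::finite \<Rightarrow> ('n, 'k::field) mpoly"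
  assumes g: "\<forall>i. g i \<in> graded_piece e"
    and g2: "\<forall>i \<mu>. lookup (g i) \<mu> \<noteq> 0 \<longrightarrow> lookup \<mu> i + 2 \<le> e"
    and gm: "\<forall>i \<mu>. lookup (g i) \<mu> \<noteq> 0 \<longrightarrow> mixed \<mu>"
    and c0: "\<forall>\<mu>. mixed \<mu> \<longrightarrow> c0 \<le> total_degree \<mu> \<longrightarrow> single \<mu> 1 \<in> ideal_gen g"
    and u: "u \<in> graded_piece m" "\<forall>\<mu>. lookup u \<mu> \<noteq> 0 \<longrightarrow> mixed \<mu>"
    and m: "Suc m = CARD('n) * (e - 1)"
  shows "u \<in> ideal_gen g"
proof -
  define c where "c = Suc c0"
  have c: "\<forall>\<mu>. mixed \<mu> \<longrightarrow> c \<le> total_degree \<mu> \<longrightarrow> single \<mu> 1 \<in> ideal_gen g" and c1: "c \<ge> 1"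
    using c0 by (auto simp: c_def)
  \<comment> \<open>Large enough that \<open>x\<^sub>i\<^sup>M\<close> does not meet degree \<open>m\<close>, and that \<open>M' - p > m\<close> for all \<open>p < 3 c\<close>.\<close>
  define M' where "M' = m + 3 * c + e + 1"
  define M where "M = Suc M'"
  have eM: "e < M" by (simp add: M_def M'_def)
  have "e - 1 \<noteq> 0" using m by (metis mult_0_right nat.distinct(1))
  then have e1: "e \<ge> 2" by simp
  let ?G = "\<lambda>i. Var i ^ M + g i"
  note gM = g eM
  obtain e0 where e0: "lookup e0 0 = 1" "\<And>f. f \<in> order_ge (M + 2 * c) \<Longrightarrow> e0 * f \<in> ideal_gen ?G"
    using localising_multiplier[OF g g2 c c1 eM] by blast
  define v where "v = e0 * u"
  \<comment> \<open>The mixed form \<open>u x\<^sub>i\<^sup>c\<close> reduces to order \<open>M + (m + c - e)\<close>. Another factor \<open>x\<^sub>i\<^sup>2\<^sup>c\<close> raises this to the order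
    \<open>M + 2 c\<close> that \<open>e0\<close> moves into the ideal.\<close>
  have vX: "v * Var i ^ p \<in> ideal_gen ?G" if p: "3 * c \<le> p" for i p
  proof -
    let ?f = "u * Var i ^ c"
    have "?f \<in> graded_piece (m + c)"
      unfolding Var_power by (intro graded_mult u graded_single) simp
    moreover have "\<forall>\<mu>. lookup ?f \<mu> \<noteq> 0 \<longrightarrow> mixed \<mu>"
    proof clarify
      fix \<mu> assume "lookup ?f \<mu> \<noteq> 0"
      then obtain x y where "\<mu> = x + y" "x \<in> keys u"
        using keys_mult[of u "Var i ^ c"] by (auto simp: in_keys_iff)
      then show "mixed \<mu>" using mixed_add u(2) by (auto simp: in_keys_iff)
    qed
    ultimately obtain r where r: "r \<in> order_ge (M + (m + c - e))" "?f - r \<in> ideal_gen ?G"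
      using mixed_form_reduces[OF g c, of ?f "m + c" M] by auto
    have "r * Var i ^ (p - c) \<in> order_ge (M + (m + c - e) + (p - c))"
      unfolding Var_power by (intro order_ge_mult r order_ge_graded[OF graded_single]) auto
    then have "r * Var i ^ (p - c) \<in> order_ge (M + 2 * c)"
      by (rule order_ge_mono) (use p in linarith)
    then have "e0 * (r * Var i ^ (p - c)) \<in> ideal_gen ?G" by (rule e0(2))
    moreover have "(e0 * Var i ^ (p - c)) * (?f - r) \<in> ideal_gen ?G" by (intro ideal_gen_mult r)
    ultimately have "(e0 * Var i ^ (p - c)) * (?f - r) + e0 * (r * Var i ^ (p - c)) \<in> ideal_gen ?G"
      by (intro ideal_gen_add)
    moreover have "(e0 * Var i ^ (p - c)) * (?f - r) + e0 * (r * Var i ^ (p - c)) = v * (Var i ^ c * Var i ^ (p - c))"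
      by (simp only: v_def algebra_simps)
    moreover have "(Var i :: ('n, 'k) mpoly) ^ c * Var i ^ (p - c) = Var i ^ p"
      using p by (simp flip: power_add)
    ultimately show ?thesis by simp
  qed
  obtain h where h: "\<And>i. in_x (g i) - Const (g i) = (\<Sum>j\<in>UNIV. h i j * diagonal_var j)"
    "\<And>i j. h i j \<in> weighted 1 {m. Suc m = e}"
  proof -
    have "\<exists>h. in_x (g i) - Const (g i) = (\<Sum>j\<in>UNIV. h j * diagonal_var j)
        \<and> (\<forall>j. h j \<in> weighted 1 {m. Suc m = e})" for i
    proof -
      have gi: "g i \<in> graded_piece e" using g by blast
      obtain h where "in_x (g i) - Const (g i) = (\<Sum>j\<in>UNIV. h j * diagonal_var j)"
        "\<And>j. h j \<in> weighted 1 {m. Suc m = e}" using divided_differences[OF gi] by blast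
      then show ?thesis by blast
    qed
    then have "\<forall>i. \<exists>h. in_x (g i) - Const (g i) = (\<Sum>j\<in>UNIV. h j * diagonal_var j)
        \<and> (\<forall>j. h j \<in> weighted 1 {m. Suc m = e})" by blast
    from choice[OF this] show ?thesis using that by blast
  qed
  \<comment> \<open>The divided difference of \<open>x\<^sub>i\<^sup>M\<close>. So \<open>det H\<close> is the Bezoutian of the perturbed family and \<open>det H0\<close> the one of the
    \<open>g\<^sub>i\<close>.\<close>
  define D :: "'n \<Rightarrow> ('n, 'k) bipoly" where "D i = (\<Sum>p<Suc M'. Var i ^ p * Const (Var i) ^ (M' - p))" for i
  define H where "H = (\<chi> i j. (if i = j then D i else 0) + h i j)"
  define H0 where "H0 = (\<chi> i j. h i j)"
  have Dt: "(Var i :: ('n, 'k) bipoly) ^ p * Const (Var i) ^ q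
      = single (single i p) (single (single i q) 1)" for i p q
    unfolding Const_simps(7)[symmetric] Var_power by (simp add: mult_single)
  have HG: "in_x (?G i) - Const (?G i) = (\<Sum>j\<in>UNIV. H $ i $ j * diagonal_var j)" for i
  proof -
    have "(\<Sum>j\<in>UNIV. H $ i $ j * diagonal_var j)
        = (\<Sum>j\<in>UNIV. if i = j then D i * diagonal_var i else 0) + (\<Sum>j\<in>UNIV. h i j * diagonal_var j)"
      unfolding sum.distrib[symmetric] by (intro sum.cong) (auto simp: H_def distrib_right)
    also have "\<dots> = diagonal_var i * D i + (in_x (g i) - Const (g i))"
      unfolding h(1)[symmetric] by (simp add: mult.commute)
    also have "diagonal_var i * D i = Var i ^ M - Const (Var i) ^ M"
      unfolding D_def M_def diff_power_eq_sum ..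
    finally show ?thesis
      by (simp only: in_x_simps(3,7) in_x_Var Const_simps(3,7)) simp
  qed
  have H0g: "in_x (g i) - Const (g i) = (\<Sum>j\<in>UNIV. H0 $ i $ j * diagonal_var j)" for i
    by (simp add: H0_def h(1))
  have detH0: "det H0 \<in> weighted 1 {Suc m}"
    unfolding m
  proof (rule det_weighted)
    fix i j
    have "h i j \<in> weighted 1 {e - 1}" by (rule weighted_mono[OF h(2)]) auto
    then show "H0 $ i $ j \<in> weighted 1 {e - 1}" by (simp add: H0_def)
  qed
  \<comment> \<open>The residue vanishes on \<open>x\<close>-degrees below \<open>n (M - 1)\<close>. The only term of \<open>det H\<close> of this \<open>x\<close>-degree is
    the monomial \<open>\<Prod>x\<^sub>i\<^sup>M\<^sup>-\<^sup>1\<close> with residue \<open>1\<close>.\<close>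
  have one: "residue_x M g (det H) = 1"
  proof -
    have "D i \<in> weighted 1 {M'}" for i
      unfolding D_def Dt by (intro weighted_sum weighted_single2) auto
    moreover have "h i j \<in> weighted 1 {..<M'}" for i j
      by (rule weighted_mono[OF h(2)]) (auto simp: M'_def)
    ultimately have 1: "det H - prod D UNIV \<in> weighted 1 {..<CARD('n) * M'}"
      unfolding H_def by (intro det_diagonal_perturbed)
    have split: "D i = Var i ^ M' + (\<Sum>p<M'. Var i ^ p * Const (Var i) ^ (M' - p))" for i
      by (simp add: D_def)
    have "(\<Prod>i\<in>UNIV. (Var i :: ('n, 'k) bipoly) ^ M' + (\<Sum>p<M'. Var i ^ p * Const (Var i) ^ (M' - p))) - (\<Prod>i\<in>UNIV. Var i ^ M')
        \<in> weighted 0 {..<CARD('n) * M'}"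
    proof (rule weighted_prod_perturbed)
      show "(Var i :: ('n, 'k) bipoly) ^ M' \<in> weighted 0 {M'}" for i
        using Dt[of i M' 0] weighted_single2[of "single i M'" 0 0 "{M'}" "1 :: 'k"] by simp
      show "(\<Sum>p<M'. (Var i :: ('n, 'k) bipoly) ^ p * Const (Var i) ^ (M' - p)) \<in> weighted 0 {..<M'}" for i
        unfolding Dt by (intro weighted_sum weighted_single2) auto
    qed simp
    then have 2: "prod D UNIV - (\<Prod>i\<in>UNIV. Var i ^ M') \<in> weighted 0 {..<CARD('n) * M'}"
      unfolding split .
    have "(\<Prod>i\<in>UNIV. (Var i :: ('n, 'k) bipoly) ^ M') = single (top_exponent M 0) 1"
      using single_eq_Const_mult_Vars[of "top_exponent M (0 :: 'n \<Rightarrow>\<^sub>0 nat)" "1 :: ('n, 'k) mpoly"]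
      by (simp add: M_def)
    then have "det H = single (top_exponent M 0) 1 + (prod D UNIV - (\<Prod>i\<in>UNIV. Var i ^ M'))
        + (det H - prod D UNIV)" by simp
    moreover have "residue_x M g (prod D UNIV - (\<Prod>i\<in>UNIV. Var i ^ M')) = 0"
      by (rule residue_x_low_weight[OF gM, of _ 0]) (use 2 in \<open>simp add: M_def\<close>)
    moreover have "residue_x M g (det H - prod D UNIV) = 0"
      by (rule residue_x_low_weight[OF gM, of _ 1]) (use 1 in \<open>simp add: M_def\<close>)
    moreover have "residue_x M g (single (top_exponent M 0) 1) = 1"
      by (simp add: residue_x_single residue_top[OF gM])
    ultimately show ?thesis by (metis add.right_neutral residue_x_add)
  qed
  have main: "v - residue_x M g (in_x v * det H) \<in> ideal_gen ?G"
    by (rule residue_reproducing[OF gM HG one])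
  \<comment> \<open>The difference lies in the ideal of the \<open>D i\<close>, sums of products \<open>x\<^sub>i\<^sup>p y\<^sub>i\<^sup>q\<close> with \<open>p + q = M'\<close>. If \<open>p \<ge> 3 c\<close>, then \<open>v x\<^sub>i\<^sup>p\<close>
    has no residue; otherwise \<open>q > m\<close>.\<close>
  have high: "residue_x M g (in_x v * (det H - det H0)) \<in> order_ge (Suc m)"
  proof -
    obtain s where s: "det H - det H0 = (\<Sum>i\<in>UNIV. s i * D i)"
      using det_diagonal_perturbed_ideal[of D h] unfolding H_def H0_def ideal_gen_def by blast
    have "residue_x M g (in_x v * (s i * (Var i ^ p * Const (Var i) ^ (M' - p)))) \<in> order_ge (Suc m)"
      if p: "p \<le> M'" for i p
    proof -
      have "in_x v * (s i * (Var i ^ p * Const (Var i) ^ (M' - p)))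
          = Const (Var i ^ (M' - p)) * (s i * in_x (v * Var i ^ p))"
        unfolding in_x_simps(4,7) in_x_Var Const_simps(7) by (simp only: ac_simps)
      then have eq: "residue_x M g (in_x v * (s i * (Var i ^ p * Const (Var i) ^ (M' - p))))
          = Var i ^ (M' - p) * residue_x M g (s i * in_x (v * Var i ^ p))"
        by (simp only: residue_x_Const_mult)
      show ?thesis
      proof (cases "3 * c \<le> p")
        case True
        then show ?thesis unfolding eq residue_x_times_ideal[OF gM vX[OF True]] by simp
      next
        case False
        then have "Var i ^ (M' - p) \<in> (order_ge (Suc m) :: ('n, 'k) mpoly set)"
          unfolding Var_power by (intro order_ge_graded[OF graded_single[OF refl]]) (simp add: M'_def)
        then show ?thesis unfolding eq using order_ge_mult_left by (metis mult.commute)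
      qed
    qed
    then show ?thesis
      unfolding s D_def sum_distrib_left residue_x_sum by (intro order_ge_sum) simp
  qed
  \<comment> \<open>Since \<open>det H0\<close> is homogeneous of degree \<open>m + 1\<close>, the coefficients of \<open>y\<close>-degree \<open>m\<close> are those of the variables
    \<open>x\<^sub>i\<close>.\<close>
  have low: "hom_part m (residue_x M g (in_x v * det H0)) \<in> ideal_gen g"
  proof -
    let ?L = "lookup (det H0)"
    have summand: "hom_part m (residue_x M g (in_x v * single \<nu> (?L \<nu>))) \<in> ideal_gen g" for \<nu>
    proof -
      have "in_x v * single \<nu> (?L \<nu>) = in_x (v * single \<nu> 1) * Const (?L \<nu>)"
        unfolding single_bipoly[of \<nu> "?L \<nu>"] by (simp only: in_x_simps(4) ac_simps)
      then have "residue_x M g (in_x v * single \<nu> (?L \<nu>))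
          = Const (residue M g (v * single \<nu> 1)) * ?L \<nu>"
        by (simp only: residue_x_in_x[OF gM])
      then have eq: "hom_part m (residue_x M g (in_x v * single \<nu> (?L \<nu>)))
          = hom_part m (?L \<nu>) * Const (residue M g (v * single \<nu> 1))"
        by (simp add: mult.commute[of "Const _"] hom_part_mult[OF graded_Const])
      have "hom_part m (?L \<nu>) \<in> ideal_gen g"
      proof (cases "total_degree \<nu> = Suc 0")
        case True
        then obtain i where "\<nu> = single i (Suc 0)" by (rule total_degree_eq_1)
        then show ?thesis
          using bezoutian_linear_coefficient[OF g gm H0g detH0] hom_part_in_ideal_gen[OF g] by blast
      next
        case False
        then have "hom_part m (?L \<nu>) = 0"
          using weighted_lookup_graded[OF detH0, of \<nu>] hom_part_other[of "?L \<nu>" "Suc m - total_degree \<nu>" m]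
          by (cases "?L \<nu> = 0") auto
        then show ?thesis by simp
      qed
      then show ?thesis unfolding eq by (rule ideal_gen_mult_right)
    qed
    have "in_x v * det H0 = (\<Sum>\<nu>\<in>keys (det H0). in_x v * single \<nu> (?L \<nu>))"
      by (subst (1) poly_mapping_sum_single[of "det H0"]) (simp only: sum_distrib_left)
    then show ?thesis
      by (simp only: residue_x_sum hom_part_sum) (intro ideal_gen_sum summand)
  qed
  have "hom_part m (v - residue_x M g (in_x v * det H)) \<in> ideal_gen g"
    by (rule hom_part_perturbed_ideal[OF g _ main]) (simp add: M_def M'_def)
  moreover have "residue_x M g (in_x v * det H)
      = residue_x M g (in_x v * det H0) + residue_x M g (in_x v * (det H - det H0))"
    unfolding residue_x_add[symmetric] by (simp add: right_diff_distrib)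
  moreover have "hom_part m (residue_x M g (in_x v * (det H - det H0))) = 0"
    by (rule hom_part_order_ge[OF high]) simp
  ultimately have "hom_part m v - hom_part m (residue_x M g (in_x v * det H0)) \<in> ideal_gen g"
    by (simp add: hom_part_diff hom_part_add)
  then have "hom_part m v \<in> ideal_gen g" using low ideal_gen_cong by blast
  moreover have "hom_part m v = u"
  proof -
    have "hom_part 0 e0 = 1"
      using e0(1) by (intro poly_mapping_eqI) (auto simp: lookup_hom_part lookup_one)
    then show ?thesis by (simp add: v_def hom_part_mult[OF u(1)])
  qed
  ultimately show ?thesis by simp
qed

section \<open>Partial derivatives and linear substitutions\<close>

lemma mpoly_ring_induct [case_names Const Var add mult]:
  fixes f :: "('n::finite \<Rightarrow>\<^sub>0 nat) \<Rightarrow>\<^sub>0 'r::comm_ring_1"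
  assumes C: "\<And>c. P (Const c)" and V: "\<And>i. P (Var i)" and add: "\<And>f g. P f \<Longrightarrow> P g \<Longrightarrow> P (f + g)"
    and mult: "\<And>f g. P f \<Longrightarrow> P g \<Longrightarrow> P (f * g)"
  shows "P f"
proof (induction f rule: poly_mapping_induct_single)
  case zero
  then show ?case using C[of 0] by simp
next
  case (single \<mu> c)
  have 1: "P 1" using C[of 1] by simp
  have pow: "P (Var i ^ a)" for i a by (induction a) (auto simp: 1 V mult)
  have "P (\<Prod>i\<in>S. Var i ^ lookup \<mu> i)" if "finite S" for S
    using that by (induction S rule: finite_induct) (auto simp: 1 pow mult)
  then show ?case unfolding single_eq_Const_mult_Vars[of \<mu> c] by (intro mult C) simp
qed (rule add)

lemma partial_superset:
  assumes "finite A" "keys f \<subseteq> A"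
  shows "partial i f = (\<Sum>\<mu>\<in>A. single (\<mu> - single i (Suc 0))
     (of_nat (lookup \<mu> i) * lookup f \<mu>))"
  unfolding partial_def One_nat_def using assms
  by (intro sum.mono_neutral_left) (auto simp: not_in_keys_iff_lookup_eq_zero)

lemma partial_single: "partial i (single \<mu> c)
    = single (\<mu> - single i (Suc 0)) (of_nat (lookup \<mu> i) * c)"
  by (subst partial_superset[of "{\<mu>}"]) auto

lemma partial_0 [simp]: "partial i 0 = 0"
  by (simp add: partial_def)

lemma partial_add: "partial i (f + g) = partial i f + partial i g"
proof -
  let ?A = "keys f \<union> keys g"
  have "keys (f + g) \<subseteq> ?A" by (rule keys_add)
  then show ?thesis
    by (simp add: partial_superset[of ?A] lookup_add distrib_left single_add sum.distrib)
qed

lemma partial_sum: "partial i (sum f A) = (\<Sum>a\<in>A. partial i (f a))"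
  by (induction A rule: infinite_finite_induct) (auto simp: partial_add)

lemma partial_mult: "partial i (f * g) = partial i f * g + f * partial i g"
proof (induction f rule: poly_mapping_induct_single)
  case (single \<mu> a)
  have shift: "lookup \<mu> i \<noteq> 0 \<Longrightarrow> \<mu> + \<nu> - single i (Suc 0) = (\<mu> - single i (Suc 0)) + \<nu>"
    for \<mu> \<nu> :: "'a \<Rightarrow>\<^sub>0 nat"
  proof (rule poly_mapping_eqI)
    fix k assume "lookup \<mu> i \<noteq> 0"
    then show "lookup (\<mu> + \<nu> - single i (Suc 0)) k
        = lookup ((\<mu> - single i (Suc 0)) + \<nu>) k"
      by (cases "k = i") (auto simp: lookup_add lookup_minus lookup_single)
  qed
  show ?case
  proof (induction g rule: poly_mapping_induct_single)
    case (single \<nu> b)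
    have 1: "single (\<mu> + \<nu> - single i (Suc 0)) (of_nat (lookup \<mu> i) * (a * b))
        = partial i (single \<mu> a) * single \<nu> b"
      by (cases "lookup \<mu> i = 0") (auto simp: partial_single mult_single shift mult.assoc)
    have 2: "single (\<mu> + \<nu> - single i (Suc 0)) (of_nat (lookup \<nu> i) * (a * b))
        = single \<mu> a * partial i (single \<nu> b)"
      using shift[of \<nu> \<mu>] by (cases "lookup \<nu> i = 0") (auto simp: partial_single mult_single ac_simps)
    show ?case
      unfolding 1[symmetric] 2[symmetric]
      by (simp add: mult_single partial_single[of i "\<mu> + \<nu>"] lookup_add distrib_right flip: single_add)
  qed (auto simp: partial_add distrib_left)
qed (auto simp: partial_add distrib_right)

lemma partial_Const [simp]: "partial i (Const c) = 0"
  by (simp add: partial_single)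

lemma partial_one [simp]: "partial i 1 = 0"
  using partial_Const[of i 1] by (simp del: partial_Const)

lemma partial_Var: "partial i (Var j) = (if i = j then 1 else 0)"
  by (auto simp: partial_single lookup_single)

lemma partial_uminus: "partial i (- f) = - partial i f"
  using partial_add[of i f "- f"] by (simp add: eq_neg_iff_add_eq_0 add.commute)

lemma partial_diff: "partial i (f - g) = partial i f - partial i g"
  using partial_add[of i f "- g"] by (simp add: partial_uminus)

lemma lookup_partial:
  "lookup (partial i f) \<mu>
    = of_nat (Suc (lookup \<mu> i)) * lookup f (\<mu> + single i (Suc 0))"
proof (induction f rule: poly_mapping_induct_single)
  case (single \<nu> c)
  show ?case
  proof (cases "\<nu> = \<mu> + single i (Suc 0)")
    case True
    then show ?thesis by (simp add: partial_single lookup_add)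
  next
    case False
    have "\<nu> - single i (Suc 0) \<noteq> \<mu>" if "lookup \<nu> i \<noteq> 0"
    proof
      assume e: "\<nu> - single i (Suc 0) = \<mu>"
      have "\<nu> = \<mu> + single i (Suc 0)"
      proof (rule poly_mapping_eqI)
        show "lookup \<nu> k = lookup (\<mu> + single i (Suc 0)) k" for k
          using that by (cases "k = i") (auto simp: lookup_add lookup_minus lookup_single simp flip: e)
      qed
      then show False using False by simp
    qed
    then show ?thesis
      using False by (cases "lookup \<nu> i = 0") (auto simp: partial_single lookup_single when_def)
  qed
qed (auto simp: partial_add lookup_add distrib_left)

lemma partial_commute: "partial i (partial j f) = partial j (partial i f)"
  by (cases "i = j") (auto intro!: poly_mapping_eqI simp: lookup_partial lookup_add lookup_single ac_simps)

lemma graded_partial: "f \<in> graded_piece d \<Longrightarrow> partial i f \<in> graded_piece (d - 1)"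
  by (auto intro!: graded_pieceI simp: lookup_partial dest!: graded_pieceD)

lemma euler_identity:
  fixes f :: "('n::finite, 'k::field) mpoly"
  assumes "f \<in> graded_piece d"
  shows "(\<Sum>i\<in>UNIV. Var i * partial i f) = Const (of_nat d) * f"
proof -
  have s: "Var i * partial i (single \<mu> c) = single \<mu> (of_nat (lookup \<mu> i) * c)"
    for i and \<mu> :: "'n \<Rightarrow>\<^sub>0 nat" and c :: 'k
  proof (cases "lookup \<mu> i = 0")
    case False
    have "single i (Suc 0) + (\<mu> - single i (Suc 0)) = \<mu>"
    proof (rule poly_mapping_eqI)
      show "lookup (single i (Suc 0) + (\<mu> - single i (Suc 0))) k = lookup \<mu> k" for k
        using False by (cases "k = i") (auto simp: lookup_add lookup_minus lookup_single)
    qed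
    then show ?thesis by (simp add: partial_single mult_single)
  qed (simp add: partial_single)
  have ss: "(\<Sum>i\<in>UNIV. single \<mu> (h i)) = single \<mu> (sum h UNIV)"
    for h :: "'n \<Rightarrow> 'k" and \<mu> :: "'n \<Rightarrow>\<^sub>0 nat"
    by (intro poly_mapping_eqI) (auto simp: lookup_sum lookup_single when_def)
  have t: "(\<Sum>i\<in>UNIV. Var i * partial i (single \<mu> c)) = Const (of_nat (total_degree \<mu>)) * single \<mu> c"
    for \<mu> :: "'n \<Rightarrow>\<^sub>0 nat" and c :: 'k
    unfolding s ss by (simp add: mult_single total_degree_def sum_distrib_right)
  have "(\<Sum>i\<in>UNIV. Var i * partial i f)
      = (\<Sum>\<mu>\<in>keys f. \<Sum>i\<in>UNIV. Var i * partial i (single \<mu> (lookup f \<mu>)))"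
    by (subst poly_mapping_sum_single[of f], subst sum.swap) (simp add: partial_sum sum_distrib_left)
  also have "\<dots> = (\<Sum>\<mu>\<in>keys f. Const (of_nat d) * single \<mu> (lookup f \<mu>))"
    unfolding t using assms by (intro sum.cong) (auto simp: graded_piece_def)
  also have "\<dots> = Const (of_nat d) * f"
    by (simp only: sum_distrib_left[symmetric] poly_mapping_sum_single[symmetric])
  finally show ?thesis .
qed

definition linear_subst :: "'k::field ^ 'n::finite ^ 'n \<Rightarrow> ('n, 'k) mpoly \<Rightarrow> ('n, 'k) mpoly" where
  "linear_subst A = insert_vars Const (\<lambda>i. \<Sum>j\<in>UNIV. Const (A $ i $ j) * Var j)"

lemma ring_map_linear_subst: "ring_map (linear_subst A)"
  unfolding linear_subst_def by (rule ring_map_insert_vars[OF ring_map_Const])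

lemmas linear_subst_simps = ring_mapD[OF ring_map_linear_subst]

lemma linear_subst_Const [simp]: "linear_subst A (Const c) = Const c"
  unfolding linear_subst_def by (rule insert_vars_Const[OF ring_map_Const])

lemma linear_subst_Var: "linear_subst A (Var i) = (\<Sum>j\<in>UNIV. Const (A $ i $ j) * Var j)"
  unfolding linear_subst_def by (rule insert_vars_Var[OF ring_map_Const])

lemma eval_linear_subst: "eval_mpoly (linear_subst A f) p = eval_mpoly f (A *v p)"
proof (rule ring_map_eqI[of "\<lambda>f. eval_mpoly (linear_subst A f) p" "\<lambda>f. eval_mpoly f (A *v p)"])
  show "ring_map (\<lambda>f. eval_mpoly (linear_subst A f) p)"
    by (rule ring_map_comp[OF ring_map_eval ring_map_linear_subst])
  show "eval_mpoly (linear_subst A (Var i)) p = eval_mpoly (Var i) (A *v p)" for i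
    by (simp add: linear_subst_Var eval_simps matrix_vector_mult_def)
qed (auto simp: ring_map_eval)

lemma linear_subst_inverse:
  assumes "A ** B = mat 1"
  shows "linear_subst B (linear_subst A f) = f"
proof (rule ring_map_eqI[of "\<lambda>f. linear_subst B (linear_subst A f)" "\<lambda>f. f"])
  show "ring_map (\<lambda>f. linear_subst B (linear_subst A f))"
    by (rule ring_map_comp[OF ring_map_linear_subst ring_map_linear_subst])
  show "linear_subst B (linear_subst A (Var i)) = Var i" for i
  proof -
    have AB: "(\<Sum>j\<in>UNIV. A $ i $ j * B $ j $ k) = (if i = k then 1 else 0)" for k
      using arg_cong[OF assms, of "\<lambda>C. C $ i $ k"] by (simp add: matrix_matrix_mult_def mat_def)
    have "linear_subst B (linear_subst A (Var i)) = (\<Sum>j\<in>UNIV. \<Sum>k\<in>UNIV. Const (A $ i $ j * B $ j $ k) * Var k)"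
      unfolding linear_subst_Var linear_subst_simps(4,8) linear_subst_Const sum_distrib_left
      by (intro sum.cong refl) (simp add: mult_single)
    also have "\<dots> = (\<Sum>k\<in>UNIV. Const (\<Sum>j\<in>UNIV. A $ i $ j * B $ j $ k) * Var k)"
      by (subst sum.swap) (simp only: Const_simps(8) sum_distrib_right)
    also have "\<dots> = (\<Sum>k\<in>UNIV. if i = k then Var k else 0)"
      unfolding AB by (intro sum.cong) auto
    finally show ?thesis by simp
  qed
qed (auto simp: ring_map_id)

lemma graded_linear_subst:
  assumes "f \<in> graded_piece m" shows "linear_subst A f \<in> graded_piece m"
proof -
  have V: "linear_subst A (Var i) \<in> graded_piece 1" for i
    unfolding linear_subst_Var
    by (intro graded_sum) (use graded_mult[OF graded_Const graded_Var] in force)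
  have "linear_subst A (single \<mu> c) \<in> graded_piece (total_degree \<mu>)" for \<mu> c
  proof -
    have "Const c * (\<Prod>i\<in>UNIV. linear_subst A (Var i) ^ lookup \<mu> i)
        \<in> graded_piece (0 + (\<Sum>i\<in>UNIV. lookup \<mu> i * 1))"
      by (intro graded_mult graded_Const graded_prod graded_power V)
    then show ?thesis
      unfolding single_eq_Const_mult_Vars[of \<mu> c]
      by (simp add: linear_subst_simps total_degree_def)
  qed
  then have "(\<Sum>\<mu>\<in>keys f. linear_subst A (single \<mu> (lookup f \<mu>))) \<in> graded_piece m"
    using assms by (intro graded_sum) (auto simp: graded_piece_def)
  then show ?thesis
    by (simp only: linear_subst_simps(8)[symmetric] poly_mapping_sum_single[symmetric])
qed

lemma chain_rule:
  fixes f :: "('n::finite, 'k::field) mpoly"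
  shows "partial j (linear_subst A f) = (\<Sum>i\<in>UNIV. Const (A $ i $ j) * linear_subst A (partial i f))"
proof (induction f rule: mpoly_ring_induct)
  case (Const c)
  then show ?case by (simp add: linear_subst_simps)
next
  case (Var l)
  have "partial j (linear_subst A (Var l)) = (\<Sum>k\<in>UNIV. if k = j then Const (A $ l $ k) else 0)"
    unfolding linear_subst_Var partial_sum partial_mult partial_Const partial_Var
    by (intro sum.cong) auto
  moreover have "(\<Sum>i\<in>UNIV. Const (A $ i $ j) * linear_subst A (partial i (Var l)))
      = (\<Sum>i\<in>UNIV. if i = l then Const (A $ i $ j) else 0)"
    unfolding partial_Var by (intro sum.cong) (auto simp: linear_subst_simps)
  ultimately show ?case by simp
next
  case (add f g)
  then show ?case by (simp add: linear_subst_simps partial_add distrib_left sum.distrib)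
next
  case (mult f g)
  have "partial j (linear_subst A (f * g))
      = partial j (linear_subst A f) * linear_subst A g + linear_subst A f * partial j (linear_subst A g)"
    by (simp add: linear_subst_simps partial_mult)
  also have "\<dots> = (\<Sum>i\<in>UNIV. Const (A $ i $ j) * linear_subst A (partial i (f * g)))"
    unfolding mult sum_distrib_left sum_distrib_right sum.distrib[symmetric]
    by (intro sum.cong refl) (simp only: linear_subst_simps(3,4) partial_mult algebra_simps)
  finally show ?case .
qed

definition unit_vec :: "'n::finite \<Rightarrow> 'k::field ^ 'n" where
  "unit_vec j = (\<chi> i. if i = j then 1 else 0)"

lemma mult_unit_vec: "A *v unit_vec j = (\<chi> i. A $ i $ j)"
  by (simp add: matrix_vector_mult_def unit_vec_def vec_eq_iff if_distrib cong: if_cong)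

lemma eval_unit_vec:
  fixes f :: "('n::finite, 'k::field) mpoly"
  assumes "f \<in> graded_piece D"
  shows "eval_mpoly f (unit_vec j) = lookup f (single j D)"
proof -
  have "lookup f \<mu> * (\<Prod>i\<in>UNIV. (unit_vec j :: 'k ^ 'n) $ i ^ lookup \<mu> i)
      = (if \<mu> = single j D then lookup f \<mu> else 0)" if "\<mu> \<in> keys f" for \<mu>
  proof (cases "\<exists>i. i \<noteq> j \<and> lookup \<mu> i \<noteq> 0")
    case True
    then obtain i where i: "i \<noteq> j" "lookup \<mu> i \<noteq> 0" by blast
    then have "(unit_vec j :: 'k ^ 'n) $ i ^ lookup \<mu> i = 0" by (simp add: unit_vec_def)
    then have "(\<Prod>i\<in>UNIV. (unit_vec j :: 'k ^ 'n) $ i ^ lookup \<mu> i) = 0"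
      by (intro prod_zero) auto
    moreover have "\<mu> \<noteq> single j D" using i by (auto simp: lookup_single)
    ultimately show ?thesis by simp
  next
    case False
    then have m: "\<mu> = single j (lookup \<mu> j)"
      by (intro poly_mapping_eqI) (auto simp: lookup_single when_def)
    have "total_degree \<mu> = D" using assms that by (auto simp: graded_piece_def)
    then have "\<mu> = single j D" using m by (metis total_degree_single)
    moreover have "(\<Prod>i\<in>UNIV. (unit_vec j :: 'k ^ 'n) $ i ^ lookup \<mu> i) = 1"
      using False by (intro prod.neutral) (auto simp: unit_vec_def)
    ultimately show ?thesis by simp
  qed
  then have "eval_mpoly f (unit_vec j)
      = (\<Sum>\<mu>\<in>keys f. if \<mu> = single j D then lookup f \<mu> else 0)"
    unfolding eval_mpoly_def by (intro sum.cong refl)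
  then show ?thesis by (auto simp: not_in_keys_iff_lookup_eq_zero)
qed

section \<open>Nodes at the coordinate points\<close>

text \<open>
  Vanishing to order at least \<open>r\<close> at the coordinate point of \<open>x\<^sub>i\<close>, in the chart where \<open>x\<^sub>i\<close> is set to \<open>1\<close>.
\<close>

definition transversal_order :: "'n \<Rightarrow> nat \<Rightarrow> ('n::finite, 'k::field) mpoly set" where
  "transversal_order i r = {f. \<forall>\<mu>. lookup f \<mu> \<noteq> 0 \<longrightarrow> r + lookup \<mu> i \<le> total_degree \<mu>}"

lemma transversal_order_0 [simp]: "0 \<in> transversal_order i r"
  by (simp add: transversal_order_def)

lemma transversal_order_add:
  "f \<in> transversal_order i r \<Longrightarrow> g \<in> transversal_order i r \<Longrightarrow> f + g \<in> transversal_order i r"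
  by (auto simp: transversal_order_def lookup_add) (metis add_0)

lemma transversal_order_sum:
  "(\<And>a. a \<in> A \<Longrightarrow> f a \<in> transversal_order i r) \<Longrightarrow> sum f A \<in> transversal_order i r"
  by (induction A rule: infinite_finite_induct) (auto intro: transversal_order_add)

lemma transversal_order_mult:
  assumes "f \<in> transversal_order i r" "g \<in> transversal_order i s"
  shows "f * g \<in> transversal_order i (r + s)"
  unfolding transversal_order_def
proof clarify
  fix \<mu> assume "lookup (f * g) \<mu> \<noteq> 0"
  then obtain a b where ab: "\<mu> = a + b" "a \<in> keys f" "b \<in> keys g"
    using keys_mult[of f g] by (auto simp: in_keys_iff)
  then have "r + lookup a i \<le> total_degree a" "s + lookup b i \<le> total_degree b"
    using assms by (auto simp: transversal_order_def in_keys_iff)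
  then show "r + s + lookup \<mu> i \<le> total_degree \<mu>" by (simp add: ab lookup_add)
qed

lemma total_degree_remove:
  "total_degree \<mu> = lookup \<mu> i + (\<Sum>j\<in>UNIV - {i}. lookup \<mu> j)"
  unfolding total_degree_def by (rule sum.remove) auto

lemma exponent_split_off:
  fixes \<mu> :: "'n \<Rightarrow>\<^sub>0 nat"
  assumes "lookup \<mu> j \<ge> a"
  shows "\<mu> = single j a + (\<mu> - single j a)"
proof (rule poly_mapping_eqI)
  show "lookup \<mu> k = lookup (single j a + (\<mu> - single j a)) k" for k
    using assms by (cases "k = j") (auto simp: lookup_add lookup_minus lookup_single)
qed

lemma almost_pure_exponent:
  assumes "total_degree \<mu> = e" "mixed \<mu>" "lookup \<mu> i + 2 > e"
  obtains l where "l \<noteq> i" "\<mu> = single i (e - 1) + single l (Suc 0)" "e \<ge> 2"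
proof -
  obtain l where l: "l \<noteq> i" "lookup \<mu> l \<noteq> 0" using assms(2) unfolding mixed_def by metis
  define \<nu> where "\<nu> = \<mu> - single l (Suc 0)"
  have \<mu>: "\<mu> = single l (Suc 0) + \<nu>"
    unfolding \<nu>_def by (rule exponent_split_off) (use l in simp)
  have t: "Suc (total_degree \<nu>) = e" using assms(1) unfolding \<mu> by simp
  have "lookup \<mu> i = lookup \<nu> i" unfolding \<mu> using l by (simp add: lookup_add lookup_single)
  then have "lookup \<nu> i + 1 \<ge> e" using assms(3) by simp
  then have z: "(\<Sum>j\<in>UNIV - {i}. lookup \<nu> j) = 0" and i: "lookup \<nu> i = e - 1"
    using total_degree_remove[of \<nu> i] t by linarith+
  have n: "\<nu> = single i (e - 1)"
  proof (rule poly_mapping_eqI)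
    show "lookup \<nu> k = lookup (single i (e - 1)) k" for k
      using z i by (cases "k = i") (auto simp: lookup_single)
  qed
  have "mixed \<mu>" by fact
  then have "e \<noteq> 1"
  proof (rule contrapos_pn)
    assume "e = 1"
    then have "\<mu> = single l (Suc 0)" using \<mu> n by simp
    then show "\<not> mixed \<mu>" by (auto simp: mixed_def lookup_single when_def split: if_splits)
  qed
  then show ?thesis using that[of l] l \<mu> n t by (simp add: add.commute)
qed

text \<open>
  Nondegeneracy of the transversal Hessian at the coordinate point \<open>e\<^sub>m\<close>: the partial derivatives have a
  combination whose part linear in the variables other than \<open>x\<^sub>m\<close> is the single variable \<open>x\<^sub>l\<close>. Adding
  the entry \<open>(m, m)\<close> makes the full Hessian, whose kernel is the line of \<open>e\<^sub>m\<close>, invertible.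
\<close>

lemma transversal_variable:
  fixes g :: "'n::finite \<Rightarrow> ('n, 'k::field) mpoly"
  assumes g: "\<forall>i. g i \<in> graded_piece e" and e: "e \<ge> 1"
    and g2: "\<forall>i \<mu>. lookup (g i) \<mu> \<noteq> 0 \<longrightarrow> lookup \<mu> i + 2 \<le> e"
    and gm: "\<forall>i \<mu>. lookup (g i) \<mu> \<noteq> 0 \<longrightarrow> mixed \<mu>"
    and sym: "\<And>i j. partial i (g j) = partial j (g i)"
    and ker: "\<And>w. (\<And>a. (\<Sum>b\<in>UNIV. eval_mpoly (partial a (g b)) (unit_vec m) * w $ b) = 0)
      \<Longrightarrow> \<exists>c. w = c *s unit_vec m"
    and l: "l \<noteq> m"
  obtains q where "q \<in> transversal_order m 2"
    "single (single m (e - 1) + single l (Suc 0)) 1 - q \<in> ideal_gen g"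
proof -
  define K where "K a b = eval_mpoly (partial a (g b)) (unit_vec m)" for a b
  have gp: "partial a (g b) \<in> graded_piece (e - 1)" for a b using graded_partial g by blast
  have K: "K a b = of_nat (Suc (lookup (single m (e - 1)) a)) *
      lookup (g b) (single m (e - 1) + single a (Suc 0))" for a b
    unfolding K_def eval_unit_vec[OF gp] lookup_partial ..
  have Kl: "K a b = lookup (g b) (single m (e - 1) + single a (Suc 0))"
    if "a \<noteq> m" for a b using that by (simp add: K lookup_single)
  have Ksym: "K a b = K b a" for a b unfolding K_def by (simp add: sym)
  have Km: "K a m = 0" for a
  proof -
    have "lookup (g m) (single m (e - 1) + single a (Suc 0)) = 0"
    proof (rule ccontr)
      assume "\<not> ?thesis"
      then have "lookup (single m (e - 1) + single a (Suc 0)) m + 2 \<le> e"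
        using g2 by blast
      then show False by (simp add: lookup_add)
    qed
    then show ?thesis by (simp add: K)
  qed
  \<comment> \<open>The row and the column of \<open>m\<close> in \<open>K\<close> are zero.\<close>
  define K' :: "'k ^ 'n ^ 'n" where "K' = (\<chi> a b. K a b + (if a = m \<and> b = m then 1 else 0))"
  have K'v: "(K' *v v) $ a = (\<Sum>b\<in>UNIV. K a b * v $ b) + (if a = m then v $ m else 0)" for v a
    unfolding K'_def matrix_vector_mult_def
    by (simp add: distrib_right sum.distrib if_distrib[of "\<lambda>x. x * _"] cong: if_cong)
  have "\<forall>v. K' *v v = 0 \<longrightarrow> v = 0"
  proof (intro allI impI)
    fix v assume v: "K' *v v = 0"
    have row_m: "(\<Sum>b\<in>UNIV. K m b * v $ b) = 0" by (simp add: Ksym[of m] Km)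
    then have vm: "v $ m = 0" using arg_cong[OF v, of "\<lambda>w. w $ m"] K'v[of v m] by simp
    have "(\<Sum>b\<in>UNIV. K a b * v $ b) = 0" for a
      using arg_cong[OF v, of "\<lambda>w. w $ a"] K'v[of v a] row_m by (cases "a = m") auto
    then obtain c where c: "v = c *s unit_vec m" using ker[of v] unfolding K_def by blast
    then have "c = 0" using vm by (simp add: unit_vec_def)
    then show "v = 0" using c by simp
  qed
  then obtain C where "C ** K' = mat 1" unfolding matrix_left_invertible_ker[symmetric] by blast
  then have C: "K' ** C = mat 1" using matrix_left_right_inverse by blast
  define a where "a = C *v unit_vec l"
  have "K' *v a = unit_vec l" unfolding a_def matrix_vector_mul_assoc C by simp
  then have Ka: "(\<Sum>b\<in>UNIV. K l' b * a $ b) = (if l' = l then 1 else 0)" if "l' \<noteq> m" for l'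
    using K'v[of a l'] that by (simp add: unit_vec_def)
  define h where "h = (\<Sum>b\<in>UNIV. Const (a $ b) * g b)"
  have hJ: "h \<in> ideal_gen g" unfolding h_def by (rule ideal_genI)
  have lookup_C: "lookup (Const c * f) \<mu> = c * lookup f \<mu>" for c and f :: "('n, 'k) mpoly" and \<mu>
    by (induction f rule: poly_mapping_induct_single)
      (auto simp: mult_single lookup_single when_def lookup_add distrib_left)
  have lh: "lookup h \<mu> = (\<Sum>b\<in>UNIV. a $ b * lookup (g b) \<mu>)" for \<mu>
    by (simp add: h_def lookup_sum lookup_C)
  let ?x = "single m (e - 1) + single l (Suc 0)"
  define q where "q = single ?x 1 - h"
  have "q \<in> transversal_order m 2"
    unfolding transversal_order_def
  proof clarify
    fix \<mu> assume nz: "lookup q \<mu> \<noteq> 0"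
    show "2 + lookup \<mu> m \<le> total_degree \<mu>"
    proof (rule ccontr)
      assume neg: "\<not> ?thesis"
      have "mixed \<mu> \<and> total_degree \<mu> = e"
      proof (cases "\<mu> = ?x")
        case True
        have False if "e = 1"
        proof -
          have "lookup q ?x = 1 - (\<Sum>b\<in>UNIV. a $ b * lookup (g b) ?x)"
            by (simp add: q_def lookup_minus lh)
          also have "(\<Sum>b\<in>UNIV. a $ b * lookup (g b) ?x) = (\<Sum>b\<in>UNIV. K l b * a $ b)"
            by (simp add: Kl[OF l] mult.commute)
          finally show False using nz True Ka[OF l] by simp
        qed
        then have "mixed ?x"
          unfolding mixed_def using l e
          by (intro exI[of _ m] exI[of _ l]) (auto simp: lookup_add lookup_single)
        then show ?thesis using True e by simp
      next
        case False
        then have "lookup h \<mu> \<noteq> 0" using nz by (simp add: q_def lookup_minus lookup_single)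
        then obtain b where "lookup (g b) \<mu> \<noteq> 0"
          unfolding lh by (metis (no_types, lifting) mult_zero_right sum.neutral)
        then show ?thesis using gm graded_pieceD[OF spec[OF g]] by blast
      qed
      then obtain l' where l': "l' \<noteq> m" "\<mu> = single m (e - 1) + single l' (Suc 0)"
        using neg almost_pure_exponent[of \<mu> e m] by (metis add.commute not_le)
      have "lookup h \<mu> = (\<Sum>b\<in>UNIV. K l' b * a $ b)"
        unfolding lh l'(2) by (simp add: Kl[OF l'(1)] mult.commute)
      also have "\<dots> = (if l' = l then 1 else 0)" by (rule Ka[OF l'(1)])
      finally have lhm: "lookup h \<mu> = (if l' = l then 1 else 0)" .
      have "lookup q \<mu> = 0"
      proof (cases "l' = l")
        case True
        then show ?thesis using lhm l' by (simp add: q_def lookup_minus)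
      next
        case False
        then have "lookup \<mu> l' \<noteq> lookup ?x l'"
          using l' by (simp add: lookup_add lookup_single)
        then have "\<mu> \<noteq> ?x" by metis
        then show ?thesis using False lhm by (simp add: q_def lookup_minus lookup_single)
      qed
      then show False using nz by simp
    qed
  qed
  moreover have "single ?x 1 - q \<in> ideal_gen g" using hJ by (simp add: q_def)
  ultimately show ?thesis using that by blast
qed

text \<open>
  By assumption each variable \<open>x\<^sub>l\<close> with \<open>l \<noteq> m\<close>, multiplied by \<open>x\<^sub>m\<^sup>E\<close>, is of transversal order \<open>2\<close> modulo
  the ideal. So every multiplication by \<open>x\<^sub>m\<^sup>E\<close> raises the transversal order by one.
\<close>

lemma transversal_order_raise:
  fixes g :: "'n::finite \<Rightarrow> ('n, 'k::field) mpoly"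
  assumes step: "\<And>l. l \<noteq> m \<Longrightarrow> \<exists>q\<in>transversal_order m 2.
      single (single m E + single l (Suc 0)) 1 - q \<in> ideal_gen g"
    and f: "f \<in> transversal_order m 1"
  shows "\<exists>q\<in>transversal_order m (Suc s). single (single m (E * s)) 1 * f - q \<in> ideal_gen g"
proof (induction s)
  case 0
  then show ?case using f by (intro bexI[of _ f]) auto
next
  case (Suc s)
  then obtain q where q: "q \<in> transversal_order m (Suc s)"
    "single (single m (E * s)) 1 * f - q \<in> ideal_gen g" by blast
  let ?X = "single (single m E) 1 :: ('n, 'k) mpoly"
  have mono: "\<exists>q'\<in>transversal_order m (Suc (Suc s)). ?X * single \<mu> c - q' \<in> ideal_gen g"
    if \<mu>: "Suc s + lookup \<mu> m \<le> total_degree \<mu>" for \<mu> c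
  proof -
    have "(\<Sum>j\<in>UNIV - {m}. lookup \<mu> j) \<noteq> 0" using \<mu> total_degree_remove[of \<mu> m] by linarith
    then obtain l where l: "l \<in> UNIV - {m}" "lookup \<mu> l \<noteq> 0" by (rule sum.not_neutral_contains_not_neutral)
    then have lm: "l \<noteq> m" by simp
    define \<nu> where "\<nu> = \<mu> - single l (Suc 0)"
    have eq: "\<mu> = single l (Suc 0) + \<nu>"
      unfolding \<nu>_def by (rule exponent_split_off) (use l in simp)
    obtain q' where q': "q' \<in> transversal_order m 2"
      "single (single m E + single l (Suc 0)) 1 - q' \<in> ideal_gen g"
      using step[OF lm] by blast
    have "Suc s + lookup \<nu> m \<le> Suc (total_degree \<nu>)"
      using \<mu> lm unfolding eq by (simp add: lookup_add lookup_single)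
    then have "single \<nu> c \<in> transversal_order m s"
      by (auto simp: transversal_order_def lookup_single when_def)
    from transversal_order_mult[OF this q'(1)]
    have "single \<nu> c * q' \<in> transversal_order m (Suc (Suc s))" by simp
    moreover have "?X * single \<mu> c - single \<nu> c * q' = single \<nu> c *
        (single (single m E + single l (Suc 0)) 1 - q')"
      unfolding eq right_diff_distrib by (simp add: mult_single ac_simps)
    ultimately show ?thesis using ideal_gen_mult[OF q'(2)] by metis
  qed
  have "\<exists>F. \<forall>\<mu>\<in>keys q. F \<mu> \<in> transversal_order m (Suc (Suc s))
      \<and> ?X * single \<mu> (lookup q \<mu>) - F \<mu> \<in> ideal_gen g"
  proof (rule bchoice, rule ballI)
    fix \<mu> assume "\<mu> \<in> keys q"
    then have "Suc s + lookup \<mu> m \<le> total_degree \<mu>"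
      using q(1) by (auto simp: transversal_order_def in_keys_iff)
    from mono[OF this] show "\<exists>q'. q' \<in> transversal_order m (Suc (Suc s))
      \<and> ?X * single \<mu> (lookup q \<mu>) - q' \<in> ideal_gen g" by blast
  qed
  then obtain F where F: "\<And>\<mu>. \<mu> \<in> keys q \<Longrightarrow> F \<mu> \<in> transversal_order m (Suc (Suc s))"
    "\<And>\<mu>. \<mu> \<in> keys q \<Longrightarrow> ?X * single \<mu> (lookup q \<mu>) - F \<mu> \<in> ideal_gen g"
    by blast
  let ?q = "\<Sum>\<mu>\<in>keys q. F \<mu>"
  have Xq: "?X * q = (\<Sum>\<mu>\<in>keys q. ?X * single \<mu> (lookup q \<mu>))"
    by (subst (1) poly_mapping_sum_single[of q]) (simp only: sum_distrib_left)
  have "single (single m (E * Suc s)) 1 * f - ?q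
      = ?X * (single (single m (E * s)) 1 * f - q) + (?X * q - ?q)"
    by (simp add: right_diff_distrib mult_single flip: mult.assoc single_add)
  also have "\<dots> \<in> ideal_gen g"
    unfolding Xq sum_subtractf[symmetric] by (intro ideal_gen_add ideal_gen_mult q(2) ideal_gen_sum F(2))
  finally show ?case using F(1) by (intro bexI[of _ ?q] transversal_order_sum)
qed

text \<open>
  With the common zeros of the partial derivatives known to be the coordinate points, the
  Nullstellensatz bounds the transversal order that has to be reached.
\<close>

lemma mixed_monomials_in_ideal:
  fixes g :: "'n::finite \<Rightarrow> ('n, 'k::{alg_closed_field,field_char_0}) mpoly"
  assumes step: "\<And>m l. l \<noteq> m \<Longrightarrow> \<exists>q\<in>transversal_order m 2.
      single (single m E + single l (Suc 0)) 1 - q \<in> ideal_gen g"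
    and zeros: "\<And>q. (\<And>i. eval_mpoly (g i) q = 0) \<Longrightarrow> \<exists>j c. q = c *s unit_vec j"
  shows "\<exists>c. \<forall>\<mu>. mixed \<mu> \<longrightarrow> c \<le> total_degree \<mu> \<longrightarrow> single \<mu> 1 \<in> ideal_gen g"
proof -
  let ?P = "{x :: 'n \<times> 'n. fst x \<noteq> snd x}"
  have "\<exists>\<rho>. (Var (fst x) * Var (snd x)) ^ \<rho> \<in> ideal_gen g" if x: "x \<in> ?P" for x
  proof (rule nullstellensatz)
    fix p assume "\<And>i. eval_mpoly (g i) p = 0"
    then obtain j c where p: "p = c *s unit_vec j" using zeros by blast
    show "eval_mpoly (Var (fst x) * Var (snd x)) p = 0"
      using x by (auto simp: p eval_simps unit_vec_def)
  qed
  then have "\<forall>x\<in>?P. \<exists>\<rho>. (Var (fst x) * Var (snd x)) ^ \<rho> \<in> ideal_gen g" by blast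
  from bchoice[OF this] obtain \<rho>0
    where \<rho>0: "\<And>x. x \<in> ?P \<Longrightarrow> (Var (fst x) * Var (snd x)) ^ \<rho>0 x \<in> ideal_gen g" by blast
  define \<rho> where "\<rho> = Suc (sum \<rho>0 UNIV)"
  have \<rho>: "(Var a * Var b) ^ \<rho> \<in> ideal_gen g" if "a \<noteq> b" for a b
  proof -
    have "\<rho>0 (a, b) \<le> sum \<rho>0 UNIV" by (rule member_le_sum) auto
    then have "\<rho>0 (a, b) \<le> \<rho>" by (simp add: \<rho>_def)
    then have eq: "(Var a * Var b) ^ \<rho> = (Var a * Var b) ^ (\<rho> - \<rho>0 (a, b)) * (Var a * Var b :: ('n, 'k) mpoly) ^ \<rho>0 (a, b)"
      by (simp flip: power_add)
    show ?thesis unfolding eq using \<rho>0[of "(a, b)"] that by (intro ideal_gen_mult) simp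
  qed
  \<comment> \<open>A monomial of transversal order at least \<open>n \<rho>\<close> contains \<open>x\<^sub>j\<^sup>\<rho>\<close> for some \<open>j \<noteq> m\<close>, and \<open>(x\<^sub>m x\<^sub>j)\<^sup>\<rho>\<close> is in the
    ideal.\<close>
  have far: "Var m ^ \<rho> * single \<mu> c \<in> ideal_gen g"
    if \<mu>: "CARD('n) * \<rho> + lookup \<mu> m \<le> total_degree \<mu>" for m \<mu> c
  proof -
    have "\<exists>j\<in>UNIV - {m}. \<rho> \<le> lookup \<mu> j"
    proof (rule ccontr)
      assume "\<not> ?thesis"
      then have "(\<Sum>j\<in>UNIV - {m}. lookup \<mu> j) \<le> (\<Sum>j\<in>UNIV - {m}. \<rho> - 1)"
        by (intro sum_mono) force
      also have "\<dots> = (CARD('n) - 1) * (\<rho> - 1)" by simp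
      also have "\<dots> \<le> CARD('n) * (\<rho> - 1)" by simp
      also have "\<dots> < CARD('n) * \<rho>" by (simp add: \<rho>_def)
      finally show False using \<mu> total_degree_remove[of \<mu> m] by linarith
    qed
    then obtain j where j: "j \<noteq> m" "\<rho> \<le> lookup \<mu> j" by auto
    have "Var m ^ \<rho> * single \<mu> c
        = (Var m * Var j) ^ \<rho> * single (\<mu> - single j \<rho>) c"
      unfolding power_mult_distrib Var_power
      by (subst exponent_split_off[OF j(2)]) (simp add: mult_single ac_simps)
    then show ?thesis using \<rho>[of m j] j(1) by (simp add: ideal_gen_mult_right)
  qed
  define s where "s = CARD('n) * \<rho>"
  define N where "N = \<rho> + E * s"
  have near: "Var m ^ N * Var j \<in> ideal_gen g" if "j \<noteq> m" for m j
  proof -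
    have "Var j \<in> (transversal_order m 1 :: ('n, 'k) mpoly set)"
      using that by (auto simp: transversal_order_def lookup_single when_def split: if_splits)
    then obtain q where q: "q \<in> transversal_order m (Suc s)"
      "single (single m (E * s)) 1 * Var j - q \<in> ideal_gen g"
      using transversal_order_raise[of m E g "Var j" s] step by blast
    have "Var m ^ \<rho> * q = (\<Sum>\<mu>\<in>keys q. Var m ^ \<rho> * single \<mu> (lookup q \<mu>))"
      by (subst (1) poly_mapping_sum_single[of q]) (simp only: sum_distrib_left)
    also have "\<dots> \<in> ideal_gen g"
      using q(1) by (intro ideal_gen_sum far) (auto simp: transversal_order_def in_keys_iff s_def)
    finally have "Var m ^ \<rho> * q \<in> ideal_gen g" .
    moreover have "Var m ^ \<rho> * (single (single m (E * s)) 1 * Var j - q) \<in> ideal_gen g"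
      using q(2) by (rule ideal_gen_mult)
    ultimately have "Var m ^ \<rho> * (single (single m (E * s)) 1 * Var j - q) + Var m ^ \<rho> * q \<in> ideal_gen g"
      by (intro ideal_gen_add)
    moreover have "Var m ^ \<rho> * (single (single m (E * s)) 1 * Var j - q) + Var m ^ \<rho> * q = Var m ^ N * Var j"
      unfolding right_diff_distrib N_def power_add Var_power by (simp add: mult.assoc)
    ultimately show ?thesis by simp
  qed
  have "single \<mu> 1 \<in> ideal_gen g" if \<mu>: "mixed \<mu>" "CARD('n) * Suc N \<le> total_degree \<mu>" for \<mu>
  proof -
    have "\<exists>m. N \<le> lookup \<mu> m"
    proof (rule ccontr)
      assume "\<not> ?thesis"
      then have "total_degree \<mu> \<le> (\<Sum>m\<in>(UNIV :: 'n set). N)"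
        unfolding total_degree_def by (intro sum_mono) (simp add: not_le less_imp_le)
      moreover have "CARD('n) > 0" by simp
      ultimately show False using \<mu>(2) unfolding mult_Suc_right sum_constant of_nat_id by linarith
    qed
    then obtain m where m: "N \<le> lookup \<mu> m" by blast
    obtain j where j: "j \<noteq> m" "lookup \<mu> j \<noteq> 0" using \<mu>(1) unfolding mixed_def by metis
    define \<nu> where "\<nu> = \<mu> - single m N"
    have 1: "\<mu> = single m N + \<nu>" unfolding \<nu>_def by (rule exponent_split_off[OF m])
    have "lookup \<nu> j \<ge> Suc 0" using j by (simp add: \<nu>_def lookup_minus lookup_single)
    then have 2: "\<nu> = single j (Suc 0) + (\<nu> - single j (Suc 0))" by (rule exponent_split_off)
    have "single \<mu> 1 = Var m ^ N * single \<nu> (1 :: 'k)"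
      unfolding 1 Var_power by (simp add: mult_single)
    also have "\<dots> = (Var m ^ N * Var j) * single (\<nu> - single j (Suc 0)) 1"
      by (subst 2) (simp add: mult_single mult.assoc)
    finally show ?thesis using near[OF j(1)] by (simp add: ideal_gen_mult_right)
  qed
  then show ?thesis by blast
qed

text \<open>
  Singularity at the coordinate points makes the partial derivatives mixed. It also excludes the monomial
  \<open>x\<^sub>i\<^sup>d\<^sup>-\<^sup>1 x\<^sub>l\<close> from \<open>f\<close>, so the derivative by \<open>x\<^sub>i\<close> vanishes to second order at the coordinate point of \<open>x\<^sub>i\<close>.
\<close>

lemma gradient_ideal_contains_forms_through_coordinate_points:
  fixes f :: "('n::finite, 'k::{alg_closed_field,field_char_0}) mpoly"
  assumes f: "f \<in> graded_piece d" and d: "d \<ge> 3"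
    and sing: "\<And>i j. eval_mpoly (partial i f) (unit_vec j) = 0"
    and zeros: "\<forall>q. (\<forall>i. eval_mpoly (partial i f) q = 0) \<longrightarrow> (\<exists>j c. q = c *s unit_vec j)"
    and ker: "\<forall>m w. (\<forall>a. (\<Sum>b\<in>UNIV. eval_mpoly (partial a (partial b f)) (unit_vec m) * w $ b) = 0)
      \<longrightarrow> (\<exists>c. w = c *s unit_vec m)"
    and u: "u \<in> graded_piece m" "\<And>j. eval_mpoly u (unit_vec j) = 0" and m: "Suc m = CARD('n) * (d - 2)"
  shows "u \<in> ideal_gen (\<lambda>i. partial i f)"
proof -
  let ?g = "\<lambda>i. partial i f" and ?e = "d - 1"
  have g: "\<forall>i. ?g i \<in> graded_piece ?e" using graded_partial[OF f] by blast
  have mix: "mixed \<mu>" if h: "h \<in> graded_piece D" "\<And>j. eval_mpoly h (unit_vec j) = 0" "lookup h \<mu> \<noteq> 0"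
    for h :: "('n, 'k) mpoly" and D \<mu>
  proof (rule ccontr)
    assume "\<not> mixed \<mu>"
    then obtain i where "\<mu> = single i (total_degree \<mu>)" by (rule not_mixedE)
    then have "\<mu> = single i D" using graded_pieceD[OF h(1,3)] by simp
    then show False using h(2)[of i] h(3) eval_unit_vec[OF h(1), of i] by simp
  qed
  have gm: "\<forall>i \<mu>. lookup (?g i) \<mu> \<noteq> 0 \<longrightarrow> mixed \<mu>" using mix g sing by blast
  have g2: "\<forall>i \<mu>. lookup (?g i) \<mu> \<noteq> 0 \<longrightarrow> lookup \<mu> i + 2 \<le> ?e"
  proof (intro allI impI, rule ccontr)
    fix i \<mu> assume nz: "lookup (?g i) \<mu> \<noteq> 0" and neg: "\<not> lookup \<mu> i + 2 \<le> ?e"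
    have "total_degree \<mu> = ?e" using graded_pieceD[OF spec[OF g] nz] .
    moreover have "mixed \<mu>" using gm nz by blast
    moreover have "?e < lookup \<mu> i + 2" using neg by simp
    ultimately obtain l where l: "l \<noteq> i" "\<mu> = single i (?e - 1) + single l (Suc 0)"
      by (rule almost_pure_exponent)
    have "single i (?e - 1) + single i (Suc 0) = single i ?e"
    proof -
      have "?e - 1 + Suc 0 = ?e" using d by simp
      then show ?thesis unfolding single_add[symmetric] by (rule arg_cong)
    qed
    then have eq: "\<mu> + single i (Suc 0) = single i ?e + single l (Suc 0)"
      unfolding l(2) by (metis (no_types) add.assoc add.commute)
    have "lookup f (single i ?e + single l (Suc 0)) \<noteq> 0"
      using nz unfolding lookup_partial eq by auto
    moreover have "lookup (?g l) (single i ?e) = 0"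
      using eval_unit_vec[OF spec[OF g], of l i] sing[of l i] by simp
    ultimately show False using l(1) unfolding lookup_partial by (simp add: lookup_single)
  qed
  have step: "\<exists>q\<in>transversal_order m 2. single (single m (?e - 1) + single l (Suc 0)) 1 - q
      \<in> ideal_gen ?g" if lm: "l \<noteq> m" for m l
  proof -
    have e1: "?e \<ge> 1" using d by simp
    obtain q where "q \<in> transversal_order m 2"
      "single (single m (?e - 1) + single l (Suc 0)) 1 - q \<in> ideal_gen ?g"
      using transversal_variable[OF g e1 g2 gm partial_commute _ lm] ker by blast
    then show ?thesis by blast
  qed
  have "\<exists>c. \<forall>\<mu>. mixed \<mu> \<longrightarrow> c \<le> total_degree \<mu> \<longrightarrow> single \<mu> 1 \<in> ideal_gen ?g"
  proof (rule mixed_monomials_in_ideal[OF step])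
    fix q assume q: "\<And>i. eval_mpoly (partial i f) q = 0"
    have "\<forall>i. eval_mpoly (partial i f) q = 0" by (intro allI q)
    then show "\<exists>j c. q = c *s unit_vec j" using zeros by simp
  qed
  then obtain c where c: "\<forall>\<mu>. mixed \<mu> \<longrightarrow> c \<le> total_degree \<mu> \<longrightarrow> single \<mu> 1 \<in> ideal_gen ?g" by blast
  have um: "\<forall>\<mu>. lookup u \<mu> \<noteq> 0 \<longrightarrow> mixed \<mu>" using mix[OF u(1) u(2)] by blast
  have m': "Suc m = CARD('n) * (?e - 1)" using m by (simp add: numeral_2_eq_2)
  show "u \<in> ideal_gen ?g"
    by (rule mixed_forms_below_socle_degree[OF g g2 gm c u(1) um m'])
qed

section \<open>Nodes at points in general linear position\<close>

lemma column_combination_zero: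
  fixes A B :: "'k::field ^ 'n ^ 'n"
  assumes AB: "A ** B = mat 1" and G: "\<And>j. (\<Sum>i\<in>UNIV. A $ i $ j * G i) = 0"
  shows "G k = 0"
proof -
  have e: "(\<Sum>j\<in>UNIV. A $ i $ j * B $ j $ k) = (if i = k then 1 else 0)" for i
    using arg_cong[OF AB, of "\<lambda>C. C $ i $ k"] by (simp add: matrix_matrix_mult_def mat_def)
  have "0 = (\<Sum>j\<in>UNIV. B $ j $ k * (\<Sum>i\<in>UNIV. A $ i $ j * G i))" by (simp add: G)
  also have "\<dots> = (\<Sum>j\<in>UNIV. \<Sum>i\<in>UNIV. (A $ i $ j * B $ j $ k) * G i)"
    unfolding sum_distrib_left by (intro sum.cong refl) (simp add: ac_simps)
  also have "\<dots> = (\<Sum>i\<in>UNIV. (\<Sum>j\<in>UNIV. A $ i $ j * B $ j $ k) * G i)"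
    by (subst sum.swap) (simp only: sum_distrib_right)
  also have "\<dots> = (\<Sum>i\<in>UNIV. if i = k then G i else 0)" unfolding e by (intro sum.cong) auto
  finally show ?thesis by simp
qed

text \<open>
  The substitution \<open>A\<close> moves the points \<open>p j\<close> to the coordinate points. By the chain rule it respects gradient
  ideals and transforms Hessians by congruence.
\<close>

lemma forms_through_nodes_in_gradient_ideal:
  fixes f :: "('n::finite, 'k::{alg_closed_field,field_char_0}) mpoly" and A B :: "'k ^ 'n ^ 'n"
  assumes f: "f \<in> graded_piece d" and d: "d \<ge> 3" and AB: "A ** B = mat 1"
    and p: "\<And>j. p j = A *v unit_vec j"
    and sing: "\<And>i j. eval_mpoly (partial i f) (p j) = 0"
    and zeros: "\<forall>q. (\<forall>i. eval_mpoly (partial i f) q = 0) \<longrightarrow> (\<exists>j c. q = c *s p j)"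
    and ker: "\<forall>m w. (\<forall>a. (\<Sum>b\<in>UNIV. eval_mpoly (partial a (partial b f)) (p m) * w $ b) = 0)
      \<longrightarrow> (\<exists>c. w = c *s p m)"
    and m: "Suc m = CARD('n) * (d - 2)" and u: "u \<in> graded_piece m" "\<And>j. eval_mpoly u (p j) = 0"
  shows "u \<in> gradient_ideal f"
proof -
  let ?f = "linear_subst A f"
  have BA: "B ** A = mat 1" using AB matrix_left_right_inverse by blast
  have f': "?f \<in> graded_piece d" by (rule graded_linear_subst[OF f])
  have ev: "eval_mpoly (partial j ?f) q = (\<Sum>i\<in>UNIV. A $ i $ j * eval_mpoly (partial i f) (A *v q))" for j q
    unfolding chain_rule by (simp add: eval_simps eval_linear_subst)
  have pull: "\<exists>c. q = c *s unit_vec j" if q: "A *v q = c *s p j" for q c j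
  proof -
    have "A *v q = A *v (c *s unit_vec j)" unfolding q p by (simp add: vec.scale)
    then have "(B ** A) *v q = (B ** A) *v (c *s unit_vec j)" unfolding matrix_vector_mul_assoc[symmetric] by simp
    then show ?thesis unfolding BA by auto
  qed
  have sing': "eval_mpoly (partial i ?f) (unit_vec j) = 0" for i j
    unfolding ev p[symmetric] by (simp add: sing)
  have zeros': "\<forall>q. (\<forall>i. eval_mpoly (partial i ?f) q = 0) \<longrightarrow> (\<exists>j c. q = c *s unit_vec j)"
  proof (intro allI impI)
    fix q assume q: "\<forall>i. eval_mpoly (partial i ?f) q = 0"
    have "eval_mpoly (partial i f) (A *v q) = 0" for i
      using column_combination_zero[OF AB, of "\<lambda>i. eval_mpoly (partial i f) (A *v q)" i] q unfolding ev by blast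
    then obtain j c where "A *v q = c *s p j" using zeros by blast
    then show "\<exists>j c. q = c *s unit_vec j" using pull by blast
  qed
  have ker': "\<forall>m w. (\<forall>a. (\<Sum>b\<in>UNIV. eval_mpoly (partial a (partial b ?f)) (unit_vec m) * w $ b) = 0)
      \<longrightarrow> (\<exists>c. w = c *s unit_vec m)"
  proof (intro allI impI)
    fix m w assume w: "\<forall>a. (\<Sum>b\<in>UNIV. eval_mpoly (partial a (partial b ?f)) (unit_vec m) * w $ b) = 0"
    let ?H = "\<lambda>l i. eval_mpoly (partial l (partial i f)) (p m)"
    have h: "eval_mpoly (partial a (partial b ?f)) (unit_vec m)
        = (\<Sum>i\<in>UNIV. \<Sum>l\<in>UNIV. A $ i $ b * A $ l $ a * ?H l i)" for a b
    proof -
      have "partial a (partial b ?f) = (\<Sum>i\<in>UNIV. Const (A $ i $ b) * partial a (linear_subst A (partial i f)))"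
        unfolding chain_rule[of b A f] partial_sum partial_mult by simp
      then show ?thesis
        unfolding chain_rule[of a A] by (simp add: eval_simps eval_linear_subst sum_distrib_left mult.assoc flip: p)
    qed
    have "(\<Sum>l\<in>UNIV. A $ l $ a * (\<Sum>i\<in>UNIV. ?H l i * (A *v w) $ i))
        = (\<Sum>b\<in>UNIV. eval_mpoly (partial a (partial b ?f)) (unit_vec m) * w $ b)" for a
    proof -
      have "(\<Sum>l\<in>UNIV. A $ l $ a * (\<Sum>i\<in>UNIV. ?H l i * (A *v w) $ i))
          = (\<Sum>l\<in>UNIV. \<Sum>i\<in>UNIV. \<Sum>b\<in>UNIV. A $ i $ b * A $ l $ a * ?H l i * w $ b)"
        unfolding matrix_vector_mult_def vec_lambda_beta sum_distrib_left
        by (intro sum.cong refl) (simp add: ac_simps)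
      also have "\<dots> = (\<Sum>b\<in>UNIV. \<Sum>i\<in>UNIV. \<Sum>l\<in>UNIV. A $ i $ b * A $ l $ a * ?H l i * w $ b)"
        by (subst sum.swap, subst (2) sum.swap, subst sum.swap, rule refl)
      finally show ?thesis unfolding h sum_distrib_right .
    qed
    then have "(\<Sum>l\<in>UNIV. A $ l $ a * (\<Sum>i\<in>UNIV. ?H l i * (A *v w) $ i)) = 0" for a using w by simp
    then have "(\<Sum>i\<in>UNIV. ?H l i * (A *v w) $ i) = 0" for l
      using column_combination_zero[OF AB, of "\<lambda>l. \<Sum>i\<in>UNIV. ?H l i * (A *v w) $ i" l] by blast
    then obtain c where "A *v w = c *s p m" using ker by blast
    then show "\<exists>c. w = c *s unit_vec m" by (rule pull)
  qed
  note main = gradient_ideal_contains_forms_through_coordinate_points[OF f' d sing' zeros' ker']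
  have 1: "linear_subst A u \<in> ideal_gen (\<lambda>i. partial i ?f)"
    by (rule main[OF graded_linear_subst[OF u(1)] _ m]) (simp add: eval_linear_subst u(2) flip: p)
  have 2: "linear_subst B (partial i ?f) \<in> ideal_gen (\<lambda>i. partial i f)" for i
    unfolding chain_rule linear_subst_simps(4,8) linear_subst_Const linear_subst_inverse[OF AB] by (rule ideal_genI)
  have "linear_subst B (linear_subst A u) \<in> ideal_gen (\<lambda>i. partial i f)"
    by (rule ideal_gen_image[OF ring_map_linear_subst 2 1])
  then show "u \<in> gradient_ideal f" by (simp add: linear_subst_inverse[OF AB] gradient_ideal_eq)
qed

lemma smult_mpoly_eq: "smult_mpoly c f = Const c * f"
  by (simp add: smult_mpoly_def)

lemma eval_smult: "eval_mpoly (smult_mpoly c f) p = c * eval_mpoly f p"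
  by (simp add: smult_mpoly_eq eval_simps)

lemma subspace_eval_zero: "mpoly.subspace {f. eval_mpoly f p = 0}"
  by (rule mpoly.subspaceI) (auto simp: eval_simps eval_smult)

lemma graded_piece_finite_span:
  "\<exists>M :: ('n::finite, 'k::field) mpoly set. finite M \<and> graded_piece m \<subseteq> mpoly.span M"
proof (intro exI conjI subsetI)
  let ?M = "(\<lambda>\<mu>. single \<mu> 1) ` {\<mu> :: 'n \<Rightarrow>\<^sub>0 nat. total_degree \<mu> \<le> m} :: ('n, 'k) mpoly set"
  show "finite ?M" using finite_total_degree_le by blast
  fix f :: "('n, 'k) mpoly" assume f: "f \<in> graded_piece m"
  have "f = (\<Sum>\<mu>\<in>keys f. smult_mpoly (lookup f \<mu>) (single \<mu> 1))"
    by (simp add: smult_mpoly_eq mult_single flip: poly_mapping_sum_single)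
  also have "\<dots> \<in> mpoly.span ?M"
    using f by (intro mpoly.span_sum mpoly.span_scale mpoly.span_base) (auto simp: graded_piece_def)
  finally show "f \<in> mpoly.span ?M" .
qed

text \<open>
  The forms \<open>u j\<close> complete a basis of the subspace of forms vanishing at the points \<open>p j\<close>: evaluation at the
  points separates them from it, and subtracting interpolating combinations leads into it.
\<close>

lemma dim_graded_piece_vanishing:
  fixes p :: "'n::finite \<Rightarrow> 'k::field ^ 'n" and u :: "'n \<Rightarrow> ('n, 'k) mpoly"
  assumes u: "\<And>j. u j \<in> graded_piece m" "\<And>j l. eval_mpoly (u j) (p l) = (if j = l then 1 else 0)"
  shows "mpoly.dim (graded_piece m :: ('n, 'k) mpoly set)
    = mpoly.dim {f \<in> graded_piece m. \<forall>j. eval_mpoly f (p j) = 0} + CARD('n)"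
proof -
  let ?W = "{f \<in> graded_piece m. \<forall>j. eval_mpoly f (p j) = 0}"
  obtain B where B: "B \<subseteq> ?W" "mpoly.independent B" "?W \<subseteq> mpoly.span B" "card B = mpoly.dim ?W"
    using mpoly.basis_exists[of ?W] by blast
  obtain M :: "('n, 'k) mpoly set" where M: "finite M" "graded_piece m \<subseteq> mpoly.span M"
    using graded_piece_finite_span by blast
  have finB: "finite B" using mpoly.independent_span_bound[OF M(1) B(2)] B(1) M(2) by blast
  have ind: "mpoly.independent (B \<union> u ` J) \<and> card (B \<union> u ` J) = card B + card J" if "finite J" for J
    using that
  proof (induction J rule: finite_induct)
    case (insert j J)
    have "B \<union> u ` J \<subseteq> {f. eval_mpoly f (p j) = 0}" using B(1) insert(2) u(2) by auto
    then have "mpoly.span (B \<union> u ` J) \<subseteq> {f. eval_mpoly f (p j) = 0}"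
      using mpoly.span_minimal subspace_eval_zero by blast
    moreover have "u j \<notin> {f. eval_mpoly f (p j) = 0}" using u(2)[of j j] by simp
    ultimately have nsp: "u j \<notin> mpoly.span (B \<union> u ` J)" by blast
    then have "u j \<notin> B \<union> u ` J" using mpoly.span_superset[of "B \<union> u ` J"] by blast
    then show ?case using insert nsp finB mpoly.independent_insertI[OF nsp] by auto
  qed (use B in simp)
  have "graded_piece m \<subseteq> mpoly.span (B \<union> range u)"
  proof
    fix f :: "('n, 'k) mpoly" assume f: "f \<in> graded_piece m"
    let ?s = "\<Sum>j\<in>UNIV. smult_mpoly (eval_mpoly f (p j)) (u j)"
    have "?s \<in> graded_piece m"
      unfolding smult_mpoly_eq by (intro graded_sum) (use graded_mult[OF graded_Const u(1)] in force)
    moreover have "eval_mpoly ?s (p l) = eval_mpoly f (p l)" for l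
      by (simp add: eval_simps(8) eval_smult u(2) if_distrib cong: if_cong)
    ultimately have "f - ?s \<in> ?W" using f by (auto intro: graded_diff simp: eval_simps(6))
    then have "f - ?s \<in> mpoly.span (B \<union> range u)" using B(3) mpoly.span_mono[of B "B \<union> range u"] by blast
    moreover have "?s \<in> mpoly.span (B \<union> range u)"
      by (intro mpoly.span_sum mpoly.span_scale mpoly.span_base) auto
    ultimately have "(f - ?s) + ?s \<in> mpoly.span (B \<union> range u)" by (rule mpoly.span_add)
    then show "f \<in> mpoly.span (B \<union> range u)" by simp
  qed
  moreover have "B \<union> range u \<subseteq> graded_piece m" using B(1) u(1) by auto
  ultimately have "mpoly.dim (graded_piece m :: ('n, 'k) mpoly set) = card B + CARD('n)"
    using ind[of UNIV] by (intro mpoly.dim_unique[of "B \<union> range u"]) auto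
  then show ?thesis using B(4) by simp
qed

lemma linear_form_zero:
  fixes l :: "('n::finite, 'k::field) mpoly" and A B :: "'k ^ 'n ^ 'n"
  assumes l: "l \<in> graded_piece 1" and AB: "A ** B = mat 1" and z: "\<And>j. eval_mpoly l (A *v unit_vec j) = 0"
  shows "l = 0"
proof -
  have "linear_subst A l = 0"
  proof (rule poly_mapping_eqI, rule ccontr)
    fix \<mu> assume nz: "lookup (linear_subst A l) \<mu> \<noteq> lookup 0 \<mu>"
    have g: "linear_subst A l \<in> graded_piece 1" by (rule graded_linear_subst[OF l])
    then have "total_degree \<mu> = Suc 0" using nz graded_pieceD[OF g, of \<mu>] by simp
    then obtain j where "\<mu> = single j (Suc 0)" by (rule total_degree_eq_1)
    then show False using nz eval_unit_vec[OF g, of j] z[of j] by (simp add: eval_linear_subst)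
  qed
  then show ?thesis using linear_subst_inverse[OF AB, of l] by (simp add: linear_subst_simps)
qed

text \<open>
  The piece of the gradient ideal consists of all forms through the points \<open>p j\<close>. Powers of the dual linear forms
  interpolate at these points, so their number is the codimension. If a power of \<open>l\<close> vanishes at the points, then so does
  \<open>l\<close>, and \<open>l = 0\<close> since they span the space.
\<close>

theorem veronese_avoiding_of_nodes:
  fixes f :: "('n::finite, 'k::{alg_closed_field,field_char_0}) mpoly" and A B :: "'k ^ 'n ^ 'n"
  assumes f: "f \<in> graded_piece d" and d: "d \<ge> 3" and n: "CARD('n) \<ge> 3" and AB: "A ** B = mat 1"
    and p: "\<And>j. p j = A *v unit_vec j"
    and sing: "\<And>i j. eval_mpoly (partial i f) (p j) = 0"
    and zeros: "\<forall>q. (\<forall>i. eval_mpoly (partial i f) q = 0) \<longrightarrow> (\<exists>j c. q = c *s p j)"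
    and ker: "\<forall>m w. (\<forall>a. (\<Sum>b\<in>UNIV. eval_mpoly (partial a (partial b f)) (p m) * w $ b) = 0)
      \<longrightarrow> (\<exists>c. w = c *s p m)"
    and red: "reduced_hypersurface f"
  shows "veronese_avoiding d f"
proof -
  define m where "m = CARD('n) * (d - 2) - 1"
  have BA: "B ** A = mat 1" using AB matrix_left_right_inverse by blast
  have "3 * 1 \<le> CARD('n) * (d - 2)" using n d by (intro mult_le_mono) auto
  then have m: "Suc m = CARD('n) * (d - 2)" and m1: "m \<ge> 1" by (auto simp: m_def)
  have piece: "gradient_ideal_piece f m = {u \<in> graded_piece m. \<forall>j. eval_mpoly u (p j) = 0}"
  proof (intro equalityI subsetI)
    fix u assume u: "u \<in> gradient_ideal_piece f m"
    then obtain a where "u = (\<Sum>i\<in>UNIV. a i * partial i f)"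
      by (auto simp: gradient_ideal_piece_def gradient_ideal_def)
    then show "u \<in> {u \<in> graded_piece m. \<forall>j. eval_mpoly u (p j) = 0}"
      using u sing by (simp add: eval_simps gradient_ideal_piece_def)
  next
    fix u assume "u \<in> {u \<in> graded_piece m. \<forall>j. eval_mpoly u (p j) = 0}"
    then show "u \<in> gradient_ideal_piece f m"
      using forms_through_nodes_in_gradient_ideal[OF f d AB p sing zeros ker m, of u]
      by (simp add: gradient_ideal_piece_def)
  qed
  define y :: "'n \<Rightarrow> ('n, 'k) mpoly" where "y j = (\<Sum>i\<in>UNIV. Const (B $ j $ i) * Var i)" for j
  have y1: "y j \<in> graded_piece 1" for j
    unfolding y_def by (intro graded_sum) (use graded_mult[OF graded_Const graded_Var] in force)
  have yp: "eval_mpoly (y j) (p l) = (if j = l then 1 else 0)" for j l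
  proof -
    have "eval_mpoly (y j) (p l) = (B *v p l) $ j"
      by (simp add: y_def eval_simps matrix_vector_mult_def)
    also have "B *v p l = unit_vec l" unfolding p matrix_vector_mul_assoc BA by simp
    finally show ?thesis by (simp add: unit_vec_def)
  qed
  have "mpoly.dim (graded_piece m :: ('n, 'k) mpoly set) = mpoly.dim (gradient_ideal_piece f m) + CARD('n)"
    unfolding piece
  proof (rule dim_graded_piece_vanishing)
    show "y j ^ m \<in> graded_piece m" for j using graded_power[OF y1, of j m] by simp
    show "eval_mpoly (y j ^ m) (p l) = (if j = l then 1 else 0)" for j l
      using m1 by (simp add: eval_simps yp)
  qed
  then have I: "proj_codim (graded_piece m) (gradient_ideal_piece f m) = int CARD('n)"
    by (simp add: proj_codim_def)
  have II: "proj_space smult_mpoly (gradient_ideal_piece f m) \<inter> veronese m = {}"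
  proof (rule ccontr)
    assume "\<not> ?thesis"
    then obtain v l where v: "v \<in> gradient_ideal_piece f m" and l: "l \<in> graded_piece 1" "l \<noteq> 0"
      "proj_point smult_mpoly v = proj_point smult_mpoly (l ^ m)"
      by (auto simp: proj_space_def veronese_def)
    have "l ^ m = smult_mpoly 1 (l ^ m)" by simp
    then have "l ^ m \<in> proj_point smult_mpoly (l ^ m)" unfolding proj_point_def by blast
    then have "l ^ m \<in> proj_point smult_mpoly v" by (simp only: l(3))
    then obtain c where c: "l ^ m = smult_mpoly c v" unfolding proj_point_def by blast
    have "eval_mpoly l (p j) = 0" for j
    proof -
      have "eval_mpoly l (p j) ^ m = c * eval_mpoly v (p j)"
        using arg_cong[OF c, of "\<lambda>f. eval_mpoly f (p j)"] by (simp add: eval_simps eval_smult)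
      then show ?thesis using v unfolding piece by simp
    qed
    then have "l = 0" using linear_form_zero[OF l(1) AB] unfolding p by blast
    then show False using l(2) by simp
  qed
  show ?thesis using red I II by (simp add: veronese_avoiding_def Let_def m_def)
qed

subsection \<open>From the definition of a node\<close>

lemma eval_scale:
  assumes "h \<in> graded_piece D" shows "eval_mpoly h (c *s q) = c ^ D * eval_mpoly h q"
proof -
  have "(\<Prod>i\<in>UNIV. (c *s q) $ i ^ lookup \<mu> i)
      = c ^ D * (\<Prod>i\<in>UNIV. q $ i ^ lookup \<mu> i)" if "\<mu> \<in> keys h" for \<mu>
  proof -
    have "total_degree \<mu> = D" using assms that by (auto simp: graded_piece_def)
    then show ?thesis by (simp add: power_mult_distrib prod.distrib total_degree_def flip: power_sum)
  qed
  then show ?thesis by (simp add: eval_mpoly_def sum_distrib_left ac_simps)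
qed

lemma dehomogenize_eq: "dehomogenize i f = insert_vars Const (\<lambda>j. if j = i then 1 else Var j) f"
proof -
  have "single (Poly_Mapping.update i 0 \<mu>) c
      = Const c * (\<Prod>j\<in>UNIV. (if j = i then 1 else Var j) ^ lookup \<mu> j)"
    for \<mu> :: "'a \<Rightarrow>\<^sub>0 nat" and c :: 'b
    unfolding single_eq_Const_mult_Vars[of "Poly_Mapping.update i 0 \<mu>" c]
    by (intro arg_cong2[of _ _ _ _ "(*)"] prod.cong refl) (auto simp: lookup_update)
  then show ?thesis by (simp add: dehomogenize_def insert_vars_def)
qed

lemma ring_map_dehomogenize: "ring_map (dehomogenize i)"
proof -
  have "dehomogenize i = (insert_vars Const (\<lambda>j. if j = i then 1 else Var j) :: ('a, 'b) mpoly \<Rightarrow> _)"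
    by (rule ext) (rule dehomogenize_eq)
  then show ?thesis by (simp only: ring_map_insert_vars[OF ring_map_Const])
qed

lemma dehomogenize_Const [simp]: "dehomogenize i (Const c) = Const c"
  unfolding dehomogenize_eq by (rule insert_vars_Const[OF ring_map_Const])

lemma dehomogenize_Var: "dehomogenize i (Var j) = (if j = i then 1 else Var j)"
  unfolding dehomogenize_eq by (rule insert_vars_Var[OF ring_map_Const])

lemma eval_dehomogenize:
  fixes p :: "'k::field ^ 'n::finite"
  assumes "p $ i = 1" shows "eval_mpoly (dehomogenize i f) p = eval_mpoly f p"
  by (rule ring_map_eqI[of "\<lambda>f. eval_mpoly (dehomogenize i f) p" "\<lambda>f. eval_mpoly f p"])
    (auto simp: dehomogenize_Var assms eval_simps ring_map_eval intro: ring_map_comp[OF ring_map_eval ring_map_dehomogenize])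

lemma partial_dehomogenize:
  assumes "j \<noteq> i" shows "partial j (dehomogenize i f) = dehomogenize i (partial j f)"
proof (induction f rule: mpoly_ring_induct)
  case (Const c)
  then show ?case by (simp add: ring_mapD[OF ring_map_dehomogenize])
next
  case (Var l)
  then show ?case using assms by (auto simp: dehomogenize_Var partial_Var ring_mapD[OF ring_map_dehomogenize])
next
  case (add f g)
  then show ?case by (simp add: ring_mapD[OF ring_map_dehomogenize] partial_add)
next
  case (mult f g)
  then show ?case by (simp add: ring_mapD[OF ring_map_dehomogenize] partial_mult)
qed

lemma eval_of_nat [simp]: "eval_mpoly (of_nat m) p = of_nat m"
  using eval_Const[of "of_nat m" p] by (simp del: eval_Const)

text \<open>
  By Euler's identity for the partial derivatives, the homogeneous Hessian kills \<open>p\<close>. A vector of its kernel can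
  therefore be moved into \<open>v $ i = 0\<close> by a multiple of \<open>p\<close>, where the Hessian of the chart is nondegenerate.
\<close>

lemma node_hessian_kernel:
  fixes f :: "('n::finite, 'k::field) mpoly" and p w :: "'k ^ 'n"
  assumes f: "f \<in> graded_piece d" and pi: "p $ i = 1"
    and sing: "\<And>a. eval_mpoly (partial a f) p = 0"
    and nd: "\<And>v :: 'k ^ 'n. v $ i = 0 \<Longrightarrow> (\<And>j. j \<noteq> i \<Longrightarrow>
      (\<Sum>l\<in>UNIV - {i}. eval_mpoly (partial j (partial l (dehomogenize i f))) p * v $ l) = 0) \<Longrightarrow> v = 0"
    and w: "\<And>a. (\<Sum>b\<in>UNIV. eval_mpoly (partial a (partial b f)) p * w $ b) = 0"
  shows "w = (w $ i) *s p"
proof -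
  define v where "v = w - (w $ i) *s p"
  have vi: "v $ i = 0" by (simp add: v_def pi)
  have hp: "(\<Sum>b\<in>UNIV. eval_mpoly (partial a (partial b f)) p * p $ b) = 0" for a
  proof -
    have "(\<Sum>b\<in>UNIV. eval_mpoly (Var b * partial b (partial a f)) p) = of_nat (d - 1) * eval_mpoly (partial a f) p"
      using arg_cong[OF euler_identity[OF graded_partial[OF f], of a], of "\<lambda>h. eval_mpoly h p"]
      by (simp add: eval_simps)
    then show ?thesis by (simp add: sing eval_simps partial_commute[of _ a] mult.commute)
  qed
  have hv: "(\<Sum>b\<in>UNIV. eval_mpoly (partial a (partial b f)) p * v $ b) = 0" for a
  proof -
    have "(\<Sum>b\<in>UNIV. eval_mpoly (partial a (partial b f)) p * v $ b)
        = (\<Sum>b\<in>UNIV. eval_mpoly (partial a (partial b f)) p * w $ b)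
          - w $ i * (\<Sum>b\<in>UNIV. eval_mpoly (partial a (partial b f)) p * p $ b)"
      unfolding sum_distrib_left sum_subtractf[symmetric]
      by (intro sum.cong refl) (simp add: v_def algebra_simps)
    then show ?thesis by (simp add: w hp)
  qed
  have "v = 0"
  proof (rule nd[OF vi])
    fix j assume j: "j \<noteq> i"
    have "(\<Sum>l\<in>UNIV - {i}. eval_mpoly (partial j (partial l (dehomogenize i f))) p * v $ l)
        = (\<Sum>l\<in>UNIV - {i}. eval_mpoly (partial j (partial l f)) p * v $ l)"
      using j pi by (intro sum.cong refl) (simp add: partial_dehomogenize eval_dehomogenize)
    also have "\<dots> = (\<Sum>l\<in>UNIV. eval_mpoly (partial j (partial l f)) p * v $ l)"
      by (intro sum.mono_neutral_left) (auto simp: vi)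
    finally show "(\<Sum>l\<in>UNIV - {i}. eval_mpoly (partial j (partial l (dehomogenize i f))) p * v $ l) = 0"
      by (simp add: hv)
  qed
  then show ?thesis by (simp add: v_def)
qed

lemma zero_of_gradient_zero:
  fixes f :: "('n::finite, 'k::field_char_0) mpoly"
  assumes f: "f \<in> graded_piece d" "d \<noteq> 0" and z: "\<And>i. eval_mpoly (partial i f) q = 0"
  shows "eval_mpoly f q = 0"
  using arg_cong[OF euler_identity[OF f(1)], of "\<lambda>h. eval_mpoly h q"] f(2) by (simp add: eval_simps z)

theorem nodal_locus_subset:
  fixes d :: nat
  assumes n: "CARD('n::finite) \<ge> 3" and d: "d \<ge> 3"
  shows "(nodal_locus d :: ('n, 'k::{alg_closed_field, field_char_0}) mpoly set set) \<subseteq> VA_red_locus d"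
proof
  fix X :: "('n, 'k) mpoly set" assume "X \<in> nodal_locus d"
  then obtain f :: "('n, 'k) mpoly" where X: "X = proj_point smult_mpoly f" and f: "f \<in> graded_piece d" "f \<noteq> 0"
    and red: "reduced_hypersurface f" and fin: "finite (singular_locus f)"
    and card: "card (singular_locus f) = CARD('n)" and node: "\<And>P. P \<in> singular_locus f \<Longrightarrow> is_node f P"
    and span: "vec.span (\<Union>(singular_locus f)) = UNIV"
    unfolding nodal_locus_def by blast
  obtain P where P: "bij_betw P (UNIV :: 'n set) (singular_locus f)"
    using finite_same_card_bij[of "UNIV :: 'n set" "singular_locus f"] fin card by auto
  have PS: "P j \<in> singular_locus f" for j using P by (auto simp: bij_betw_def)
  have "\<exists>p. P j = proj_point (*s) p \<and> (\<forall>a. eval_mpoly (partial a f) p = 0)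
      \<and> (\<forall>w. (\<forall>a. (\<Sum>b\<in>UNIV. eval_mpoly (partial a (partial b f)) p * w $ b) = 0) \<longrightarrow> (\<exists>c. w = c *s p))" (is "\<exists>p. ?Q j p") for j
  proof -
    obtain i and p :: "'k ^ 'n" where ip: "P j = proj_point (*s) p" "p $ i = 1"
      and nd: "\<forall>v :: 'k ^ 'n. v $ i = 0 \<and> (\<forall>j. j \<noteq> i \<longrightarrow>
        (\<Sum>l\<in>UNIV - {i}. eval_mpoly (partial j (partial l (dehomogenize i f))) p * v $ l) = 0) \<longrightarrow> v = 0"
      using node[OF PS[of j]] unfolding is_node_def Let_def
      by (elim exE conjE) (rule that, assumption+)
    obtain q where q: "P j = proj_point (*s) q" "\<And>a. eval_mpoly (partial a f) q = 0"
      using PS[of j] unfolding singular_locus_def by auto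
    have "p = 1 *s p" by simp
    then have "p \<in> P j" unfolding ip(1) proj_point_def by blast
    then obtain c where c: "p = c *s q" unfolding q(1) proj_point_def by blast
    have s: "eval_mpoly (partial a f) p = 0" for a
      unfolding c eval_scale[OF graded_partial[OF f(1)]] q(2) by simp
    have "\<exists>c. w = c *s p" if w: "\<forall>a. (\<Sum>b\<in>UNIV. eval_mpoly (partial a (partial b f)) p * w $ b) = 0" for w
    proof -
      have "w = (w $ i) *s p"
        by (rule node_hessian_kernel[OF f(1) ip(2) s]) (use nd w in blast)+
      then show ?thesis by blast
    qed
    then show ?thesis using ip(1) s by blast
  qed
  then have "\<forall>j. \<exists>p. ?Q j p" by blast
  from choice[OF this] obtain p where Q: "\<forall>j. ?Q j (p j)" by blast
  then have p: "P j = proj_point (*s) (p j)" "eval_mpoly (partial a f) (p j) = 0" for j a by blast+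
  have ker: "\<forall>m w. (\<forall>a. (\<Sum>b\<in>UNIV. eval_mpoly (partial a (partial b f)) (p m) * w $ b) = 0)
      \<longrightarrow> (\<exists>c. w = c *s p m)" using Q by blast
  \<comment> \<open>General linear position: the matrix of the representatives is invertible.\<close>
  define A :: "'k ^ 'n ^ 'n" where "A = (\<chi> i j. p j $ i)"
  have Ap: "p j = A *v unit_vec j" for j by (simp add: mult_unit_vec A_def vec_eq_iff)
  have "columns A = range p" by (auto simp: columns_def column_def A_def)
  have "\<Union>(singular_locus f) \<subseteq> vec.span (range p)"
  proof
    fix x assume "x \<in> \<Union>(singular_locus f)"
    then obtain j where "x \<in> P j" using P by (auto simp: bij_betw_def)
    then obtain c where "x = c *s p j" unfolding p(1) proj_point_def by blast
    then show "x \<in> vec.span (range p)" by (auto intro: vec.span_scale vec.span_base)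
  qed
  then have "vec.span (\<Union>(singular_locus f)) \<subseteq> vec.span (range p)"
    by (rule vec.span_minimal) (rule vec.subspace_span)
  then have "vec.span (columns A) = UNIV" using span \<open>columns A = range p\<close> by auto
  then obtain B where AB: "A ** B = mat 1" using matrix_right_invertible_span_columns[of A] by blast
  have "\<exists>j c. q = c *s p j" if q: "\<And>i. eval_mpoly (partial i f) q = 0" for q
  proof (cases "q = 0")
    case True
    then show ?thesis by (intro exI[of _ undefined] exI[of _ 0]) simp
  next
    case False
    have "eval_mpoly f q = 0" by (rule zero_of_gradient_zero[OF f(1) _ q]) (use d in simp)
    then have "proj_point (*s) q \<in> singular_locus f" using False q unfolding singular_locus_def by blast
    then have "proj_point (*s) q \<in> range P" using P by (simp add: bij_betw_def)
    then obtain j where j: "P j = proj_point (*s) q" by auto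
    have "q = 1 *s q" by simp
    then have "q \<in> P j" unfolding j proj_point_def by blast
    then show ?thesis unfolding p(1) proj_point_def by blast
  qed
  then have zeros: "\<forall>q. (\<forall>i. eval_mpoly (partial i f) q = 0) \<longrightarrow> (\<exists>j c. q = c *s p j)" by blast
  have "veronese_avoiding d f"
    by (rule veronese_avoiding_of_nodes[OF f(1) d n AB Ap p(2) zeros ker red])
  then show "X \<in> VA_red_locus d"
    using X f red unfolding VA_red_locus_def VA_locus_def reduced_locus_def by blast
qed

section \<open>Recognising nodal hypersurfaces\<close>

definition line_poly :: "('n::finite, 'k::field) mpoly \<Rightarrow> 'k ^ 'n \<Rightarrow> 'k ^ 'n \<Rightarrow> 'k poly" where
  "line_poly f a v = insert_vars (\<lambda>c. [:c:]) (\<lambda>i. [:a $ i, v $ i:]) f"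

lemma poly_line_poly:
  fixes f :: "('n::finite, 'k::field) mpoly"
  shows "poly (line_poly f a v) t = eval_mpoly f (a + t *s v)"
proof -
  have C: "ring_map (\<lambda>c :: 'k. [:c:])" by (simp add: ring_map_def one_pCons)
  show ?thesis
  proof (rule ring_map_eqI[of "\<lambda>f. poly (line_poly f a v) t" "\<lambda>f. eval_mpoly f (a + t *s v)"])
    show "ring_map (\<lambda>f. poly (line_poly f a v) t)"
      using ring_map_insert_vars[OF C, of "\<lambda>i. [:a $ i, v $ i:]"] by (simp add: ring_map_def line_poly_def)
  qed (auto simp: line_poly_def ring_map_eval C)
qed

lemma constant_of_no_zeros_on_line:
  fixes f :: "('n::finite, 'k::{alg_closed_field,field_char_0}) mpoly"
  assumes "\<And>t. eval_mpoly f (a + t *s v) \<noteq> 0"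
  shows "eval_mpoly f (a + t *s v) = eval_mpoly f (a + s *s v)"
proof -
  have "degree (line_poly f a v) = 0"
  proof (rule ccontr)
    assume "degree (line_poly f a v) \<noteq> 0"
    then obtain t where "poly (line_poly f a v) t = 0" using alg_closed_imp_poly_has_root by blast
    then show False using assms[of t] by (simp add: poly_line_poly)
  qed
  then obtain c where "line_poly f a v = [:c:]" by (rule degree_eq_zeroE)
  then show ?thesis by (simp flip: poly_line_poly)
qed

text \<open>
  On a line that avoids \<open>a\<close> the polynomial has no zero and is constant. Such lines in the directions \<open>v\<close> and \<open>w\<close>
  show that it is constant on the line through \<open>a\<close> in direction \<open>v\<close>, outside \<open>a\<close> and hence also at \<open>a\<close>.
\<close>

lemma no_isolated_zero:
  fixes f :: "('n::finite, 'k::{alg_closed_field,field_char_0}) mpoly"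
  assumes nz: "\<And>t s. t \<noteq> 0 \<or> s \<noteq> 0 \<Longrightarrow> eval_mpoly f (a + t *s v + s *s w) \<noteq> 0"
  shows "eval_mpoly f a \<noteq> 0"
proof -
  have A: "eval_mpoly f (a + t *s v + s *s w) = eval_mpoly f (a + s *s w)" if "s \<noteq> 0" for t s
    using constant_of_no_zeros_on_line[of f "a + s *s w" v t 0] nz that by (simp add: ac_simps)
  have B: "eval_mpoly f (a + t *s v + s *s w) = eval_mpoly f (a + t *s v)" if "t \<noteq> 0" for t s
    using constant_of_no_zeros_on_line[of f "a + t *s v" w s 0] nz that by simp
  define \<kappa> where "\<kappa> = eval_mpoly f (a + 1 *s v + 1 *s w)"
  have "eval_mpoly f (a + t *s v) = \<kappa>" if "t \<noteq> 0" for t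
    using A[of 1 t] A[of 1 1] B[OF that, of 1] by (simp add: \<kappa>_def)
  then have "poly (line_poly f a v - [:\<kappa>:]) t = 0" if "t \<noteq> 0" for t
    using that by (simp add: poly_line_poly)
  then have "UNIV - {0} \<subseteq> {t. poly (line_poly f a v - [:\<kappa>:]) t = 0}" by auto
  moreover have "infinite (UNIV - {0 :: 'k})" using infinite_UNIV_char_0 by simp
  ultimately have "line_poly f a v - [:\<kappa>:] = 0" using poly_roots_finite finite_subset by blast
  then have "poly (line_poly f a v) 0 = \<kappa>" by simp
  then have "eval_mpoly f a = \<kappa>" by (simp add: poly_line_poly)
  then show ?thesis using nz[of 1 1] by (simp add: \<kappa>_def)
qed

text \<open>
  A double factor of \<open>f\<close> vanishes only on the singular lines. They are too few for the zero set of a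
  polynomial in at least three variables, so the factor has no zero and is a unit by the
  Nullstellensatz.
\<close>

lemma squarefree_of_nodes:
  fixes f :: "('n::finite, 'k::{alg_closed_field,field_char_0}) mpoly" and A B :: "'k ^ 'n ^ 'n"
  assumes n: "CARD('n) \<ge> 3" and AB: "A ** B = mat 1"
    and zeros: "\<forall>q. (\<forall>i. eval_mpoly (partial i f) q = 0) \<longrightarrow> (\<exists>j c. q = c *s (A *v unit_vec j))"
  shows "squarefree f"
proof (rule squarefreeI)
  fix y assume "y ^ 2 dvd f"
  then obtain h where f: "f = y * (y * h)" by (auto simp: dvd_def power2_eq_square mult.assoc)
  have BA: "B ** A = mat 1" using AB matrix_left_right_inverse by blast
  define z where "z = linear_subst A y"
  have zero: "\<exists>j c. q = c *s unit_vec j" if q: "eval_mpoly z q = 0" for q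
  proof -
    have "eval_mpoly y (A *v q) = 0" using q by (simp add: z_def eval_linear_subst)
    then have "\<forall>i. eval_mpoly (partial i f) (A *v q) = 0"
      unfolding f by (simp add: partial_mult eval_simps)
    then obtain j c where "A *v q = c *s (A *v unit_vec j)" using zeros by blast
    also have "\<dots> = A *v (c *s unit_vec j)" by (simp add: vec.scale)
    finally have "(B ** A) *v q = (B ** A) *v (c *s unit_vec j)" unfolding matrix_vector_mul_assoc[symmetric] by simp
    then show ?thesis unfolding BA by auto
  qed
  have two: "eval_mpoly z q \<noteq> 0" if "q $ i \<noteq> 0" "q $ j \<noteq> 0" "i \<noteq> j" for q :: "'k ^ 'n" and i j
    using zero[of q] that by (auto simp: unit_vec_def split: if_splits)
  have three: "\<exists>j l. j \<noteq> l \<and> j \<noteq> i \<and> l \<noteq> i" for i :: 'n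
  proof -
    have "\<not> UNIV \<subseteq> {i}" using card_mono[of "{i}" "UNIV :: 'n set"] n by fastforce
    then obtain j where j: "j \<noteq> i" by blast
    have "card {i, j} = 2" using j by simp
    then have "\<not> UNIV \<subseteq> {i, j}" using card_mono[of "{i, j}" "UNIV :: 'n set"] n by fastforce
    then show ?thesis using j by blast
  qed
  have one: "eval_mpoly z (c *s unit_vec i) \<noteq> 0" if c: "c \<noteq> 0" for c i
  proof -
    obtain j l where jl: "j \<noteq> l" "j \<noteq> i" "l \<noteq> i" using three by blast
    show ?thesis
    proof (rule no_isolated_zero)
      fix t s :: 'k assume "t \<noteq> 0 \<or> s \<noteq> 0"
      then show "eval_mpoly z (c *s unit_vec i + t *s unit_vec j + s *s unit_vec l) \<noteq> 0"
        using two[of _ i j] two[of _ i l] c jl by (auto simp: unit_vec_def)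
    qed
  qed
  have "eval_mpoly z 0 \<noteq> 0"
  proof -
    obtain j l :: 'n where jl: "j \<noteq> l" using three by blast
    show ?thesis
    proof (rule no_isolated_zero)
      fix t s :: 'k assume ts: "t \<noteq> 0 \<or> s \<noteq> 0"
      show "eval_mpoly z (0 + t *s unit_vec j + s *s unit_vec l) \<noteq> 0"
      proof (cases "t = 0 \<or> s = 0")
        case True
        then show ?thesis using ts one[of t j] one[of s l] by auto
      next
        case False
        then show ?thesis using two[of _ j l] jl by (simp add: unit_vec_def)
      qed
    qed
  qed
  then have nz: "eval_mpoly z q \<noteq> 0" for q
    using zero[of q] one by (metis vector_smult_lzero)
  have "\<exists>m. 1 ^ m \<in> ideal_gen (\<lambda>_ :: unit. z)"
    by (rule nullstellensatz) (use nz in auto)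
  then obtain a where "1 = a * z" by (auto simp: ideal_gen_def UNIV_unit)
  then have "1 = linear_subst B (a * z)" by (metis linear_subst_simps(2))
  also have "\<dots> = linear_subst B a * y"
    unfolding linear_subst_simps(4) z_def linear_subst_inverse[OF AB] ..
  finally show "y dvd 1" by (metis dvd_triv_right)
qed

lemma nodal_locusI:
  fixes f :: "('n::finite, 'k::{alg_closed_field,field_char_0}) mpoly" and A B :: "'k ^ 'n ^ 'n"
  assumes f: "f \<in> graded_piece d" and d: "d \<noteq> 0" and n: "CARD('n) \<ge> 3" and AB: "A ** B = mat 1"
    and p: "\<And>j. p j = A *v unit_vec j"
    and sing: "\<And>i j. eval_mpoly (partial i f) (p j) = 0"
    and zeros: "\<forall>q. (\<forall>i. eval_mpoly (partial i f) q = 0) \<longrightarrow> (\<exists>j c. q = c *s p j)"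
    and node: "\<And>j. is_node f (proj_point (*s) (p j))"
  shows "proj_point smult_mpoly f \<in> nodal_locus d"
proof -
  have BA: "B ** A = mat 1" using AB matrix_left_right_inverse by blast
  have Bp: "B *v p j = unit_vec j" for j unfolding p matrix_vector_mul_assoc BA by simp
  have un: "unit_vec j \<noteq> (0 :: 'k ^ 'n)" for j by (auto simp: unit_vec_def vec_eq_iff)
  have p0: "p j \<noteq> 0" for j using Bp[of j] un[of j] by auto
  have red: "reduced_hypersurface f"
    unfolding reduced_hypersurface_def by (rule squarefree_of_nodes[OF n AB]) (use zeros in \<open>simp add: p\<close>)
  have f0: "f \<noteq> 0"
  proof
    assume "f = 0"
    then have "y ^ 2 dvd f" for y by simp
    then have "(0 :: ('n, 'k) mpoly) dvd 1"
      using red unfolding reduced_hypersurface_def squarefree_def by blast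
    then show False by simp
  qed
  have scale: "proj_point (*s) (c *s v) = proj_point (*s) v" if "c \<noteq> 0" for c :: 'k and v :: "'k ^ 'n"
    unfolding proj_point_def
  proof (intro equalityI subsetI)
    fix x assume "x \<in> {b *s v |b. True}"
    then obtain b where "x = b *s v" by blast
    then have "x = (b / c) *s (c *s v)" using that by (simp add: vector_smult_assoc)
    then show "x \<in> {b *s (c *s v) |b. True}" by blast
  qed (auto simp: vector_smult_assoc)
  have S: "singular_locus f = range (\<lambda>j. proj_point (*s) (p j))"
  proof (intro equalityI subsetI)
    fix X assume "X \<in> singular_locus f"
    then obtain q where q: "X = proj_point (*s) q" "q \<noteq> 0" "\<forall>i. eval_mpoly (partial i f) q = 0"
      unfolding singular_locus_def by auto
    then obtain j c where jc: "q = c *s p j" using zeros by blast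
    then have "c \<noteq> 0" using q(2) by auto
    then show "X \<in> range (\<lambda>j. proj_point (*s) (p j))" using q(1) jc scale by auto
  next
    fix X assume "X \<in> range (\<lambda>j. proj_point (*s) (p j))"
    then obtain j where "X = proj_point (*s) (p j)" by auto
    moreover have "eval_mpoly f (p j) = 0" by (rule zero_of_gradient_zero[OF f d sing])
    ultimately show "X \<in> singular_locus f" unfolding singular_locus_def using p0 sing by blast
  qed
  have mem: "p j \<in> proj_point (*s) (p j)" for j
    unfolding proj_point_def by (auto intro: exI[of _ 1])
  have inj: "inj (\<lambda>j. proj_point (*s) (p j))"
  proof (rule injI)
    fix j l assume "proj_point (*s) (p j) = proj_point (*s) (p l)"
    then have "p j \<in> proj_point (*s) (p l)" using mem[of j] by simp
    then obtain c where "p j = c *s p l" unfolding proj_point_def by blast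
    then have "B *v p j = c *s (B *v p l)" by (simp add: vec.scale)
    then have "unit_vec j = c *s (unit_vec l :: 'k ^ 'n)" unfolding Bp .
    then have "(unit_vec j :: 'k ^ 'n) $ j = (c *s unit_vec l) $ j" by simp
    then show "j = l" by (auto simp: unit_vec_def split: if_splits)
  qed
  have "columns A = range p" by (auto simp: columns_def column_def p mult_unit_vec)
  then have "vec.span (range p) = UNIV" using matrix_right_invertible_span_columns[of A] AB by auto
  moreover have "range p \<subseteq> \<Union>(singular_locus f)" using S mem by auto
  ultimately have span: "vec.span (\<Union>(singular_locus f)) = UNIV" using vec.span_mono by blast
  have "card (singular_locus f) = CARD('n)" unfolding S by (rule card_image[OF inj])
  moreover have "finite (singular_locus f)" unfolding S by simp
  moreover have "\<forall>P\<in>singular_locus f. is_node f P" unfolding S using node by auto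
  ultimately show ?thesis unfolding nodal_locus_def using f f0 red span by blast
qed

section \<open>A nodal cubic\<close>

definition psum1 :: "('n::finite, 'k::field) mpoly" where "psum1 = (\<Sum>i\<in>UNIV. Var i)"
definition psum2 :: "('n::finite, 'k::field) mpoly" where "psum2 = (\<Sum>i\<in>UNIV. Var i * Var i)"
definition psum3 :: "('n::finite, 'k::field) mpoly" where "psum3 = (\<Sum>i\<in>UNIV. Var i * (Var i * Var i))"

text \<open>Six times the third elementary symmetric polynomial, in terms of power sums.\<close>

definition symmetric_cubic :: "('n::finite, 'k::field) mpoly" where
  "symmetric_cubic = psum1 * (psum1 * psum1) - 3 * (psum1 * psum2) + 2 * psum3"

lemma symmetric_cubic_graded: "symmetric_cubic \<in> graded_piece 3"
proof -
  have 1: "psum1 \<in> graded_piece 1" unfolding psum1_def by (intro graded_sum graded_Var)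
  have V2: "Var i * Var i \<in> graded_piece 2" for i
    using graded_mult[OF graded_Var graded_Var] by (simp add: numeral_2_eq_2)
  have 2: "psum2 \<in> graded_piece 2" unfolding psum2_def by (intro graded_sum V2)
  have V3: "Var i * (Var i * Var i) \<in> graded_piece 3" for i
    using graded_mult[OF graded_Var V2] by (simp add: numeral_3_eq_3)
  have 3: "psum3 \<in> graded_piece 3" unfolding psum3_def by (intro graded_sum V3)
  have "psum1 * (psum1 * psum1) \<in> graded_piece (1 + (1 + 1))" by (intro graded_mult 1)
  moreover have num: "numeral w \<in> graded_piece 0" for w using graded_Const[of "numeral w"] by simp
  have "3 * (psum1 * psum2) \<in> graded_piece (0 + (1 + 2))" by (intro graded_mult num 1 2)
  moreover have "2 * psum3 \<in> graded_piece (0 + 3)" by (intro graded_mult num 3)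
  ultimately show ?thesis unfolding symmetric_cubic_def
    by (intro graded_add graded_diff) (simp_all add: numeral_3_eq_3)
qed

lemma partial_numeral [simp]: "partial j (numeral w) = 0"
  using partial_Const[of j "numeral w"] by (simp del: partial_Const)

lemma eval_numeral [simp]: "eval_mpoly (numeral w) p = numeral w"
  using eval_Const[of "numeral w" p] by (simp del: eval_Const)

lemma partial_psum:
  fixes j :: "'n::finite"
  shows "partial j (psum1 :: ('n, 'k::field) mpoly) = 1" "partial j (psum2 :: ('n, 'k) mpoly) = 2 * Var j"
    "partial j (psum3 :: ('n, 'k) mpoly) = 3 * (Var j * Var j)"
proof -
  show "partial j (psum1 :: ('n, 'k) mpoly) = 1" by (simp add: psum1_def partial_sum partial_Var)
  have "partial j (Var i * Var i :: ('n, 'k) mpoly) = (if j = i then 2 * Var i else 0)" for i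
    by (simp add: partial_mult partial_Var)
  then show "partial j (psum2 :: ('n, 'k) mpoly) = 2 * Var j" by (simp add: psum2_def partial_sum)
  have "partial j (Var i * (Var i * Var i) :: ('n, 'k) mpoly) = (if j = i then 3 * (Var i * Var i) else 0)" for i
    by (simp add: partial_mult partial_Var)
  then show "partial j (psum3 :: ('n, 'k) mpoly) = 3 * (Var j * Var j)" by (simp add: psum3_def partial_sum)
qed

lemma partial_symmetric_cubic:
  "partial j symmetric_cubic = 3 * (psum1 * psum1) - 3 * psum2 - 6 * (psum1 * Var j) + 6 * (Var j * Var j)"
  unfolding symmetric_cubic_def partial_add partial_diff partial_mult partial_numeral partial_psum
  by (simp add: algebra_simps)

text \<open>
  All coordinates of a critical point are roots of one quadratic polynomial, with roots \<open>a\<close> and \<open>b\<close>. If they occur \<open>x\<close>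
  and \<open>y\<close> times, then \<open>(x - 1) a + (y - 1) b = 0\<close> and \<open>(x - 1) a\<^sup>2 + (y - 1) b\<^sup>2 = 0\<close>.
\<close>

lemma symmetric_cubic_critical:
  fixes q :: "'k::field_char_0 ^ 'n::finite"
  assumes n: "CARD('n) \<ge> 3" and q: "\<forall>i. eval_mpoly (partial i symmetric_cubic) q = 0"
  shows "\<exists>j c. q = c *s unit_vec j"
proof (cases "q = 0")
  case True
  then show ?thesis by (intro exI[of _ undefined] exI[of _ 0]) simp
next
  case False
  define s where "s = (\<Sum>i\<in>UNIV. q $ i)"
  define t where "t = (\<Sum>i\<in>UNIV. q $ i * q $ i)"
  have eq: "s * s - t - 2 * (s * q $ i) + 2 * (q $ i * q $ i) = 0" for i
  proof -
    have "3 * (s * s) - 3 * t - 6 * (s * q $ i) + 6 * (q $ i * q $ i) = 0"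
      using spec[OF q, of i] by (simp add: partial_symmetric_cubic eval_simps psum1_def psum2_def s_def t_def)
    then have "3 * (s * s - t - 2 * (s * q $ i) + 2 * (q $ i * q $ i)) = 0" by algebra
    then show ?thesis using mult_eq_0_iff zero_neq_numeral by metis
  qed
  obtain i where i: "q $ i \<noteq> 0" using False by (auto simp: vec_eq_iff)
  define a where "a = q $ i"
  define b where "b = s - a"
  have ab: "q $ j = a \<or> q $ j = b" for j
  proof -
    have "(q $ j - a) * (q $ j - b) = 0"
    proof -
      have "2 * ((q $ j - a) * (q $ j - b)) = 0"
        using eq[of j] eq[of i] unfolding a_def[symmetric] b_def by algebra
      then show ?thesis by simp
    qed
    then show ?thesis by auto
  qed
  define J where "J = {j. q $ j = a}"
  define x where "x = card J"
  define y where "y = card (UNIV - J)"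
  have xy: "x + y = CARD('n)" unfolding x_def y_def
    using card_mono[of UNIV J] by (simp add: card_Diff_subset)
  have x1: "x \<ge> 1" unfolding x_def using card_gt_0_iff[of J] by (auto simp: J_def a_def Suc_le_eq)
  have out: "q $ j = b" if "j \<in> UNIV - J" for j using that ab[of j] by (auto simp: J_def)
  have split: "(\<Sum>j\<in>UNIV. h (q $ j)) = of_nat x * h a + of_nat y * h b" for h :: "'k \<Rightarrow> 'k"
  proof -
    have "(\<Sum>j\<in>UNIV. h (q $ j)) = (\<Sum>j\<in>J. h (q $ j)) + (\<Sum>j\<in>UNIV - J. h (q $ j))"
      by (metis (no_types, lifting) finite subset_UNIV sum.subset_diff add.commute)
    also have "(\<Sum>j\<in>J. h (q $ j)) = (\<Sum>j\<in>J. h a)" by (intro sum.cong) (auto simp: J_def)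
    also have "(\<Sum>j\<in>UNIV - J. h (q $ j)) = (\<Sum>j\<in>UNIV - J. h b)" by (intro sum.cong refl) (simp add: out)
    finally show ?thesis by (simp add: x_def y_def)
  qed
  have s_eq: "s = of_nat x * a + of_nat y * b" using split[of "\<lambda>z. z"] by (simp add: s_def)
  have t_eq: "t = of_nat x * (a * a) + of_nat y * (b * b)" using split[of "\<lambda>z. z * z"] by (simp add: t_def)
  have s_ab: "s = a + b" by (simp add: b_def)
  have "s * s - t - 2 * (s * a) + 2 * (a * a) = 0" using eq[of i] by (simp add: a_def)
  then have t_ab: "t = a * a + b * b" unfolding s_ab by (simp add: algebra_simps)
  have e1: "(of_nat x - 1) * a + (of_nat y - 1) * b = 0" using s_eq s_ab by (simp add: algebra_simps)
  have e2: "(of_nat x - 1) * (a * a) + (of_nat y - 1) * (b * b) = 0" using t_eq t_ab by (simp add: algebra_simps)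
  have e3: "(of_nat y - 1) * (b * (b - a)) = 0"
  proof -
    have "(of_nat y - 1) * (b * (b - a)) = ((of_nat x - 1) * (a * a) + (of_nat y - 1) * (b * b))
        - a * ((of_nat x - 1) * a + (of_nat y - 1) * b)" by (simp add: algebra_simps)
    then show ?thesis using e1 e2 by simp
  qed
  have a0: "a \<noteq> 0" using i by (simp add: a_def)
  have of1: "(of_nat m :: 'k) - 1 = 0 \<longleftrightarrow> m = 1" for m :: nat
    by (metis eq_iff_diff_eq_0 of_nat_1 of_nat_eq_iff)
  have "x = 1 \<and> (y \<noteq> 0 \<longrightarrow> b = 0)"
  proof (cases "b = 0")
    case True
    then have "(of_nat x - 1) * a = 0" using e1 by simp
    then show ?thesis using True a0 of1[of x] by simp
  next
    case b0: False
    show ?thesis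
    proof (cases "y = 1")
      case True
      then have "(of_nat x - 1) * a = 0" using e1 by simp
      then have "x = 1" using a0 of1[of x] by simp
      then show ?thesis using True xy n by simp
    next
      case False
      then have "b = a" using e3 b0 of1[of y] by auto
      then have "y = 0"
        using out card_0_eq[of "UNIV - J"] unfolding y_def J_def by (auto simp: card_eq_0_iff)
      then have "((of_nat x - 1) - 1) * a = 0" using e1 \<open>b = a\<close> by (simp add: algebra_simps)
      then have "(of_nat x :: 'k) = of_nat 2" using a0 by (simp add: algebra_simps)
      then have "x = 2" by (simp only: of_nat_eq_iff)
      then show ?thesis using xy n \<open>y = 0\<close> by simp
    qed
  qed
  then have J1: "card J = 1" and "b = 0" using xy n by (auto simp: x_def)
  from J1 obtain j where "J = {j}" by (rule card_1_singletonE)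
  have "q $ l = (a *s unit_vec j) $ l" for l
  proof (cases "l = j")
    case True
    then have "l \<in> J" using \<open>J = {j}\<close> by simp
    then have "q $ l = a" by (simp add: J_def)
    then show ?thesis using True by (simp add: unit_vec_def)
  next
    case False
    then have "q $ l = 0" using out[of l] \<open>J = {j}\<close> \<open>b = 0\<close> by simp
    then show ?thesis using False by (simp add: unit_vec_def)
  qed
  then have "q = a *s unit_vec j" by (simp add: vec_eq_iff)
  then show ?thesis by blast
qed

text \<open>
  At a coordinate point the Hessian has the entries \<open>0\<close> on the diagonal and \<open>6\<close> elsewhere. In \<open>n - 1 \<ge> 2\<close> variables
  this is nondegenerate.
\<close>

lemma nodal_cubic:
  assumes n: "CARD('n::finite) \<ge> 3"
  shows "proj_point smult_mpoly (symmetric_cubic :: ('n, 'k::{alg_closed_field,field_char_0}) mpoly) \<in> nodal_locus 3"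
proof (rule nodal_locusI[where A = "mat 1" and B = "mat 1" and p = unit_vec])
  let ?f = "symmetric_cubic :: ('n, 'k) mpoly"
  have sums: "(\<Sum>i\<in>UNIV. (unit_vec j :: 'k ^ 'n) $ i) = 1" "(\<Sum>i\<in>UNIV. (unit_vec j :: 'k ^ 'n) $ i * unit_vec j $ i) = 1" for j
    by (simp_all add: unit_vec_def if_distrib cong: if_cong)
  show sing: "eval_mpoly (partial i ?f) (unit_vec j) = 0" for i j
    by (simp add: partial_symmetric_cubic eval_simps psum1_def psum2_def sums) (simp add: unit_vec_def)
  show "\<forall>q. (\<forall>i. eval_mpoly (partial i ?f) q = 0) \<longrightarrow> (\<exists>j c. q = c *s unit_vec j)"
    using symmetric_cubic_critical[OF n] by blast
  show "is_node ?f (proj_point (*s) (unit_vec j))" for j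
    unfolding is_node_def Let_def
  proof (intro exI[of _ j] exI[of _ "unit_vec j"] conjI allI impI refl)
    show uj: "(unit_vec j :: 'k ^ 'n) $ j = 1" by (simp add: unit_vec_def)
    show "eval_mpoly (dehomogenize j ?f) (unit_vec j) = 0"
      unfolding eval_dehomogenize[OF uj] by (rule zero_of_gradient_zero[OF symmetric_cubic_graded _ sing]) simp
    show "eval_mpoly (partial i (dehomogenize j ?f)) (unit_vec j) = 0" if "i \<noteq> j" for i
      using that by (simp add: partial_dehomogenize eval_dehomogenize[OF uj] sing)
    fix v :: "'k ^ 'n"
    assume v: "v $ j = 0 \<and> (\<forall>i. i \<noteq> j \<longrightarrow>
      (\<Sum>l\<in>UNIV - {j}. eval_mpoly (partial i (partial l (dehomogenize j ?f))) (unit_vec j) * v $ l) = 0)"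
    have H: "eval_mpoly (partial i (partial l (dehomogenize j ?f))) (unit_vec j) = (if i = l then 0 else 6)"
      if "i \<noteq> j" "l \<noteq> j" for i l
    proof -
      have "eval_mpoly (partial i (partial l (dehomogenize j ?f))) (unit_vec j) = eval_mpoly (partial i (partial l ?f)) (unit_vec j)"
        using that by (simp add: partial_dehomogenize eval_dehomogenize[OF uj])
      also have "\<dots> = (if i = l then 0 else 6)"
        unfolding partial_symmetric_cubic partial_add partial_diff partial_mult partial_numeral partial_psum partial_Var
        using that by (simp add: eval_simps psum1_def sums) (simp add: unit_vec_def)
      finally show ?thesis .
    qed
    define \<sigma> where "\<sigma> = (\<Sum>l\<in>UNIV - {j}. v $ l)"
    have row: "v $ i = \<sigma>" if i: "i \<noteq> j" for i
    proof -
      have "0 = (\<Sum>l\<in>UNIV - {j}. eval_mpoly (partial i (partial l (dehomogenize j ?f))) (unit_vec j) * v $ l)"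
        using v i by simp
      also have "\<dots> = (\<Sum>l\<in>UNIV - {j}. 6 * v $ l - (if i = l then 6 * v $ i else 0))"
        using i by (intro sum.cong) (auto simp: H)
      also have "\<dots> = 6 * (\<sigma> - v $ i)"
        using i by (simp add: sum_subtractf \<sigma>_def sum_distrib_left algebra_simps)
      finally show ?thesis by simp
    qed
    have "\<sigma> = (\<Sum>l\<in>UNIV - {j}. \<sigma>)" unfolding \<sigma>_def[of] using row by (metis (no_types, lifting) DiffE \<sigma>_def insertI1 sum.cong)
    then have "\<sigma> = of_nat (CARD('n) - 1) * \<sigma>" by (simp add: card_Diff_singleton)
    then have "(of_nat (CARD('n) - 1) - 1) * \<sigma> = 0" by (simp add: algebra_simps)
    moreover have "(of_nat (CARD('n) - 1) :: 'k) - 1 = of_nat (CARD('n) - 2)" using n by (simp add: of_nat_diff)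
    moreover have "(of_nat (CARD('n) - 2) :: 'k) \<noteq> 0" unfolding of_nat_eq_0_iff using n by simp
    ultimately have "\<sigma> = 0" by (metis mult_eq_0_iff)
    then show "v = 0" using row v by (metis vec_eq_iff zero_index)
  qed
qed (auto simp: n symmetric_cubic_graded)

section \<open>Univariate polynomials with prescribed critical values\<close>

definition crit :: "'k::field poly \<Rightarrow> 'k set" where
  "crit P = {y. poly (pderiv P) y = 0}"

definition simple_crit :: "'k::field poly \<Rightarrow> 'k \<Rightarrow> 'k \<Rightarrow> bool" where
  "simple_crit P z v \<longleftrightarrow> poly P z = v \<and> poly (pderiv P) z = 0 \<and> poly (pderiv (pderiv P)) z \<noteq> 0"

lemma pderiv_nonzero:
  fixes P :: "'k::field_char_0 poly"
  assumes "degree P \<noteq> 0" shows "pderiv P \<noteq> 0"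
  using assms by (simp add: pderiv_eq_0_iff)

lemma finite_crit:
  fixes P :: "'k::field_char_0 poly"
  assumes "degree P \<noteq> 0" shows "finite (crit P)"
  unfolding crit_def by (intro poly_roots_finite pderiv_nonzero assms)

text \<open>
  Adding a multiple \<open>s W\<close> of a polynomial with double zeros at the critical points of \<open>q\<close> keeps these
  critical points and their values. At any other critical point \<open>y\<close> with value \<open>\<sigma>\<close>, eliminating \<open>s\<close>
  gives \<open>(q - \<sigma>) W' = W q'\<close>; this has finitely many solutions \<open>y\<close>, and each determines \<open>s\<close>.
\<close>

lemma perturb_critical_values:
  fixes q W :: "'k::field_char_0 poly"
  assumes deg: "0 < degree q" "degree q < degree W" and Z: "finite Z" "crit q \<subseteq> Z" and V: "finite V"
    and W: "\<forall>z\<in>Z. poly W z = 0 \<and> poly (pderiv W) z = 0"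
    and q: "\<forall>z\<in>Z. simple_crit q z (v z)"
  shows "\<exists>P. degree P = degree W \<and> (\<forall>z\<in>Z. simple_crit P z (v z)) \<and> (\<forall>y\<in>crit P. y \<notin> Z \<longrightarrow> poly P y \<notin> V)"
proof -
  define R where "R \<sigma> = (q - [:\<sigma>:]) * pderiv W - W * pderiv q" for \<sigma>
  have R: "R \<sigma> \<noteq> 0" for \<sigma>
  proof
    assume R0: "R \<sigma> = 0"
    let ?q = "q - [:\<sigma>:]"
    have dq: "degree ?q = degree q" using deg(1) by (cases q) (auto split: if_splits)
    have lq: "coeff [:\<sigma>:] (degree q) = 0" using deg(1) by (cases "degree q") auto
    have d1: "degree (pderiv W) = degree W - 1" "degree (pderiv q) = degree q - 1" by (auto simp: degree_pderiv)
    have e: "degree ?q + degree (pderiv W) = degree q + degree W - 1"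
      "degree W + degree (pderiv q) = degree q + degree W - 1" using deg by (auto simp: dq d1)
    have "coeff (?q * pderiv W) (degree q + degree W - 1) = lead_coeff q * (of_nat (degree W) * lead_coeff W)"
      using coeff_mult_degree_sum[of ?q "pderiv W"] deg by (simp only: e(1)) (simp add: dq lq d1 coeff_pderiv)
    moreover have "coeff (W * pderiv q) (degree q + degree W - 1) = lead_coeff W * (of_nat (degree q) * lead_coeff q)"
      using coeff_mult_degree_sum[of W "pderiv q"] deg by (simp only: e(2)) (simp add: d1 coeff_pderiv)
    ultimately have "lead_coeff q * (of_nat (degree W) * lead_coeff W) = lead_coeff W * (of_nat (degree q) * lead_coeff q)"
      using arg_cong[OF R0, of "\<lambda>p. coeff p (degree q + degree W - 1)"] by (simp add: R_def)
    then have "(of_nat (degree W) :: 'k) = of_nat (degree q)" using deg by auto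
    then show False using deg(2) by (simp only: of_nat_eq_iff)
  qed
  define bad where "bad = {0} \<union> (\<Union>\<sigma>\<in>V. (\<lambda>y. - poly (pderiv q) y / poly (pderiv W) y) ` {y. poly (R \<sigma>) y = 0})
    \<union> (\<Union>z\<in>Z. {- poly (pderiv (pderiv q)) z / poly (pderiv (pderiv W)) z})"
  have "finite bad" unfolding bad_def using V Z(1) poly_roots_finite[OF R] by auto
  then obtain s where s: "s \<notin> bad" using infinite_UNIV_char_0[where 'a = 'k] by (metis ex_new_if_finite)
  then have s0: "s \<noteq> 0" by (auto simp: bad_def)
  define P where "P = q + smult s W"
  have dP: "degree P = degree W"
    unfolding P_def using deg s0 by (simp add: degree_add_eq_right)
  have P': "pderiv P = pderiv q + smult s (pderiv W)" by (simp add: P_def pderiv_add pderiv_smult)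
  have P'': "pderiv (pderiv P) = pderiv (pderiv q) + smult s (pderiv (pderiv W))"
    by (simp add: P' pderiv_add pderiv_smult)
  show ?thesis
  proof (intro exI[of _ P] conjI ballI impI)
    show "degree P = degree W" by (rule dP)
  next
    fix z assume z: "z \<in> Z"
    have "poly (pderiv (pderiv P)) z \<noteq> 0"
    proof
      assume z0: "poly (pderiv (pderiv P)) z = 0"
      then have e: "poly (pderiv (pderiv q)) z = - s * poly (pderiv (pderiv W)) z"
        by (simp add: P'' eq_neg_iff_add_eq_0)
      then have "poly (pderiv (pderiv W)) z \<noteq> 0" using bspec[OF q z] by (auto simp: simple_crit_def)
      then have "s = - poly (pderiv (pderiv q)) z / poly (pderiv (pderiv W)) z" using e by simp
      then show False using s z by (auto simp: bad_def)
    qed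
    then show "simple_crit P z (v z)"
      using bspec[OF q z] bspec[OF W z] by (simp add: simple_crit_def P_def pderiv_add pderiv_smult)
  next
    fix y assume y: "y \<in> crit P" "y \<notin> Z"
    have e: "poly (pderiv q) y = - s * poly (pderiv W) y"
      using y(1) by (simp add: crit_def P' eq_neg_iff_add_eq_0)
    show "poly P y \<notin> V"
    proof
      assume v: "poly P y \<in> V"
      have "poly (pderiv W) y \<noteq> 0"
      proof
        assume "poly (pderiv W) y = 0"
        then have "y \<in> crit q" using e by (simp add: crit_def)
        then show False using y(2) Z(2) by blast
      qed
      then have "s = - poly (pderiv q) y / poly (pderiv W) y" using e by simp
      moreover have "poly (R (poly P y)) y = 0" by (simp add: R_def e P_def algebra_simps)
      ultimately show False using s v unfolding bad_def by blast
    qed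
  qed
qed

lemma double_zero:
  fixes U :: "'k::field poly"
  shows "poly ([:- z, 1:] ^ 2 * U) z = 0" "poly (pderiv ([:- z, 1:] ^ 2 * U)) z = 0"
proof -
  have "poly [:- z, 1:] z = 0" by simp
  then show "poly ([:- z, 1:] ^ 2 * U) z = 0" "poly (pderiv ([:- z, 1:] ^ 2 * U)) z = 0"
    by (simp_all only: power2_eq_square mult.assoc pderiv_mult poly_mult poly_add mult_zero_left mult_zero_right add_0)
qed

text \<open>
  The critical points of \<open>3 y\<^sup>2 - 2 y\<^sup>3\<close> are \<open>0\<close> and \<open>1\<close>, with values \<open>0\<close> and \<open>1\<close>. The perturbation by a polynomial of
  degree \<open>d\<close> with double zeros there creates further critical points, with values outside \<open>V\<close>.
\<close>

lemma exists_two_marked: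
  fixes V :: "'k::field_char_0 set"
  assumes d: "d \<ge> 4" and V: "finite V"
  shows "\<exists>P. degree P = d \<and> simple_crit P 0 0 \<and> simple_crit P 1 1 \<and> (\<forall>y\<in>crit P. y \<notin> {0, 1} \<longrightarrow> poly P y \<notin> V)"
proof -
  let ?q = "[:0, 0, 3, - 2:] :: 'k poly"
  let ?U = "[:0, 1:] ^ (d - 4) :: 'k poly"
  let ?W = "[:- 0, 1:] ^ 2 * ([:- 1, 1:] ^ 2 * ?U) :: 'k poly"
  have W1: "?W = [:- 1, 1:] ^ 2 * ([:- 0, 1:] ^ 2 * ?U)" by (rule mult.left_commute)
  have dW: "degree ?W = d" using d by (simp add: degree_mult_eq degree_power_eq)
  have q': "pderiv ?q = [:0, 6, - 6:]" "pderiv [:0, 6, - 6 :: 'k:] = [:6, - 12:]" by (simp_all add: pderiv_pCons)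
  have crit: "crit ?q \<subseteq> {0, 1}"
  proof
    fix y assume "y \<in> crit ?q"
    then have "6 * (y * (1 - y)) = 0" by (simp add: crit_def q' algebra_simps)
    then show "y \<in> {0, 1}" by simp
  qed
  have q: "simple_crit ?q z z" if "z \<in> {0, 1}" for z
    using that by (auto simp: simple_crit_def q')
  have w0: "poly ?W 0 = 0 \<and> poly (pderiv ?W) 0 = 0"
    using double_zero[of 0 "[:- 1, 1:] ^ 2 * ?U"] by (rule conjI)
  have w1: "poly ?W 1 = 0 \<and> poly (pderiv ?W) 1 = 0"
    unfolding W1 using double_zero[of 1 "[:- 0, 1:] ^ 2 * ?U"] by (rule conjI)
  have W: "poly ?W z = 0 \<and> poly (pderiv ?W) z = 0" if z: "z \<in> {0, 1}" for z
  proof -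
    consider "z = 0" | "z = 1" using z by blast
    then show ?thesis by cases (erule ssubst, rule w0, erule ssubst, rule w1)
  qed
  have Z: "finite {0, 1 :: 'k}" by simp
  have dq: "0 < degree ?q" "degree ?q < degree ?W" unfolding dW using d by simp_all
  have W': "\<forall>z\<in>{0, 1}. poly ?W z = 0 \<and> poly (pderiv ?W) z = 0"
    and q': "\<forall>z\<in>{0, 1}. simple_crit ?q z z" by (intro ballI W q; assumption)+
  obtain P where P: "degree P = degree ?W" "\<forall>z\<in>{0, 1}. simple_crit P z z"
    "\<forall>y\<in>crit P. y \<notin> {0, 1} \<longrightarrow> poly P y \<notin> V"
    using perturb_critical_values[OF dq Z crit V W' q'] by (elim exE conjE)
  have deg: "degree P = d" using P(1) dW by (simp only:)
  have s: "simple_crit P 0 0" "simple_crit P 1 1" using P(2) by simp_all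
  show ?thesis using deg s P(3) by (intro exI[of _ P] conjI)
qed

text \<open>
  The polynomial \<open>2 y\<^sup>2 - y\<^sup>4\<close> has the critical points \<open>0\<close>, \<open>1\<close> and \<open>- 1\<close>. A perturbation with three double zeros has
  degree at least \<open>6\<close>. In degree \<open>5\<close> the polynomial with derivative \<open>y (1 - y) (y + 2) (5 y + 7) / 4\<close> has the
  additional critical point \<open>- 7 / 5\<close>, whose value \<open>1 + 648 / 3125\<close> is not of the form \<open>1 - m\<close>.
\<close>

lemma exists_three_marked:
  assumes d: "d \<ge> 4"
  shows "\<exists>(P :: 'k::field_char_0 poly) b. degree P = d \<and> b \<noteq> 0 \<and> b \<noteq> 1
    \<and> simple_crit P 0 0 \<and> simple_crit P 1 1 \<and> simple_crit P b 1
    \<and> (\<forall>y\<in>crit P. \<forall>m\<le>r. y \<notin> {0, 1, b} \<longrightarrow> poly P y \<noteq> 1 - of_nat m)"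
proof -
  have witness: ?thesis if "degree P = d" "b \<noteq> 0" "b \<noteq> 1" "simple_crit P 0 0" "simple_crit P 1 1" "simple_crit P b 1"
    "\<And>y m. y \<in> crit P \<Longrightarrow> y \<notin> {0, 1, b} \<Longrightarrow> m \<le> r \<Longrightarrow> poly P y \<noteq> 1 - of_nat m" for P :: "'k poly" and b
    by (intro exI[of _ P] exI[of _ b] conjI ballI allI impI; rule that; assumption)
  let ?q = "[:0, 0, 2, 0, - 1:] :: 'k poly"
  let ?v = "\<lambda>z :: 'k. if z = 0 then 0 else 1 :: 'k"
  have q': "pderiv ?q = [:0, 4, 0, - 4:]" "pderiv [:0, 4, 0, - 4 :: 'k:] = [:4, 0, - 12:]" by (simp_all add: pderiv_pCons)
  have crit: "crit ?q \<subseteq> {0, 1, - 1}"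
  proof
    fix y assume "y \<in> crit ?q"
    then have "4 * (y * ((1 - y) * (1 + y))) = 0" by (simp add: crit_def q' algebra_simps)
    then show "y \<in> {0, 1, - 1}" by (auto simp: eq_neg_iff_add_eq_0 add.commute)
  qed
  have q: "simple_crit ?q z (?v z)" if "z \<in> {0, 1, - 1}" for z
    using that by (auto simp: simple_crit_def q')
  consider "d = 4" | "d = 5" | "d \<ge> 6" using d by linarith
  then show ?thesis
  proof cases
    case 1
    have deg: "degree ?q = d" using 1 by simp
    have s: "simple_crit ?q 0 0" "simple_crit ?q 1 1" "simple_crit ?q (- 1) 1"
      using q[of 0] q[of 1] q[of "- 1"] by simp_all
    have other: "poly ?q y \<noteq> 1 - of_nat m" if "y \<in> crit ?q" "y \<notin> {0, 1, - 1}" for y and m :: nat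
      using that crit by blast
    show ?thesis by (rule witness[OF deg _ _ s other]) simp_all
  next
    case 2
    let ?N = "[:0, 0, 7, 1, - 3, - 1:] :: 'k poly" and ?N1 = "[:0, 14, 3, - 12, - 5:] :: 'k poly"
    let ?P = "smult (1 / 4) ?N"
    have N': "pderiv ?N = ?N1" "pderiv ?N1 = [:14, 6, - 36, - 20:]" by (simp_all add: pderiv_pCons)
    have P': "pderiv ?P = smult (1 / 4) ?N1" "pderiv (smult (1 / 4) ?N1) = smult (1 / 4) [:14, 6, - 36, - 20:]"
      by (simp_all only: pderiv_smult N')
    have deg: "degree ?P = d" using 2 by simp
    have s0: "simple_crit ?P 0 0" and s1: "simple_crit ?P 1 1" and s2: "simple_crit ?P (- 2) 1"
      unfolding simple_crit_def P' poly_smult by simp_all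
    have other: "poly ?P y \<noteq> 1 - of_nat m" if y: "y \<in> crit ?P" "y \<notin> {0, 1, - 2}" for y and m :: nat
    proof -
      have "(1 / 4) * poly ?N1 y = 0" using y(1) unfolding crit_def P' poly_smult mem_Collect_eq .
      then have N1: "poly ?N1 y = 0" by (simp only: mult_eq_0_iff) simp
      have "y * ((1 - y) * ((y + 2) * (5 * y + 7))) = poly ?N1 y" by (simp add: algebra_simps)
      also note N1
      finally have "y * ((1 - y) * ((y + 2) * (5 * y + 7))) = 0" .
      moreover have "y \<noteq> 0" "1 - y \<noteq> 0" "y + 2 \<noteq> 0" using y(2) by (auto simp: eq_neg_iff_add_eq_0)
      ultimately have "5 * y + 7 = 0" unfolding mult_eq_0_iff by blast
      then have "5 * y = - 7" by (simp only: eq_neg_iff_add_eq_0)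
      then have "y = - 7 / 5" by (metis nonzero_mult_div_cancel_left zero_neq_numeral)
      then have v: "poly ?P y = 1 + 648 / 3125" by simp
      show ?thesis
      proof
        assume "poly ?P y = 1 - of_nat m"
        then have "3125 * (1 + 648 / 3125) = (3125 * (1 - of_nat m) :: 'k)" unfolding v by (rule arg_cong)
        then have "- (3125 * of_nat m) = (648 :: 'k)" by (simp add: right_diff_distrib)
        then have "648 + 3125 * of_nat m = (0 :: 'k)" by (metis add.left_inverse)
        then have "of_nat (648 + 3125 * m) = (0 :: 'k)" by simp
        then show False unfolding of_nat_eq_0_iff by simp
      qed
    qed
    show ?thesis by (rule witness[OF deg _ _ s0 s1 s2 other]) simp_all
  next
    case 3
    let ?U = "[:0, 1:] ^ (d - 6) :: 'k poly"
    let ?a = "[:- 0, 1:] ^ 2 :: 'k poly" and ?b = "[:- 1, 1:] ^ 2 :: 'k poly" and ?c = "[:- (- 1), 1:] ^ 2 :: 'k poly"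
    let ?W = "?a * (?b * (?c * ?U))"
    have W1: "?W = ?b * (?a * (?c * ?U))" by (rule mult.left_commute)
    have "?W = ?a * (?c * (?b * ?U))" by (rule arg_cong[OF mult.left_commute])
    also have "\<dots> = ?c * (?a * (?b * ?U))" by (rule mult.left_commute)
    finally have W2: "?W = ?c * (?a * (?b * ?U))" .
    have dW: "degree ?W = d" using 3 by (simp add: degree_mult_eq degree_power_eq)
    have w0: "poly ?W 0 = 0 \<and> poly (pderiv ?W) 0 = 0"
      using double_zero[of 0 "?b * (?c * ?U)"] by (rule conjI)
    have w1: "poly ?W 1 = 0 \<and> poly (pderiv ?W) 1 = 0"
      unfolding W1 using double_zero[of 1 "?a * (?c * ?U)"] by (rule conjI)
    have w2: "poly ?W (- 1) = 0 \<and> poly (pderiv ?W) (- 1) = 0"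
      unfolding W2 using double_zero[of "- 1" "?a * (?b * ?U)"] by (rule conjI)
    have W: "poly ?W z = 0 \<and> poly (pderiv ?W) z = 0" if z: "z \<in> {0, 1, - 1}" for z
    proof -
      consider "z = 0" | "z = 1" | "z = - 1" using z by blast
      then show ?thesis by cases (erule ssubst, rule w0, erule ssubst, rule w1, erule ssubst, rule w2)
    qed
    have dq: "0 < degree ?q" "degree ?q < degree ?W" unfolding dW using 3 by simp_all
    let ?V = "(\<lambda>m. 1 - of_nat m) ` {..r} :: 'k set"
    have Z: "finite {0, 1, - 1 :: 'k}" and fin: "finite ?V" by simp_all
    have W': "\<forall>z\<in>{0, 1, - 1}. poly ?W z = 0 \<and> poly (pderiv ?W) z = 0"
      and q': "\<forall>z\<in>{0, 1, - 1}. simple_crit ?q z (?v z)" by (intro ballI W q; assumption)+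
    obtain P where P: "degree P = degree ?W" "\<forall>z\<in>{0, 1, - 1}. simple_crit P z (?v z)"
      "\<forall>y\<in>crit P. y \<notin> {0, 1, - 1} \<longrightarrow> poly P y \<notin> ?V"
      using perturb_critical_values[OF dq Z crit fin W' q'] by (elim exE conjE)
    have deg: "degree P = d" using P(1) dW by (simp only:)
    have s: "simple_crit P 0 0" "simple_crit P 1 1" "simple_crit P (- 1) 1"
      using P(2) by simp_all
    have other: "poly P y \<noteq> 1 - of_nat m" if "y \<in> crit P" "y \<notin> {0, 1, - 1}" "m \<le> r" for y m
      using P(3) that by blast
    show ?thesis by (rule witness[OF deg _ _ s other]) simp_all
  qed
qed

text \<open>
  The polynomials \<open>Q i\<close> are chosen one after the other, each avoiding the finitely many values which,
  together with critical values of the earlier ones, would give an unwanted solution of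
  \<open>\<Sum>Q i (x i) = 1\<close>. The number \<open>m\<close> makes room for the values \<open>1\<close> of the polynomials chosen later.
\<close>

lemma exists_separated_family:
  fixes P :: "'k::field_char_0 poly" and a :: 'n
  assumes d: "d \<ge> 4" and degP: "degree P = d"
    and P: "\<forall>y\<in>crit P. \<forall>m\<le>R. y \<notin> M \<longrightarrow> poly P y \<noteq> 1 - of_nat m"
    and I: "finite I" "a \<notin> I"
  shows "card I \<le> R \<Longrightarrow> \<exists>Q. Q a = P \<and> (\<forall>i\<in>I. degree (Q i) = d \<and> simple_crit (Q i) 0 0 \<and> simple_crit (Q i) 1 1)
    \<and> (\<forall>x m. (\<forall>i\<in>insert a I. x i \<in> crit (Q i)) \<longrightarrow> m + card I \<le> R
      \<longrightarrow> (\<Sum>i\<in>insert a I. poly (Q i) (x i)) = 1 - of_nat m \<longrightarrow> x a \<in> M \<and> (\<forall>i\<in>I. x i \<in> {0, 1}))"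
  using I
proof (induction I rule: finite_induct)
  case empty
  then show ?case using P by (intro exI[of _ "\<lambda>_. P"]) auto
next
  case (insert i I)
  have ia: "i \<noteq> a" "a \<notin> I" "i \<notin> I" "card I \<le> R" using insert.hyps insert.prems by auto
  obtain Q where Q: "Q a = P" "\<forall>j\<in>I. degree (Q j) = d \<and> simple_crit (Q j) 0 0 \<and> simple_crit (Q j) 1 1"
    "\<forall>x m. (\<forall>j\<in>insert a I. x j \<in> crit (Q j)) \<longrightarrow> m + card I \<le> R
      \<longrightarrow> (\<Sum>j\<in>insert a I. poly (Q j) (x j)) = 1 - of_nat m \<longrightarrow> x a \<in> M \<and> (\<forall>j\<in>I. x j \<in> {0, 1})"
    using insert.IH[OF ia(4) ia(2)] by (elim exE conjE)
  define S where "S = (\<lambda>x. \<Sum>j\<in>insert a I. poly (Q j) (x j)) ` (\<Pi>\<^sub>E j\<in>insert a I. crit (Q j))"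
  have "finite (crit (Q j))" if "j \<in> insert a I" for j
    using that Q(1,2) degP d by (intro finite_crit) auto
  then have "finite S" unfolding S_def using insert(1) by (intro finite_imageI finite_PiE) auto
  have S: "(\<Sum>j\<in>insert a I. poly (Q j) (x j)) \<in> S" if x: "\<forall>j\<in>insert a I. x j \<in> crit (Q j)" for x
  proof -
    have "(\<Sum>j\<in>insert a I. poly (Q j) (x j)) = (\<Sum>j\<in>insert a I. poly (Q j) (restrict x (insert a I) j))"
      by (intro sum.cong) auto
    moreover have "restrict x (insert a I) \<in> (\<Pi>\<^sub>E j\<in>insert a I. crit (Q j))" using x by auto
    ultimately show ?thesis unfolding S_def by (rule image_eqI)
  qed
  define V where "V = (\<lambda>(m, s). 1 - of_nat m - s) ` ({..R} \<times> S)"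
  have "finite V" unfolding V_def using \<open>finite S\<close> by simp
  obtain N where N: "degree N = d" "simple_crit N 0 0" "simple_crit N 1 1"
    "\<forall>y\<in>crit N. y \<notin> {0, 1} \<longrightarrow> poly N y \<notin> V"
    using exists_two_marked[OF d \<open>finite V\<close>] by (elim exE conjE)
  define Q' where "Q' = Q(i := N)"
  have Q'_eq: "Q' j = Q j" if "j \<in> insert a I" for j using that ia by (auto simp: Q'_def)
  have "x a \<in> M \<and> (\<forall>j\<in>insert i I. x j \<in> {0, 1})"
    if x: "\<forall>j\<in>insert a (insert i I). x j \<in> crit (Q' j)" and m: "m + card (insert i I) \<le> R"
      and sum: "(\<Sum>j\<in>insert a (insert i I). poly (Q' j) (x j)) = 1 - of_nat m" for x m
  proof -
    have x': "\<forall>j\<in>insert a I. x j \<in> crit (Q j)" using x Q'_eq by auto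
    have xi: "x i \<in> crit N" using x by (auto simp: Q'_def)
    have "(\<Sum>j\<in>insert a (insert i I). poly (Q' j) (x j)) = (\<Sum>j\<in>insert i (insert a I). poly (Q' j) (x j))"
      by (simp only: insert_commute)
    also have "\<dots> = poly N (x i) + (\<Sum>j\<in>insert a I. poly (Q' j) (x j))"
      using ia insert(1) by (simp add: Q'_def)
    also have "(\<Sum>j\<in>insert a I. poly (Q' j) (x j)) = (\<Sum>j\<in>insert a I. poly (Q j) (x j))"
      by (intro sum.cong refl) (simp only: Q'_eq)
    finally have s: "poly N (x i) + (\<Sum>j\<in>insert a I. poly (Q j) (x j)) = 1 - of_nat m" using sum by simp
    have xi01: "x i = 0 \<or> x i = 1"
    proof (rule ccontr)
      assume "\<not> (x i = 0 \<or> x i = 1)"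
      then have "poly N (x i) \<notin> V" using N(4) xi by blast
      moreover have "poly N (x i) = 1 - of_nat m - (\<Sum>j\<in>insert a I. poly (Q j) (x j))"
        using s by (simp add: algebra_simps)
      ultimately show False using S[OF x'] m unfolding V_def by force
    qed
    then have "\<exists>m'. m' + card I \<le> R \<and> (\<Sum>j\<in>insert a I. poly (Q j) (x j)) = 1 - of_nat m'"
    proof
      assume "x i = 0"
      then show ?thesis using s N(2) m insert(1,2) by (intro exI[of _ m]) (simp add: simple_crit_def)
    next
      assume "x i = 1"
      then have "1 + (\<Sum>j\<in>insert a I. poly (Q j) (x j)) = 1 - of_nat m" using s N(3) by (simp add: simple_crit_def)
      then have "(\<Sum>j\<in>insert a I. poly (Q j) (x j)) = 1 - of_nat (Suc m)"
        by (simp add: algebra_simps eq_neg_iff_add_eq_0)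
      then show ?thesis using m insert(1,2) by (intro exI[of _ "Suc m"]) simp
    qed
    then have "x a \<in> M \<and> (\<forall>j\<in>I. x j \<in> {0, 1})" using Q(3) x' by blast
    then show ?thesis using xi01 by auto
  qed
  then show ?case
    using Q(1,2) N ia by (intro exI[of _ Q']) (auto simp: Q'_def)
qed

section \<open>Nodal hypersurfaces of degree at least four\<close>

text \<open>The homogenization of \<open>P(x\<^sub>i)\<close> in degree \<open>d\<close> by the variable \<open>x\<^sub>z\<close>.\<close>

definition hom_poly :: "nat \<Rightarrow> 'k::field poly \<Rightarrow> 'n::finite \<Rightarrow> 'n \<Rightarrow> ('n, 'k) mpoly" where
  "hom_poly d P i z = (\<Sum>k\<le>d. Const (coeff P k) * (Var i ^ k * Var z ^ (d - k)))"

definition separated_form :: "nat \<Rightarrow> 'n::finite \<Rightarrow> ('n \<Rightarrow> 'k::field poly) \<Rightarrow> ('n, 'k) mpoly" where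
  "separated_form d z Q = (\<Sum>i\<in>UNIV - {z}. hom_poly d (Q i) i z) - Var z ^ d"

lemma Var_power_graded: "Var i ^ k \<in> graded_piece k"
  using graded_power[OF graded_Var, of i k] by simp

lemma separated_form_graded: "separated_form d z Q \<in> graded_piece d"
proof -
  have "Const c * (Var i ^ k * Var z ^ (d - k)) \<in> graded_piece d" if "k \<in> {..d}" for c i k
    using graded_mult[OF graded_Const[of c] graded_mult[OF Var_power_graded[of i k] Var_power_graded[of z "d - k"]]] that
    by simp
  then show ?thesis
    unfolding separated_form_def hom_poly_def by (intro graded_diff graded_sum Var_power_graded) blast
qed

lemma partial_power: "partial j (p ^ Suc k) = Const (of_nat (Suc k)) * p ^ k * partial j p"
proof (induction k)
  case (Suc k)
  have c: "Const (of_nat (Suc (Suc k))) = 1 + Const (of_nat (Suc k))"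
    using Const_simps(3)[of 1 "of_nat (Suc k)"] by simp
  have "partial j (p ^ Suc (Suc k)) = p ^ Suc k * partial j p + p * partial j (p ^ Suc k)"
    by (subst power_Suc) (simp only: partial_mult mult.commute)
  also have "\<dots> = Const (of_nat (Suc (Suc k))) * p ^ Suc k * partial j p"
    unfolding Suc.IH c by (simp add: algebra_simps)
  finally show ?case .
qed simp

lemma partial_hom_poly:
  fixes i j z :: "'n::finite" and P :: "'k::field poly"
  assumes "i \<noteq> z"
  shows "partial i (hom_poly (Suc d) P i z) = hom_poly d (pderiv P) i z"
    "j \<noteq> i \<Longrightarrow> j \<noteq> z \<Longrightarrow> partial j (hom_poly d P i z) = 0"
proof -
  have 0: "partial j (Var l ^ k :: ('n, 'k) mpoly) = 0" if "j \<noteq> l" for j l k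
    using that by (cases k) (simp_all add: partial_power partial_Var del: power_Suc)
  have 1: "partial i (Var i ^ Suc k :: ('n, 'k) mpoly) = Const (of_nat (Suc k)) * Var i ^ k" for k
    by (simp add: partial_power partial_Var del: power_Suc of_nat_Suc)
  have c: "Const (coeff P (Suc k)) * (Const (of_nat (Suc k)) * x :: ('n, 'k) mpoly) = Const (coeff (pderiv P) k) * x" for k x
    by (simp only: mult.assoc[symmetric] mult_single) (simp add: coeff_pderiv mult.commute del: of_nat_Suc)
  note c = c[unfolded single_of_nat]
  show "partial i (hom_poly (Suc d) P i z) = hom_poly d (pderiv P) i z"
    unfolding hom_poly_def sum.atMost_Suc_shift partial_add partial_sum
    using assms by (simp add: partial_mult 0 1 c mult.assoc del: power_Suc of_nat_Suc)
  show "partial j (hom_poly d P i z) = 0" if "j \<noteq> i" "j \<noteq> z"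
    unfolding hom_poly_def partial_sum partial_mult using that by (simp add: 0)
qed

lemma partial_separated_form:
  assumes "j \<noteq> z"
  shows "partial j (separated_form (Suc d) z Q) = hom_poly d (pderiv (Q j)) j z"
proof -
  have "partial j (Var z ^ Suc d) = 0" using assms by (simp add: partial_power partial_Var del: power_Suc)
  moreover have "(\<Sum>i\<in>UNIV - {z}. partial j (hom_poly (Suc d) (Q i) i z))
      = (\<Sum>i\<in>UNIV - {z}. if i = j then hom_poly d (pderiv (Q j)) j z else 0)"
    using assms by (intro sum.cong refl) (auto simp: partial_hom_poly)
  ultimately show ?thesis
    using assms unfolding separated_form_def partial_diff partial_sum by simp
qed

lemma eval_hom_poly:
  fixes p :: "'k::field ^ 'n::finite"
  assumes "p $ z = 1" "degree P \<le> d"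
  shows "eval_mpoly (hom_poly d P i z) p = poly P (p $ i)"
proof -
  have "eval_mpoly (hom_poly d P i z) p = (\<Sum>k\<le>d. coeff P k * (p $ i) ^ k)"
    unfolding hom_poly_def by (simp add: eval_simps assms(1))
  also have "\<dots> = (\<Sum>k\<le>degree P. coeff P k * (p $ i) ^ k)"
    using assms(2) by (intro sum.mono_neutral_right) (auto simp: coeff_eq_0)
  finally show ?thesis by (simp add: poly_altdef)
qed

lemma eval_hom_poly_infinity:
  fixes p :: "'k::field ^ 'n::finite"
  assumes "p $ z = 0"
  shows "eval_mpoly (hom_poly d P i z) p = coeff P d * (p $ i) ^ d"
proof -
  have "eval_mpoly (hom_poly d P i z) p = (\<Sum>k\<le>d. if k = d then coeff P d * (p $ i) ^ d else 0)"
    unfolding hom_poly_def eval_simps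
    by (intro sum.cong refl) (auto simp: eval_simps assms power_0_left)
  then show ?thesis by simp
qed

context
  fixes Q :: "'n::finite \<Rightarrow> 'k::{alg_closed_field,field_char_0} poly" and z :: 'n and d e :: nat
  assumes deg: "\<forall>i. i \<noteq> z \<longrightarrow> degree (Q i) = d" and d: "d = Suc (Suc e)"
begin

lemma eval_partial_separated:
  fixes p :: "'k ^ 'n"
  assumes "p $ z = 1" "i \<noteq> z"
  shows "eval_mpoly (partial i (separated_form d z Q)) p = poly (pderiv (Q i)) (p $ i)"
  unfolding d partial_separated_form[OF assms(2)]
  by (rule eval_hom_poly) (use assms deg d in \<open>auto simp: degree_pderiv\<close>)

lemma eval_separated:
  fixes p :: "'k ^ 'n"
  assumes "p $ z = 1"
  shows "eval_mpoly (separated_form d z Q) p = (\<Sum>i\<in>UNIV - {z}. poly (Q i) (p $ i)) - 1"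
proof -
  have "(\<Sum>i\<in>UNIV - {z}. eval_mpoly (hom_poly d (Q i) i z) p) = (\<Sum>i\<in>UNIV - {z}. poly (Q i) (p $ i))"
    by (intro sum.cong refl eval_hom_poly assms) (use deg in auto)
  then show ?thesis unfolding separated_form_def by (simp add: eval_simps assms)
qed

text \<open>
  No critical point lies on \<open>x\<^sub>z = 0\<close>, because there the other partial derivatives are nonzero multiples
  of \<open>x\<^sub>i\<^sup>d\<^sup>-\<^sup>1\<close>. On the chart \<open>x\<^sub>z = 1\<close>, Euler's identity makes the form vanish at critical points.
\<close>

lemma separated_critical:
  fixes q :: "'k ^ 'n"
  assumes q: "\<forall>i. eval_mpoly (partial i (separated_form d z Q)) q = 0" "q \<noteq> 0"
  shows "\<exists>p. q = q $ z *s p \<and> p $ z = 1 \<and> (\<forall>i. i \<noteq> z \<longrightarrow> p $ i \<in> crit (Q i))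
    \<and> (\<Sum>i\<in>UNIV - {z}. poly (Q i) (p $ i)) = 1"
proof -
  let ?f = "separated_form d z Q"
  have qz: "q $ z \<noteq> 0"
  proof
    assume z0: "q $ z = 0"
    have "q $ i = 0" for i
    proof (cases "i = z")
      case False
      have "coeff (pderiv (Q i)) (Suc e) * (q $ i) ^ Suc e = 0"
        using spec[OF q(1), of i] unfolding d partial_separated_form[OF False] eval_hom_poly_infinity[OF z0] .
      moreover have "coeff (pderiv (Q i)) (Suc e) = of_nat d * lead_coeff (Q i)"
        using deg False by (simp add: coeff_pderiv d del: of_nat_Suc)
      moreover have "lead_coeff (Q i) \<noteq> 0"
        using spec[OF deg, of i] False d by (intro leading_coeff_neq_0) auto
      moreover have "(of_nat d :: 'k) \<noteq> 0" unfolding of_nat_eq_0_iff d by simp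
      ultimately show ?thesis by auto
    qed (simp add: z0)
    then show False using q(2) by (simp add: vec_eq_iff)
  qed
  define p where "p = (1 / q $ z) *s q"
  have p: "q = q $ z *s p" "p $ z = 1" using qz by (simp_all add: p_def vector_smult_assoc)
  have 0: "eval_mpoly (partial i ?f) p = 0" for i
    unfolding p_def eval_scale[OF graded_partial[OF separated_form_graded]] spec[OF q(1)] by simp
  have "eval_mpoly ?f p = 0" by (rule zero_of_gradient_zero[OF separated_form_graded _ 0]) (simp add: d)
  then have "(\<Sum>i\<in>UNIV - {z}. poly (Q i) (p $ i)) = 1" unfolding eval_separated[OF p(2)] by simp
  moreover have "p $ i \<in> crit (Q i)" if "i \<noteq> z" for i
    using 0[of i] unfolding eval_partial_separated[OF p(2) that] crit_def by simp
  ultimately show ?thesis using p by blast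
qed

text \<open>
  The transversal Hessian of a separated form is diagonal.
\<close>

lemma separated_node:
  fixes p :: "'k ^ 'n"
  assumes p: "p $ z = 1" "\<forall>i. i \<noteq> z \<longrightarrow> simple_crit (Q i) (p $ i) (v i)" and v: "sum v (UNIV - {z}) = 1"
  shows "eval_mpoly (partial i (separated_form d z Q)) p = 0"
    "is_node (separated_form d z Q) (proj_point (*s) p)"
proof -
  let ?f = "separated_form d z Q"
  have 1: "eval_mpoly (partial j ?f) p = 0" if "j \<noteq> z" for j
    using p that by (simp add: eval_partial_separated simple_crit_def)
  have "(\<Sum>j\<in>UNIV - {z}. poly (Q j) (p $ j)) = sum v (UNIV - {z})"
    using p(2) by (intro sum.cong refl) (simp add: simple_crit_def)
  then have 0: "eval_mpoly ?f p = 0" by (simp add: eval_separated p(1) v)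
  have "0 = (\<Sum>j\<in>UNIV. p $ j * eval_mpoly (partial j ?f) p)"
    using arg_cong[OF euler_identity[OF separated_form_graded], of "\<lambda>h. eval_mpoly h p" d z Q]
    by (simp add: eval_simps 0)
  also have "\<dots> = (\<Sum>j\<in>UNIV. if j = z then eval_mpoly (partial z ?f) p else 0)"
    by (intro sum.cong refl) (simp add: 1 p(1))
  finally have z: "eval_mpoly (partial z ?f) p = 0" by simp
  show "eval_mpoly (partial i ?f) p = 0" using 1 z by (cases "i = z") simp_all
  show "is_node ?f (proj_point (*s) p)"
    unfolding is_node_def Let_def
  proof (intro exI[of _ z] exI[of _ p] conjI allI impI refl)
    show "p $ z = 1" by (rule p(1))
    show "eval_mpoly (dehomogenize z ?f) p = 0" unfolding eval_dehomogenize[OF p(1)] by (rule 0)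
    show "eval_mpoly (partial j (dehomogenize z ?f)) p = 0" if "j \<noteq> z" for j
      using that by (simp add: partial_dehomogenize eval_dehomogenize[OF p(1)] 1)
    fix w :: "'k ^ 'n"
    assume w: "w $ z = 0 \<and> (\<forall>j. j \<noteq> z \<longrightarrow>
      (\<Sum>l\<in>UNIV - {z}. eval_mpoly (partial j (partial l (dehomogenize z ?f))) p * w $ l) = 0)"
    have H: "eval_mpoly (partial j (partial l (dehomogenize z ?f))) p
        = (if l = j then poly (pderiv (pderiv (Q j))) (p $ j) else 0)" if "j \<noteq> z" "l \<noteq> z" for j l
    proof -
      have "eval_mpoly (partial j (partial l (dehomogenize z ?f))) p = eval_mpoly (partial j (partial l ?f)) p"
        using that by (simp add: partial_dehomogenize eval_dehomogenize[OF p(1)])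
      also have "\<dots> = eval_mpoly (partial j (hom_poly (Suc e) (pderiv (Q l)) l z)) p"
        unfolding d partial_separated_form[OF that(2)] ..
      also have "\<dots> = (if l = j then poly (pderiv (pderiv (Q j))) (p $ j) else 0)"
      proof (cases "l = j")
        case True
        have "eval_mpoly (hom_poly e (pderiv (pderiv (Q j))) j z) p = poly (pderiv (pderiv (Q j))) (p $ j)"
          by (rule eval_hom_poly[OF p(1)]) (use deg that d in \<open>simp add: degree_pderiv\<close>)
        then show ?thesis by (simp add: True partial_hom_poly(1)[OF that(1)])
      next
        case False
        then show ?thesis using that by (simp add: partial_hom_poly(2)[OF that(2)] eval_simps)
      qed
      finally show ?thesis .
    qed
    have "w $ j = 0" for j
    proof (cases "j = z")
      case False
      have "0 = (\<Sum>l\<in>UNIV - {z}. eval_mpoly (partial j (partial l (dehomogenize z ?f))) p * w $ l)"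
        using w False by simp
      also have "\<dots> = (\<Sum>l\<in>UNIV - {z}. if l = j then poly (pderiv (pderiv (Q j))) (p $ j) * w $ j else 0)"
        using False by (intro sum.cong refl) (simp add: H)
      also have "\<dots> = poly (pderiv (pderiv (Q j))) (p $ j) * w $ j" using False by simp
      finally show ?thesis using p(2) False by (simp add: simple_crit_def)
    qed (use w in simp)
    then show "w = 0" by (simp add: vec_eq_iff)
  qed
qed

end

text \<open>
  In the chart \<open>x\<^sub>z = 1\<close> the hypersurface is \<open>\<Sum>Q\<^sub>i(x\<^sub>i) = 1\<close>, and a singular point is a choice of critical
  points whose critical values add up to \<open>1\<close>. By the choice of the \<open>Q\<^sub>i\<close> all of them are marked points, with
  values \<open>0\<close> and \<open>1\<close>, so exactly one coordinate has the value \<open>1\<close>. The marked point of \<open>Q\<^sub>i\<close> with this value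
  is \<open>1\<close>, which gives \<open>n - 1\<close> nodes; \<open>Q\<^sub>a\<close> has a second one, \<open>b\<close>, which gives the \<open>n\<close>-th node.
\<close>

lemma nodal_hypersurface_exists:
  assumes n: "CARD('n::finite) \<ge> 3" and d: "d \<ge> 4"
  shows "\<exists>f :: ('n, 'k::{alg_closed_field,field_char_0}) mpoly. proj_point smult_mpoly f \<in> nodal_locus d"
proof -
  define z :: 'n where "z = undefined"
  have "card (UNIV - {z}) \<noteq> 0" using n by (simp add: card_Diff_singleton)
  then have "UNIV - {z} \<noteq> {}" by (metis card.empty)
  then obtain a where za: "a \<noteq> z" by blast
  define I where "I = UNIV - {z, a}"
  have ins: "insert a I = UNIV - {z}" "a \<notin> I" and I: "finite I" "a \<notin> I" using za by (auto simp: I_def)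
  obtain P :: "'k poly" and b where P: "degree P = d" "b \<noteq> 0" "b \<noteq> 1"
    "simple_crit P 0 0" "simple_crit P 1 1" "simple_crit P b 1"
    "\<forall>y\<in>crit P. \<forall>m\<le>card I. y \<notin> {0, 1, b} \<longrightarrow> poly P y \<noteq> 1 - of_nat m"
    using exists_three_marked[OF d, of "card I"] by (elim exE conjE)
  let ?M = "{0, 1, b}"
  obtain Q where Q: "Q a = P" "\<forall>i\<in>I. degree (Q i) = d \<and> simple_crit (Q i) 0 0 \<and> simple_crit (Q i) 1 1"
    "\<forall>x m. (\<forall>i\<in>insert a I. x i \<in> crit (Q i)) \<longrightarrow> m + card I \<le> card I
      \<longrightarrow> (\<Sum>i\<in>insert a I. poly (Q i) (x i)) = 1 - of_nat m \<longrightarrow> x a \<in> ?M \<and> (\<forall>i\<in>I. x i \<in> {0, 1})"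
    using exists_separated_family[OF d P(1) P(7) I order_refl] by (elim exE conjE)
  have in_I: "i = a \<or> i \<in> I" if "i \<noteq> z" for i using that by (auto simp: I_def)
  have Qs: "simple_crit (Q i) 0 0" "simple_crit (Q i) 1 1" "degree (Q i) = d" if "i \<noteq> z" for i
    using in_I[OF that] Q(1,2) P(1,4,5) by auto
  define e where "e = d - 2"
  have e: "d = Suc (Suc e)" using d by (simp add: e_def)
  have deg: "\<forall>i. i \<noteq> z \<longrightarrow> degree (Q i) = d" using Qs(3) by blast
  let ?f = "separated_form d z Q"
  \<comment> \<open>The nodes \<open>e\<^sub>z + e\<^sub>j\<close> for \<open>j \<noteq> z\<close>, and \<open>e\<^sub>z + b e\<^sub>a\<close> for \<open>j = z\<close>.\<close>
  define v :: "'n \<Rightarrow> 'k ^ 'n" where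
    "v j = (\<chi> i. if i = z then 1 else if j = z then (if i = a then b else 0) else if i = j then 1 else 0)" for j
  define A where "A = (\<chi> i j. v j $ i)"
  have vA: "v j = A *v unit_vec j" for j by (simp add: mult_unit_vec A_def vec_eq_iff)
  have ker: "\<forall>x. A *v x = 0 \<longrightarrow> x = 0"
  proof (intro allI impI)
    fix x assume x: "A *v x = 0"
    have row: "(\<Sum>j\<in>UNIV. v j $ i * x $ j) = 0" for i
      using arg_cong[OF x, of "\<lambda>y. y $ i"] by (simp add: matrix_vector_mult_def A_def)
    have xI: "x $ i = 0" if "i \<in> I" for i
    proof -
      have "(\<Sum>j\<in>UNIV. v j $ i * x $ j) = (\<Sum>j\<in>UNIV. if j = i then x $ i else 0)"
        using that by (intro sum.cong refl) (auto simp: v_def I_def)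
      then show ?thesis using row[of i] by simp
    qed
    have "(\<Sum>j\<in>UNIV. v j $ a * x $ j) = (\<Sum>j\<in>UNIV. (if j = z then b * x $ z else 0) + (if j = a then x $ a else 0))"
      using za by (intro sum.cong refl) (auto simp: v_def)
    then have ra: "b * x $ z + x $ a = 0" using row[of a] by (simp add: sum.distrib)
    have "(\<Sum>j\<in>UNIV. v j $ z * x $ j) = (\<Sum>j\<in>UNIV. (if j = z then x $ z else 0) + (if j = a then x $ a else 0))"
      using za xI in_I by (intro sum.cong refl) (auto simp: v_def)
    then have rz: "x $ z + x $ a = 0" using row[of z] by (simp add: sum.distrib)
    have "(b - 1) * x $ z = (b * x $ z + x $ a) - (x $ z + x $ a)" by (simp add: algebra_simps)
    then have "(b - 1) * x $ z = 0" unfolding ra rz by simp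
    then have "x $ z = 0" using P(3) by simp
    then show "x = 0" using rz xI in_I by (metis add_0 vec_eq_iff zero_index)
  qed
  obtain B where "B ** A = mat 1" using iffD2[OF matrix_left_invertible_ker ker] by (elim exE)
  then have AB: "A ** B = mat 1" using matrix_left_right_inverse by blast
  define val :: "'n \<Rightarrow> 'n \<Rightarrow> 'k" where "val j i = (if i = (if j = z then a else j) then 1 else 0)" for i j
  have v_simple: "\<forall>i. i \<noteq> z \<longrightarrow> simple_crit (Q i) (v j $ i) (val j i)" for j
  proof (intro allI impI)
    fix i assume i: "i \<noteq> z"
    consider "j = z" "i = a" | "j = z" "i \<noteq> a" | "j \<noteq> z" "i = j" | "j \<noteq> z" "i \<noteq> j" by blast
    then show "simple_crit (Q i) (v j $ i) (val j i)"
      by cases (use i Qs(1,2)[OF i] P(6) Q(1) in \<open>simp_all add: v_def val_def\<close>)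
  qed
  have vz: "v j $ z = 1" for j by (simp add: v_def)
  have val_sum: "sum (val j) (UNIV - {z}) = 1" for j using za by (simp add: val_def)
  note node = separated_node[OF deg e vz v_simple val_sum]
  have zeros: "\<exists>j c. q = c *s v j" if q: "\<forall>i. eval_mpoly (partial i ?f) q = 0" for q
  proof (cases "q = 0")
    case True
    then show ?thesis by (intro exI[of _ z] exI[of _ 0]) simp
  next
    case False
    obtain p where p: "q = q $ z *s p" "p $ z = 1" "\<forall>i. i \<noteq> z \<longrightarrow> p $ i \<in> crit (Q i)"
      "(\<Sum>i\<in>UNIV - {z}. poly (Q i) (p $ i)) = 1"
      using separated_critical[OF deg e q False] by (elim exE conjE)
    have "\<forall>i\<in>insert a I. p $ i \<in> crit (Q i)" using p(3) ins(1) by blast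
    moreover have "(\<Sum>i\<in>insert a I. poly (Q i) (p $ i)) = 1 - of_nat 0" using p(4) unfolding ins(1) by simp
    ultimately have pm: "p $ a \<in> ?M" "\<forall>i\<in>I. p $ i \<in> {0, 1}"
      using spec[OF spec[OF Q(3), of "\<lambda>i. p $ i"], of 0] by simp_all
    define N where "N = {i \<in> UNIV - {z}. p $ i \<noteq> 0}"
    have "poly (Q i) (p $ i) = (if i \<in> N then 1 else 0)" if "i \<in> UNIV - {z}" for i
      using in_I[of i] that pm Qs[of i] Q(1) P(4-6) by (auto simp: N_def simple_crit_def)
    then have "(\<Sum>i\<in>UNIV - {z}. poly (Q i) (p $ i)) = (\<Sum>i\<in>UNIV - {z}. if i \<in> N then 1 else 0)"
      by (intro sum.cong refl)
    also have "\<dots> = of_nat (card N)" by (simp add: sum.If_cases N_def Int_def)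
    finally have "of_nat (card N) = (of_nat 1 :: 'k)" using p(4) by simp
    then have "card N = 1" unfolding of_nat_eq_iff .
    then obtain j where j: "N = {j}" by (rule card_1_singletonE)
    then have jz: "j \<noteq> z" "p $ j \<noteq> 0" by (auto simp: N_def)
    have out: "p $ i = 0" if "i \<noteq> z" "i \<noteq> j" for i
      using that j unfolding N_def by blast
    consider "p $ j = 1" | "j = a" "p $ j = b" using in_I[OF jz(1)] pm jz(2) by auto
    then have "p = v j \<or> p = v z"
    proof cases
      case 1
      then have "p $ i = v j $ i" for i using out p(2) jz(1) by (auto simp: v_def)
      then show ?thesis by (simp add: vec_eq_iff)
    next
      case 2
      then have "p $ i = v z $ i" for i using out p(2) jz(1) by (auto simp: v_def)
      then show ?thesis by (simp add: vec_eq_iff)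
    qed
    then show ?thesis using p(1) by blast
  qed
  have "proj_point smult_mpoly ?f \<in> nodal_locus d"
    by (rule nodal_locusI[OF separated_form_graded _ n AB vA node(1) _ node(2)]) (use d zeros in auto)
  then show ?thesis by (rule exI)
qed

theorem theorem3p8:
  fixes d :: nat
  assumes "CARD('n::finite) \<ge> 3" and "d \<ge> 3"
  shows "(nodal_locus d :: ('n, 'k::{alg_closed_field, field_char_0}) mpoly set set)
           \<subseteq> VA_red_locus d
         \<and> (VA_red_locus d :: ('n, 'k) mpoly set set) \<noteq> {}"
proof
  show incl: "(nodal_locus d :: ('n, 'k) mpoly set set) \<subseteq> VA_red_locus d"
    by (rule nodal_locus_subset[OF assms])
  have "(nodal_locus d :: ('n, 'k) mpoly set set) \<noteq> {}"
  proof (cases "d = 3")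
    case True
    then show ?thesis using nodal_cubic[OF assms(1), where 'k = 'k] by auto
  next
    case False
    then have "d \<ge> 4" using assms(2) by simp
    obtain f :: "('n, 'k) mpoly" where "proj_point smult_mpoly f \<in> nodal_locus d"
      using nodal_hypersurface_exists[OF assms(1) \<open>d \<ge> 4\<close>, where 'k = 'k] by (elim exE)
    then show ?thesis by blast
  qed
  then show "(VA_red_locus d :: ('n, 'k) mpoly set set) \<noteq> {}" using incl by blast
qed

end
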